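(* There exist separable complex Hilbert spaces $\mathcal{H}_1,\mathcal{H}_2$, masas $\mathcal{D}_1\subset\mathcal{B}(\mathcal{H}_1)$, $\mathcal{D}_2\subset\mathcal{B}(\mathcal{H}_2)$, and a reflexive $\mathcal{D}_2,\mathcal{D}_1$-bimodule $\mathcal{M}\subseteq\mathcal{B}(\mathcal{H}_1,\mathcal{H}_2)$ which is thin and not synthetic.
   Context: A masa is a maximal abelian selfadjoint algebra of operators. A $\mathcal{D}_2,\mathcal{D}_1$-bimodule is a subspace $\mathcal{U}\subseteq\mathcal{B}(\mathcal{H}_1,\mathcal{H}_2)$ with $\mathcal{D}_2\mathcal{U}\mathcal{D}_1\subseteq\mathcal{U}$. Let $\mathcal{P}_i$ be the lattice of orthogonal projections on $\mathcal{H}_i$. For a subspace $\mathcal{U}\subseteq\mathcal{B}(\mathcal{H}_1,\mathcal{H}_2)$, $\mathrm{Map}\,\mathcal{U}:\mathcal{P}_1\to\mathcal{P}_2$ sends $P$ to the projection onto the closed linear span of $\{Sx:S\in\mathcal{U},x\in P\mathcal{H}_1\}$. A subspace $\mathcal{U}$ is reflexive if $\mathcal{U}=\{T\in\mathcal{B}(\mathcal{H}_1,\mathcal{H}_2):\varphi(P)^\perp TP=0\ \forall P\in\mathcal{P}_1\}$ for some map $\varphi:\mathcal{P}_1\to\mathcal{P}_2$ that satisfies $\varphi(0)=0$ and preserves arbitrary suprema (equivalently, this holds with $\varphi=\mathrm{Map}\,\mathcal{U}$). A reflexive $\mathcal{D}_2,\mathcal{D}_1$-bimodule $\mathcal{M}$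 is synthetic if it is the only weak*-closed $\mathcal{D}_2,\mathcal{D}_1$-bimodule $\mathcal{U}$ with $\mathrm{Map}\,\mathcal{U}=\mathrm{Map}\,\mathcal{M}$. It is thin if the biggest algebras over which $\mathcal{M}$ is a bimodule are the masas, i.e. $\{A\in\mathcal{B}(\mathcal{H}_1):\mathcal{M}A\subseteq\mathcal{M}\}=\mathcal{D}_1$ and $\{B\in\mathcal{B}(\mathcal{H}_2):B\mathcal{M}\subseteq\mathcal{M}\}=\mathcal{D}_2$. *)

theory Defs
  imports
    "HOL-Analysis.Analysis"
    "HOL-Algebra.Module"
    "HOL-Algebra.Complete_Lattice"
begin

text \<open>
  Hilbert spaces are structures with an explicit carrier rather than types, so that a statement
  can quantify existentially over them. A separable Hilbert space has at most continuum many elements,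
  so each one has an isometric copy with carrier in \<^typ>\<open>nat \<Rightarrow> complex\<close>. The underlying vector space is a module over the ring
  \<open>complex_ring\<close>; the multiplicative fields of the module record play no role.
\<close>

definition complex_ring :: "complex ring" where
  "complex_ring = \<lparr>carrier = UNIV, mult = (*), one = 1, zero = 0, add = (+)\<rparr>"

record 'a cinner_space = "(complex, 'a) module" +
  cinner :: "'a \<Rightarrow> 'a \<Rightarrow> complex"

definition hnorm :: "('a, 'm) cinner_space_scheme \<Rightarrow> 'a \<Rightarrow> real" where
  "hnorm H x = sqrt (Re (cinner H x x))"

text \<open>The value outside the carrier is fixed because \<^locale>\<open>Metric_space\<close> asks for nonnegativity
  and symmetry on the whole type.\<close>

definition hdist :: "('a, 'm) cinner_space_scheme \<Rightarrow> 'a \<Rightarrow> 'a \<Rightarrow> real" where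
  "hdist H x y = (if x \<in> carrier H \<and> y \<in> carrier H then hnorm H (x \<ominus>\<^bsub>H\<^esub> y) else 0)"

abbreviation htop :: "('a, 'm) cinner_space_scheme \<Rightarrow> 'a topology" where
  "htop H \<equiv> Metric_space.mtopology (carrier H) (hdist H)"

locale complex_inner_product_space = Module.module complex_ring H for H (structure) +
  assumes cinner_commute:
      "\<lbrakk>x \<in> carrier H; y \<in> carrier H\<rbrakk> \<Longrightarrow> cinner H x y = cnj (cinner H y x)"
    and cinner_add_left:
      "\<lbrakk>x \<in> carrier H; y \<in> carrier H; z \<in> carrier H\<rbrakk>
        \<Longrightarrow> cinner H (x \<oplus> y) z = cinner H x z + cinner H y z"
    and cinner_smult_left:
      "\<lbrakk>x \<in> carrier H; y \<in> carrier H\<rbrakk> \<Longrightarrow> cinner H (c \<odot>\<^bsub>H\<^esub> x) y = c * cinner H x y"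
    and cinner_pos:
      "\<lbrakk>x \<in> carrier H; x \<noteq> \<zero>\<rbrakk> \<Longrightarrow> 0 < Re (cinner H x x)"
begin

lemma cinner_zero_left: "y \<in> carrier H \<Longrightarrow> cinner H \<zero> y = 0"
  using cinner_add_left[of \<zero> \<zero> y] by simp

lemma cinner_minus_left:
  assumes "x \<in> carrier H" "y \<in> carrier H"
  shows "cinner H (\<ominus> x) y = - cinner H x y"
  using cinner_add_left[of x "\<ominus> x" y] assms cinner_zero_left[of y]
  by (simp add: M.r_neg add_eq_0_iff)

lemma cinner_add_right:
  assumes "x \<in> carrier H" "y \<in> carrier H" "z \<in> carrier H"
  shows "cinner H x (y \<oplus> z) = cinner H x y + cinner H x z"
  using assms cinner_commute[of x] cinner_add_left[of y z x] by simp

lemma cinner_smult_right: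
  assumes "x \<in> carrier H" "y \<in> carrier H"
  shows "cinner H x (c \<odot>\<^bsub>H\<^esub> y) = cnj c * cinner H x y"
  using assms cinner_commute[of x] cinner_smult_left[of y x c] smult_closed[of c y]
  by (simp add: complex_ring_def)

lemma cinner_self_nonneg: "x \<in> carrier H \<Longrightarrow> 0 \<le> Re (cinner H x x)"
  using cinner_pos[of x] cinner_zero_left[of \<zero>] by (cases "x = \<zero>") auto

lemma hnorm_nonneg: "x \<in> carrier H \<Longrightarrow> 0 \<le> hnorm H x"
  by (simp add: hnorm_def cinner_self_nonneg)

lemma hnorm_eq_0_iff: "x \<in> carrier H \<Longrightarrow> hnorm H x = 0 \<longleftrightarrow> x = \<zero>"
  using cinner_pos[of x] cinner_zero_left[of \<zero>] by (cases "x = \<zero>") (auto simp: hnorm_def)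

lemma hnorm_minus: "x \<in> carrier H \<Longrightarrow> hnorm H (\<ominus> x) = hnorm H x"
  using cinner_commute[of x "\<ominus> x"] cinner_minus_left[of x x] cinner_minus_left[of x "\<ominus> x"]
  by (simp add: hnorm_def)

lemma Re_cinner_le:
  assumes x: "x \<in> carrier H" and y: "y \<in> carrier H"
  shows "Re (cinner H x y) \<le> hnorm H x * hnorm H y"
proof -
  let ?a = "hnorm H x" and ?b = "hnorm H y"
  have cl: "complex_of_real t \<odot>\<^bsub>H\<^esub> z \<in> carrier H" if "z \<in> carrier H" for t z
    using that smult_closed[of "complex_of_real t" z] by (simp add: complex_ring_def)
  have sq: "Re (cinner H x x) = ?a\<^sup>2" "Re (cinner H y y) = ?b\<^sup>2"
    using x y by (simp_all add: hnorm_def cinner_self_nonneg)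
  have comm: "Re (cinner H y x) = Re (cinner H x y)"
    using cinner_commute[OF y x] by simp
  have "0 \<le> Re (cinner H (complex_of_real ?b \<odot>\<^bsub>H\<^esub> x \<oplus> complex_of_real (- ?a) \<odot>\<^bsub>H\<^esub> y)
                        (complex_of_real ?b \<odot>\<^bsub>H\<^esub> x \<oplus> complex_of_real (- ?a) \<odot>\<^bsub>H\<^esub> y))"
    by (intro cinner_self_nonneg M.add.m_closed cl x y)
  also have "\<dots> = ?b\<^sup>2 * ?a\<^sup>2 + ?a\<^sup>2 * ?b\<^sup>2 - 2 * (?a * ?b) * Re (cinner H x y)"
    using x y cl[OF x] cl[OF y] comm sq
    by (simp del: of_real_minus add: cinner_add_left cinner_add_right cinner_smult_left
        cinner_smult_right algebra_simps power2_eq_square)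
  finally have "(?a * ?b) * Re (cinner H x y) \<le> (?a * ?b) * (?a * ?b)"
    by (simp add: power2_eq_square algebra_simps)
  moreover have "0 < ?a * ?b \<or> x = \<zero> \<or> y = \<zero>"
    using hnorm_nonneg hnorm_eq_0_iff x y by (metis less_eq_real_def mult_pos_pos)
  moreover have "cinner H x \<zero> = 0"
    using cinner_commute[of x \<zero>] cinner_zero_left x by simp
  ultimately show ?thesis
    using x y cinner_zero_left[OF y] hnorm_nonneg[OF x] hnorm_nonneg[OF y]
    by (auto simp: mult_le_cancel_left_pos)
qed

lemma hnorm_triangle:
  assumes x: "x \<in> carrier H" and y: "y \<in> carrier H"
  shows "hnorm H (x \<oplus> y) \<le> hnorm H x + hnorm H y"
proof (rule power2_le_imp_le)
  have sq: "(hnorm H z)\<^sup>2 = Re (cinner H z z)" if "z \<in> carrier H" for z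
    using that by (simp add: hnorm_def cinner_self_nonneg)
  have "Re (cinner H y x) = Re (cinner H x y)"
    using cinner_commute[OF y x] by simp
  then show "(hnorm H (x \<oplus> y))\<^sup>2 \<le> (hnorm H x + hnorm H y)\<^sup>2"
    using x y Re_cinner_le[OF x y]
    by (simp add: sq power2_sum cinner_add_left cinner_add_right)
  show "0 \<le> hnorm H x + hnorm H y"
    using hnorm_nonneg x y by simp
qed

sublocale metric: Metric_space "carrier H" "hdist H"
proof
  show "0 \<le> hdist H x y" for x y
    by (simp add: hdist_def hnorm_nonneg)
  show "hdist H x y = hdist H y x" for x y
    using hnorm_minus[of "x \<ominus> y"]
    by (auto simp: hdist_def a_minus_def M.minus_add M.a_comm)
  show "hdist H x y = 0 \<longleftrightarrow> x = y" if "x \<in> carrier H" "y \<in> carrier H" for x y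
    using that M.minus_equality[of x "\<ominus> y"] M.r_neg[of y]
    by (auto simp: hdist_def hnorm_eq_0_iff a_minus_def)
  show "hdist H x z \<le> hdist H x y + hdist H y z"
    if "x \<in> carrier H" "y \<in> carrier H" "z \<in> carrier H" for x y z
  proof -
    have "x \<ominus> z = (x \<ominus> y) \<oplus> (y \<ominus> z)"
      using that by (simp add: a_minus_def M.a_assoc M.r_neg1 M.l_neg)
    then show ?thesis
      using that hnorm_triangle[of "x \<ominus> y" "y \<ominus> z"] by (simp add: hdist_def)
  qed
qed

end

locale complex_hilbert_space = complex_inner_product_space +
  assumes complete: "metric.mcomplete"

definition closed_lin_span :: "('a, 'm) cinner_space_scheme \<Rightarrow> 'a set \<Rightarrow> 'a set" where
  "closed_lin_span H X = htop H closure_of (\<Inter>{V. submodule V complex_ring H \<and> X \<subseteq> V})"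


text \<open>Operators are extensional, i.e. \<^const>\<open>undefined\<close> off the carrier of their domain, so that
  equality of operators is equality of functions.\<close>

definition bounded_op ::
  "('a, 'm) cinner_space_scheme \<Rightarrow> ('b, 'n) cinner_space_scheme \<Rightarrow> ('a \<Rightarrow> 'b) set" where
  "bounded_op H K = {T \<in> carrier H \<rightarrow>\<^sub>E carrier K.
     (\<forall>x\<in>carrier H. \<forall>y\<in>carrier H. T (x \<oplus>\<^bsub>H\<^esub> y) = T x \<oplus>\<^bsub>K\<^esub> T y) \<and>
     (\<forall>c. \<forall>x\<in>carrier H. T (c \<odot>\<^bsub>H\<^esub> x) = c \<odot>\<^bsub>K\<^esub> T x) \<and>
     (\<exists>C. \<forall>x\<in>carrier H. hnorm K (T x) \<le> C * hnorm H x)}"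

definition op_space ::
  "('a, 'm) cinner_space_scheme \<Rightarrow> ('b, 'n) cinner_space_scheme \<Rightarrow> (complex, 'a \<Rightarrow> 'b) module" where
  "op_space H K = \<lparr>carrier = bounded_op H K, mult = undefined, one = undefined,
     zero = (\<lambda>x\<in>carrier H. \<zero>\<^bsub>K\<^esub>), add = (\<lambda>S T. \<lambda>x\<in>carrier H. S x \<oplus>\<^bsub>K\<^esub> T x),
     smult = (\<lambda>c T. \<lambda>x\<in>carrier H. c \<odot>\<^bsub>K\<^esub> T x)\<rparr>"

definition is_adjoint ::
  "('a, 'm) cinner_space_scheme \<Rightarrow> ('b, 'n) cinner_space_scheme \<Rightarrow> ('a \<Rightarrow> 'b) \<Rightarrow> ('b \<Rightarrow> 'a) \<Rightarrow> bool"
  where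
  "is_adjoint H K T S \<longleftrightarrow> T \<in> bounded_op H K \<and> S \<in> bounded_op K H \<and>
     (\<forall>x\<in>carrier H. \<forall>y\<in>carrier K. cinner K (T x) y = cinner H x (S y))"

text \<open>The weak* topology of \<open>B(H, K)\<close> as the dual of the trace class operators from \<open>K\<close> to \<open>H\<close>.
  These are the operators \<open>A z = \<Sum>n. \<langle>z, y n\<rangle> x n\<close> with \<open>x\<close>, \<open>y\<close> square summable, and the trace
  pairing of \<open>T\<close> with \<open>A\<close> is \<open>tr (T A) = \<Sum>n. \<langle>T (x n), y n\<rangle>\<close>.\<close>

definition weak_star ::
  "('a, 'm) cinner_space_scheme \<Rightarrow> ('b, 'n) cinner_space_scheme \<Rightarrow> ('a \<Rightarrow> 'b) topology" where
  "weak_star H K = topology_generated_by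
     {{T \<in> bounded_op H K. (\<Sum>n. cinner K (T (x n)) (y n)) \<in> W} | x y W.
        range x \<subseteq> carrier H \<and> summable (\<lambda>n::nat. (hnorm H (x n))\<^sup>2) \<and>
        range y \<subseteq> carrier K \<and> summable (\<lambda>n. (hnorm K (y n))\<^sup>2) \<and> open (W :: complex set)}"


definition projs :: "('a, 'm) cinner_space_scheme \<Rightarrow> ('a \<Rightarrow> 'a) set" where
  "projs H = {P \<in> bounded_op H H. compose (carrier H) P P = P \<and> is_adjoint H H P P}"

definition proj_lattice :: "('a, 'm) cinner_space_scheme \<Rightarrow> ('a \<Rightarrow> 'a) gorder" where
  "proj_lattice H = \<lparr>carrier = projs H, eq = (=),
     le = (\<lambda>P Q. P ` carrier H \<subseteq> Q ` carrier H)\<rparr>"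

definition proj_onto :: "('a, 'm) cinner_space_scheme \<Rightarrow> 'a set \<Rightarrow> ('a \<Rightarrow> 'a)" where
  "proj_onto H V = (THE P. P \<in> projs H \<and> P ` carrier H = V)"

definition proj_perp :: "('a, 'm) cinner_space_scheme \<Rightarrow> ('a \<Rightarrow> 'a) \<Rightarrow> ('a \<Rightarrow> 'a)" where
  "proj_perp H P = (\<lambda>x\<in>carrier H. x \<ominus>\<^bsub>H\<^esub> P x)"

definition Map ::
  "('a, 'm) cinner_space_scheme \<Rightarrow> ('b, 'n) cinner_space_scheme \<Rightarrow> ('a \<Rightarrow> 'b) set
    \<Rightarrow> ('a \<Rightarrow> 'a) \<Rightarrow> ('b \<Rightarrow> 'b)" where
  "Map H K U = (\<lambda>P\<in>projs H. proj_onto K (closed_lin_span K {S x | S x. S \<in> U \<and> x \<in> P ` carrier H}))"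

definition reflexive ::
  "('a, 'm) cinner_space_scheme \<Rightarrow> ('b, 'n) cinner_space_scheme \<Rightarrow> ('a \<Rightarrow> 'b) set \<Rightarrow> bool" where
  "reflexive H K U \<longleftrightarrow> (\<exists>\<phi> \<in> projs H \<rightarrow> projs K.
     \<phi> \<zero>\<^bsub>op_space H H\<^esub> = \<zero>\<^bsub>op_space K K\<^esub> \<and>
     sup_pres (proj_lattice H) (proj_lattice K) \<phi> \<and>
     U = {T \<in> bounded_op H K. \<forall>P\<in>projs H.
            compose (carrier H) (proj_perp K (\<phi> P)) (compose (carrier H) T P) = \<zero>\<^bsub>op_space H K\<^esub>})"


definition abelian_selfadjoint_algebra ::
  "('a, 'm) cinner_space_scheme \<Rightarrow> ('a \<Rightarrow> 'a) set \<Rightarrow> bool" where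
  "abelian_selfadjoint_algebra H D \<longleftrightarrow>
     submodule D complex_ring (op_space H H) \<and>
     (\<forall>A\<in>D. \<forall>B\<in>D. compose (carrier H) A B \<in> D) \<and>
     (\<forall>A\<in>D. \<forall>B\<in>D. compose (carrier H) A B = compose (carrier H) B A) \<and>
     (\<forall>A\<in>D. \<exists>B\<in>D. is_adjoint H H A B)"

definition masa :: "('a, 'm) cinner_space_scheme \<Rightarrow> ('a \<Rightarrow> 'a) set \<Rightarrow> bool" where
  "masa H D \<longleftrightarrow> abelian_selfadjoint_algebra H D \<and>
     (\<forall>D'. abelian_selfadjoint_algebra H D' \<and> D \<subseteq> D' \<longrightarrow> D' = D)"

text \<open>In the following, \<open>D2\<close> acts on the left (on \<open>K\<close>) and \<open>D1\<close> on the right (on \<open>H\<close>).\<close>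

definition bimodule ::
  "('a, 'm) cinner_space_scheme \<Rightarrow> ('b, 'n) cinner_space_scheme
    \<Rightarrow> ('b \<Rightarrow> 'b) set \<Rightarrow> ('a \<Rightarrow> 'a) set \<Rightarrow> ('a \<Rightarrow> 'b) set \<Rightarrow> bool" where
  "bimodule H K D2 D1 U \<longleftrightarrow> submodule U complex_ring (op_space H K) \<and>
     (\<forall>B\<in>D2. \<forall>T\<in>U. \<forall>A\<in>D1. compose (carrier H) B (compose (carrier H) T A) \<in> U)"

definition synthetic ::
  "('a, 'm) cinner_space_scheme \<Rightarrow> ('b, 'n) cinner_space_scheme
    \<Rightarrow> ('b \<Rightarrow> 'b) set \<Rightarrow> ('a \<Rightarrow> 'a) set \<Rightarrow> ('a \<Rightarrow> 'b) set \<Rightarrow> bool" where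
  "synthetic H K D2 D1 M \<longleftrightarrow>
     {U. bimodule H K D2 D1 U \<and> closedin (weak_star H K) U \<and> Map H K U = Map H K M} = {M}"

definition thin ::
  "('a, 'm) cinner_space_scheme \<Rightarrow> ('b, 'n) cinner_space_scheme
    \<Rightarrow> ('b \<Rightarrow> 'b) set \<Rightarrow> ('a \<Rightarrow> 'a) set \<Rightarrow> ('a \<Rightarrow> 'b) set \<Rightarrow> bool" where
  "thin H K D2 D1 M \<longleftrightarrow>
     {A \<in> bounded_op H H. \<forall>T\<in>M. compose (carrier H) T A \<in> M} = D1 \<and>
     {B \<in> bounded_op K K. \<forall>T\<in>M. compose (carrier H) B T \<in> M} = D2"

end

theory Submission
  imports Defs
begin

text \<open>
  The example is the operator version of the failure of spectral synthesis for a level set of a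
  smooth function (Schwartz for the sphere, Malliavin for infinite products). Let \<open>G\<close>
  be the Cantor group of all \<open>x = (x\<^sub>0, x\<^sub>1, \<dots>)\<close> with
  \<open>x\<^sub>k\<close> in \<open>{0, 1}\<close>. Its dual group is \<open>nat\<close> with
  \<open>XOR\<close>, a number being the set of its binary digits, so \<open>L\<^sup>2(G)\<close> is
  seen through Fourier coefficients as the space \<open>ell2\<close> of square summable sequences.
  Everything below is done on this side. The multiplication by the Walsh function of index
  \<open>k\<close> becomes \<open>shift k\<close>. The masa \<open>L\<^sup>\<infinity>(G)\<close>
  becomes the commutant \<open>conv_ops\<close> of the shifts, and the convolution by a distribution
  with Fourier coefficients \<open>t\<close> becomes the diagonal operator \<open>diag t\<close>.

  Let \<open>h\<close> be the sum of \<open>M / (k + 1)\<^sup>2 * r\<^sub>k\<close> over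
  \<open>k \<ge> 2\<close> with Rademacher functions \<open>r\<^sub>k\<close>. The Fourier
  coefficients of \<open>exp (i u h)\<close> are products of factors \<open>cos\<close> and
  \<open>i sin\<close>. About \<open>sqrt u\<close> of these factors have modulus below a fixed
  constant \<open>< 1\<close> whatever the index, so the coefficients decay fast in
  \<open>u\<close>, uniformly in the index (\<open>phase_coeff_decay\<close>). Thus the sum over all
  integers \<open>u\<close> of these coefficients, \<open>level_symbol\<close>, is bounded. It
  belongs to a positive measure \<open>\<nu>\<^sub>0\<close> on the level set \<open>h = 0\<close>
  modulo \<open>2 \<pi>\<close>. The measure \<open>\<nu>\<^sub>c\<close> on the level
  \<open>h = c\<close> depends differentiably on \<open>c\<close>, and \<open>level_deriv\<close>,
  the sum of \<open>u\<close> times the coefficients, belongs up to the factor \<open>- i\<close> to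
  its derivative at \<open>c = 0\<close>. Two facts collide.

  \<^item> The derivative cannot be separated from \<open>\<nu>\<^sub>0\<close> by sets. Let
    \<open>P\<close> and \<open>Q\<close> be projections of the masa that annihilate the convolution
    by \<open>\<nu>\<^sub>0\<close>. The function
    \<open>F c = \<langle>\<nu>\<^sub>c * P 1, Q 1\<rangle>\<close> is nonnegative because
    \<open>\<nu>\<^sub>c\<close> is positive, and \<open>F 0 = 0\<close>. So \<open>F\<close> has a
    minimum at \<open>0\<close>, and \<open>F' 0 = 0\<close>
    (\<open>derivative_0_at_minimum\<close>). Hence the convolution by the derivative lies in the
    reflexive hull.

  \<^item> The multiplication of the kernel of an operator by \<open>exp (i h (x + y)) - 1\<close>
    is a weak* continuous map of bimodules, since the Fourier series of \<open>exp (i h)\<close>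
    converges absolutely. It annihilates the convolution by \<open>\<nu>\<^sub>0\<close> but sends
    the one by \<open>\<nu>\<^sub>0'\<close> to a multiple of the one by
    \<open>\<nu>\<^sub>0\<close>, which is not \<open>0\<close>.

  So the members of the hull that this map annihilates form a strictly smaller weak* closed
  bimodule. It contains the generator of the hull and therefore has the same \<open>Map\<close>
  (\<open>refl_bimod_in_closure_sub_bimod\<close>).

  To make the hull thin, the coordinates \<open>x\<^sub>0\<close> and \<open>x\<^sub>1\<close> are
  kept out of \<open>h\<close> and grade the operators. The generator is the convolution by
  \<open>\<nu>\<^sub>0\<close> in degree \<open>(0, 0)\<close>, by the unit mass at \<open>0\<close>
  in degree \<open>(1, 0)\<close> and by two unit masses in degree \<open>(0, 1)\<close>; nothing
  has degree \<open>(1, 1)\<close>. Translating this support by a nonzero element either moves a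
  nonempty part into the empty degree, or moves two points into a one-point part, or moves the point
  of degree \<open>(1, 0)\<close> within its degree. So the support is contained in no translate of
  itself by a nonzero element, whatever the level set looks like. Operator versions of these
  alternatives show that all multipliers lie in the masa
  (\<open>right_multipliers_in_conv_ops\<close>, \<open>left_multipliers_in_conv_ops\<close>).
\<close>

no_notation Infinite_Set_Sum.abs_summable_on (infix \<open>abs'_summable'_on\<close> 50)

section \<open>The Hilbert space of square summable sequences\<close>

definition l2 :: "(nat \<Rightarrow> complex) set" where
  "l2 = {x. (\<lambda>n. (cmod (x n))\<^sup>2) summable_on UNIV}"

lemma l2_add: "x \<in> l2 \<Longrightarrow> y \<in> l2 \<Longrightarrow> (\<lambda>n. x n + y n) \<in> l2"
proof -
  assume *: "x \<in> l2" "y \<in> l2"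
  have "(\<lambda>n. 2 * (cmod (x n))\<^sup>2 + 2 * (cmod (y n))\<^sup>2) summable_on UNIV"
    using * by (intro summable_on_add summable_on_cmult_right) (auto simp: l2_def)
  moreover have "(cmod (x n + y n))\<^sup>2 \<le> 2 * (cmod (x n))\<^sup>2 + 2 * (cmod (y n))\<^sup>2" for n
  proof -
    have "(cmod (x n + y n))\<^sup>2 \<le> (cmod (x n) + cmod (y n))\<^sup>2"
      by (intro power_mono norm_triangle_ineq) auto
    also have "\<dots> \<le> 2 * (cmod (x n))\<^sup>2 + 2 * (cmod (y n))\<^sup>2"
      using zero_le_power2[of "cmod (x n) - cmod (y n)"] by (simp add: power2_sum power2_diff)
    finally show ?thesis .
  qed
  ultimately show ?thesis
    unfolding l2_def by (auto intro: summable_on_comparison_test)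
qed

lemma l2_mult_bounded:
  assumes "x \<in> l2" "\<And>n. cmod (t n) \<le> C"
  shows "(\<lambda>n. t n * x n) \<in> l2"
proof -
  have "(\<lambda>n. C\<^sup>2 * (cmod (x n))\<^sup>2) summable_on UNIV"
    using assms(1) by (intro summable_on_cmult_right) (auto simp: l2_def)
  moreover have "(cmod (t n * x n))\<^sup>2 \<le> C\<^sup>2 * (cmod (x n))\<^sup>2" for n
    using assms(2)[of n] by (auto simp: norm_mult power_mult_distrib intro!: mult_right_mono power_mono)
  ultimately show ?thesis
    unfolding l2_def by (auto intro: summable_on_comparison_test)
qed

lemma l2_scale: "x \<in> l2 \<Longrightarrow> (\<lambda>n. c * x n) \<in> l2"
  by (rule l2_mult_bounded) auto

lemma l2_0: "(\<lambda>_. 0) \<in> l2"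
  by (simp add: l2_def)

lemma l2_minus: "x \<in> l2 \<Longrightarrow> (\<lambda>n. - x n) \<in> l2"
  using l2_scale[of x "-1"] by simp

lemma l2_prod_abs_summable:
  assumes "x \<in> l2" "y \<in> l2"
  shows "(\<lambda>n. x n * cnj (y n)) abs_summable_on UNIV"
  by (rule abs_summable_product) (use assms in \<open>auto simp: l2_def norm_mult power2_eq_square\<close>)

typedef ell2 = l2
  morphisms coef Abs_ell2
  using l2_0 by blast

lemma coef_l2 [simp]: "coef x \<in> l2"
  by (rule coef)

lemma coef_Abs [simp]: "x \<in> l2 \<Longrightarrow> coef (Abs_ell2 x) = x"
  by (rule Abs_ell2_inverse)

lemma ell2_eqI: "(\<And>n. coef x n = coef y n) \<Longrightarrow> x = y"
  by (metis coef_inject ext)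

definition cin :: "ell2 \<Rightarrow> ell2 \<Rightarrow> complex" where
  "cin x y = (\<Sum>\<^sub>\<infinity>n. coef x n * cnj (coef y n))"

definition cscale :: "complex \<Rightarrow> ell2 \<Rightarrow> ell2" (infixr \<open>*\<^sub>C\<close> 75) where
  "c *\<^sub>C x = Abs_ell2 (\<lambda>n. c * coef x n)"

instantiation ell2 :: real_inner
begin

definition "0 = Abs_ell2 (\<lambda>_. 0)"
definition "x + y = Abs_ell2 (\<lambda>n. coef x n + coef y n)"
definition "- x = Abs_ell2 (\<lambda>n. - coef x n)"
definition "x - y = Abs_ell2 (\<lambda>n. coef x n + - coef y n)"
definition "r *\<^sub>R x = Abs_ell2 (\<lambda>n. complex_of_real r * coef x n)"
definition "inner x y = Re (cin x y)"
definition "norm (x::ell2) = sqrt (inner x x)"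
definition "sgn (x::ell2) = inverse (norm x) *\<^sub>R x"
definition "dist (x::ell2) y = norm (x - y)"
definition "(uniformity :: (ell2 \<times> ell2) filter) = (INF e\<in>{0 <..}. principal {(x, y). dist x y < e})"
definition "open (S :: ell2 set) = (\<forall>x\<in>S. \<forall>\<^sub>F (x', y) in uniformity. x' = x \<longrightarrow> y \<in> S)"

lemma coef_0 [simp]: "coef 0 n = 0"
  by (simp add: zero_ell2_def l2_0)
lemma coef_add [simp]: "coef (x + y) n = coef x n + coef y n"
  by (simp add: plus_ell2_def l2_add)
lemma coef_minus [simp]: "coef (- x) n = - coef x n"
  by (simp add: uminus_ell2_def l2_minus)
lemma coef_diff [simp]: "coef (x - y) n = coef x n - coef y n"
  using l2_add[OF coef_l2 l2_minus[OF coef_l2]] by (simp add: minus_ell2_def)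
lemma coef_scaleR [simp]: "coef (r *\<^sub>R x) n = complex_of_real r * coef x n"
  by (simp add: scaleR_ell2_def l2_scale)
lemma coef_cscale [simp]: "coef (c *\<^sub>C x) n = c * coef x n"
  by (simp add: cscale_def l2_scale)

lemma cin_summable: "(\<lambda>n. coef x n * cnj (coef y n)) abs_summable_on UNIV"
  by (rule l2_prod_abs_summable) auto

lemma cin_has_sum: "((\<lambda>n. coef x n * cnj (coef y n)) has_sum cin x y) UNIV"
  unfolding cin_def by (rule has_sum_infsum[OF abs_summable_summable[OF cin_summable]])

lemma cin_add_left: "cin (x + y) z = cin x z + cin y z"
  using has_sum_add[OF cin_has_sum[of x z] cin_has_sum[of y z]] cin_has_sum[of "x + y" z]
  by (auto simp: algebra_simps intro: has_sum_unique)

lemma cin_cscale_left [simp]: "cin (c *\<^sub>C x) z = c * cin x z"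
  using has_sum_cmult_right[OF cin_has_sum[of x z], of c] cin_has_sum[of "c *\<^sub>C x" z]
  by (auto simp: algebra_simps intro: has_sum_unique)

lemma cin_commute: "cin x y = cnj (cin y x)"
  unfolding cin_def infsum_cnj[symmetric] by (simp add: mult.commute)

lemma cin_self_has_sum: "((\<lambda>n. (cmod (coef x n))\<^sup>2) has_sum Re (cin x x)) UNIV"
  using has_sum_Re[OF cin_has_sum[of x x]]
  by (simp add: complex_mult_cnj cmod_power2 flip: power2_eq_square)

instance
proof
  fix x y z :: ell2 and a b r :: real
  show "x + y + z = x + (y + z)" "x + y = y + x" "0 + x = x" "- x + x = 0" "x - y = x + - y"
    by (rule ell2_eqI; simp)+
  show "a *\<^sub>R (x + y) = a *\<^sub>R x + a *\<^sub>R y" "(a + b) *\<^sub>R x = a *\<^sub>R x + b *\<^sub>R x"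
    "a *\<^sub>R b *\<^sub>R x = (a * b) *\<^sub>R x" "1 *\<^sub>R x = x"
    by (rule ell2_eqI; simp add: algebra_simps)+
  show "dist x y = norm (x - y)" "sgn x = inverse (norm x) *\<^sub>R x"
    by (simp_all add: dist_ell2_def sgn_ell2_def)
  show "uniformity = (INF e\<in>{0 <..}. principal {(x, y). dist (x::ell2) y < e})"
    by (rule uniformity_ell2_def)
  show "open U = (\<forall>x\<in>U. \<forall>\<^sub>F (x', y) in uniformity. x' = x \<longrightarrow> y \<in> U)" for U :: "ell2 set"
    by (rule open_ell2_def)
  show "inner x y = inner y x"
    using arg_cong[OF cin_commute[of x y], of Re] by (simp add: inner_ell2_def)
  show "inner (x + y) z = inner x z + inner y z"
    by (simp add: inner_ell2_def cin_add_left)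
  have "a *\<^sub>R x = complex_of_real a *\<^sub>C x"
    by (rule ell2_eqI) simp
  then show "inner (a *\<^sub>R x) y = a * inner x y"
    by (simp add: inner_ell2_def)
  show nonneg_real: "0 \<le> inner x x"
    unfolding inner_ell2_def by (rule has_sum_nonneg[OF cin_self_has_sum]) simp
  show "(inner x x = 0) = (x = 0)"
  proof
    assume "inner x x = 0"
    then have "(cmod (coef x n))\<^sup>2 = 0" for n
      by (intro nonneg_has_sum_le_0D[OF cin_self_has_sum[of x]]) (auto simp: inner_ell2_def)
    then show "x = 0"
      by (intro ell2_eqI) simp
  qed (simp add: inner_ell2_def cin_def)
  show "norm x = sqrt (inner x x)"
    by (rule norm_ell2_def)
qed

end

lemma scaleR_cscale: "a *\<^sub>R x = complex_of_real a *\<^sub>C x"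
  by (rule ell2_eqI) simp

lemma cscale_simps [simp]:
  "c *\<^sub>C (x + y) = c *\<^sub>C x + c *\<^sub>C y" "c *\<^sub>C (x - y) = c *\<^sub>C x - c *\<^sub>C y" "c *\<^sub>C 0 = 0"
  "1 *\<^sub>C x = x" "0 *\<^sub>C x = 0" "c *\<^sub>C d *\<^sub>C x = (c * d) *\<^sub>C x" "c *\<^sub>C (- x) = - (c *\<^sub>C x)"
  by (rule ell2_eqI; simp add: algebra_simps)+

lemma cscale_minus1: "- x = (-1) *\<^sub>C x"
  by (rule ell2_eqI) simp

lemma cscale_add_left: "(c + d) *\<^sub>C x = c *\<^sub>C x + d *\<^sub>C x"
  by (rule ell2_eqI) (simp add: algebra_simps)

lemma cscale_minus_left: "(- c) *\<^sub>C x = - (c *\<^sub>C x)"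
  by (rule ell2_eqI) simp

lemma cscale_diff_left: "(c - d) *\<^sub>C x = c *\<^sub>C x - d *\<^sub>C x"
  by (rule ell2_eqI) (simp add: algebra_simps)

lemma cin_add_right: "cin x (y + z) = cin x y + cin x z"
  by (metis cin_commute cin_add_left complex_cnj_add)

lemma cin_cscale_right [simp]: "cin x (c *\<^sub>C y) = cnj c * cin x y"
  by (metis cin_commute cin_cscale_left complex_cnj_mult)

lemma cin_minus_left [simp]: "cin (- x) y = - cin x y"
  by (simp add: cscale_minus1)

lemma cin_minus_right [simp]: "cin x (- y) = - cin x y"
  by (simp add: cscale_minus1)

lemma cin_diff_left: "cin (x - y) z = cin x z - cin y z"
  using cin_add_left[of x "- y" z] by simp

lemma cin_diff_right: "cin z (x - y) = cin z x - cin z y"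
  using cin_add_right[of z x "- y"] by simp

lemma cin_0 [simp]: "cin 0 x = 0" "cin x 0 = 0"
  by (simp_all add: cin_def)

lemma cin_self: "cin x x = complex_of_real ((norm x)\<^sup>2)"
proof -
  have "Im (cin x x) = 0"
    using arg_cong[OF cin_commute[of x x], of Im] by simp
  moreover have "Re (cin x x) = (norm x)\<^sup>2"
    by (simp add: power2_norm_eq_inner inner_ell2_def)
  ultimately show ?thesis
    by (simp add: complex_eq_iff)
qed

lemma norm_cscale [simp]: "norm (c *\<^sub>C x) = cmod c * norm x"
proof -
  have "cin (c *\<^sub>C x) (c *\<^sub>C x) = (c * cnj c) * cin x x"
    by (simp add: mult.assoc)
  then have "complex_of_real ((norm (c *\<^sub>C x))\<^sup>2) = complex_of_real ((cmod c * norm x)\<^sup>2)"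
    unfolding cin_self complex_norm_square[of c, symmetric] by (simp add: power_mult_distrib)
  then show ?thesis
    by (metis (no_types) of_real_eq_iff power2_eq_iff_nonneg norm_ge_zero mult_nonneg_nonneg)
qed

lemma cin_bound: "cmod (cin x y) \<le> norm x * norm y"
proof (cases "cin x y = 0")
  case False
  define c where "c = cnj (cin x y) / cmod (cin x y)"
  have c: "cmod c = 1"
    using False by (simp add: c_def norm_divide)
  have "cmod (cin x y) = Re (cin (c *\<^sub>C x) y)"
  proof -
    have "cin (c *\<^sub>C x) y = complex_of_real ((cmod (cin x y))\<^sup>2) / cmod (cin x y)"
      unfolding complex_norm_square by (simp add: c_def mult.commute)
    also have "\<dots> = complex_of_real (cmod (cin x y))"
      by (simp add: power2_eq_square)
    finally show ?thesis
      by simp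
  qed
  also have "\<dots> = inner (c *\<^sub>C x) y"
    by (simp add: inner_ell2_def)
  also have "\<dots> \<le> norm (c *\<^sub>C x) * norm y"
    by (rule norm_cauchy_schwarz)
  finally show ?thesis
    by (simp add: c)
qed simp

lemma has_sum_norm_sq: "((\<lambda>n. (cmod (coef x n))\<^sup>2) has_sum (norm x)\<^sup>2) UNIV"
  using cin_self_has_sum[of x] by (simp add: cin_self)

lemma sum_norm_sq_le: "finite F \<Longrightarrow> (\<Sum>n\<in>F. (cmod (coef x n))\<^sup>2) \<le> (norm x)\<^sup>2"
  by (rule finite_sum_le_has_sum[OF has_sum_norm_sq]) auto

lemma coef_le_norm: "cmod (coef x n) \<le> norm x"
  using sum_norm_sq_le[of "{n}" x] by (simp add: abs_le_square_iff[symmetric])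

lemma bounded_linear_cscale: "bounded_linear (\<lambda>x. c *\<^sub>C x)"
  by (rule bounded_linear_intro[where K = "cmod c"]) (auto simp: scaleR_cscale mult.commute)

lemma bounded_linear_coef: "bounded_linear (\<lambda>x. coef x n)"
  by (rule bounded_linear_intro[where K = 1])
    (auto simp: coef_le_norm scaleR_conv_of_real)

lemma bounded_linear_cin_left: "bounded_linear (\<lambda>x. cin x y)"
  by (rule bounded_linear_intro[where K = "norm y"])
    (auto simp: cin_add_left scaleR_cscale cin_bound scaleR_conv_of_real)

lemma bounded_linear_cin_right: "bounded_linear (\<lambda>y. cin x y)"
  by (rule bounded_linear_intro[where K = "norm x"])
    (use cin_bound[of x] in \<open>auto simp: cin_add_right scaleR_cscale scaleR_conv_of_real mult.commute\<close>)

instance ell2 :: banach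
proof
  fix X :: "nat \<Rightarrow> ell2"
  assume C: "Cauchy X"
  have "convergent (\<lambda>i. coef (X i) n)" for n
    using bounded_linear.Cauchy[OF bounded_linear_coef C] by (simp add: Cauchy_convergent_iff)
  then obtain y where y: "\<And>n. (\<lambda>i. coef (X i) n) \<longlonglongrightarrow> y n"
    unfolding convergent_def by metis
  have bound: "(\<Sum>n\<in>F. (cmod (coef (X i) n - y n))\<^sup>2) \<le> e\<^sup>2"
    if N: "\<And>j. j \<ge> N \<Longrightarrow> dist (X i) (X j) < e" and F: "finite F" for i N e F
  proof (rule tendsto_upperbound)
    show "((\<lambda>j. \<Sum>n\<in>F. (cmod (coef (X i) n - coef (X j) n))\<^sup>2) \<longlongrightarrow>
        (\<Sum>n\<in>F. (cmod (coef (X i) n - y n))\<^sup>2)) sequentially"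
      by (intro tendsto_intros y)
    show "\<forall>\<^sub>F j in sequentially. (\<Sum>n\<in>F. (cmod (coef (X i) n - coef (X j) n))\<^sup>2) \<le> e\<^sup>2"
    proof (rule eventually_sequentiallyI)
      fix j assume "N \<le> j"
      then have "norm (X i - X j) \<le> e"
        using N[of j] by (simp add: dist_norm)
      then show "(\<Sum>n\<in>F. (cmod (coef (X i) n - coef (X j) n))\<^sup>2) \<le> e\<^sup>2"
        using sum_norm_sq_le[OF F, of "X i - X j"] by (smt (verit) coef_diff norm_ge_zero power_mono sum.cong)
    qed
  qed simp
  have diff: "(\<lambda>n. coef (X i) n - y n) \<in> l2" if "\<And>j. j \<ge> N \<Longrightarrow> dist (X i) (X j) < e" for i N e
    unfolding l2_def using bound[OF that]
    by (auto intro!: nonneg_bdd_above_summable_on bdd_aboveI[where M = "e\<^sup>2"])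
  obtain N1 where "\<And>m n. m \<ge> N1 \<Longrightarrow> n \<ge> N1 \<Longrightarrow> dist (X m) (X n) < 1"
    using C unfolding Cauchy_def by (metis zero_less_one)
  then have "(\<lambda>n. coef (X N1) n - (coef (X N1) n - y n)) \<in> l2"
    using l2_add[OF coef_l2[of "X N1"] l2_minus[OF diff[of N1 N1 1]]] by simp
  then have yl: "y \<in> l2"
    by simp
  have "X \<longlonglongrightarrow> Abs_ell2 y"
  proof (rule metric_LIMSEQ_I)
    fix r :: real assume r: "r > 0"
    obtain N where N: "\<And>m n. m \<ge> N \<Longrightarrow> n \<ge> N \<Longrightarrow> dist (X m) (X n) < r / 2"
      using C r unfolding Cauchy_def by (metis half_gt_zero)
    have "dist (X i) (Abs_ell2 y) < r" if "i \<ge> N" for i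
    proof -
      have "(norm (X i - Abs_ell2 y))\<^sup>2 \<le> (r / 2)\<^sup>2"
      proof (rule has_sum_le_finite_sums[OF has_sum_norm_sq])
        fix F :: "nat set" assume "finite F"
        from bound[OF N[OF that] this] 
        show "(\<Sum>n\<in>F. (cmod (coef (X i - Abs_ell2 y) n))\<^sup>2) \<le> (r / 2)\<^sup>2"
          using yl by simp
      qed
      then have "norm (X i - Abs_ell2 y) \<le> r / 2"
        using r by (simp add: abs_le_square_iff[symmetric])
      then show ?thesis
        using r by (simp add: dist_norm)
    qed
    then show "\<exists>N. \<forall>i\<ge>N. dist (X i) (Abs_ell2 y) < r"
      by blast
  qed
  then show "convergent X"
    by (auto simp: convergent_def)
qed

section \<open>Projections, bounded operators and the standard basis\<close>

text \<open>An almost minimising sequence for the distance from \<open>x\<close> to \<open>V\<close>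
  converges, and its limit, a minimiser, is orthogonal to all directions of
  \<open>V\<close>.\<close>

lemma closed_subspace_projection:
  fixes V :: "'a::{real_inner, complete_space} set"
  assumes V: "closed V" "subspace V"
  shows "\<exists>y\<in>V. \<forall>z\<in>V. inner (x - y) z = 0"
proof -
  define d where "d = infdist x V"
  have V0: "V \<noteq> {}"
    using subspace_0[OF V(2)] by blast
  have d_le: "d \<le> norm (x - y)" if "y \<in> V" for y
    using infdist_le[OF that, of x] by (simp add: d_def dist_norm)
  have d0: "0 \<le> d"
    by (simp add: d_def infdist_nonneg)
  have "\<exists>y\<in>V. (norm (x - y))\<^sup>2 < d\<^sup>2 + 1 / (real n + 1)" for n
  proof -
    define e where "e = sqrt (d\<^sup>2 + 1 / (real n + 1))"
    have "d < e"
      unfolding e_def by (rule real_less_rsqrt) simp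
    then have "\<exists>y\<in>V. dist x y < e"
      unfolding d_def infdist_notempty[OF V0] by (subst (asm) cINF_less_iff) (use V0 in auto)
    then obtain y where "y \<in> V" "norm (x - y) < e"
      by (auto simp: dist_norm)
    moreover have "(norm (x - y))\<^sup>2 < e\<^sup>2"
      using calculation by (intro power_strict_mono) auto
    moreover have "e\<^sup>2 = d\<^sup>2 + 1 / (real n + 1)"
      unfolding e_def by (rule real_sqrt_pow2) simp
    ultimately show ?thesis
      by auto
  qed
  then obtain y where y: "\<And>n. y n \<in> V" "\<And>n. (norm (x - y n))\<^sup>2 < d\<^sup>2 + 1 / (real n + 1)"
    by metis
  \<comment> \<open>By the parallelogram law two almost minimisers are close, since their midpoint lies in \<open>V\<close>.\<close>
  have par: "(norm (y m - y n))\<^sup>2 \<le> 2 / (real m + 1) + 2 / (real n + 1)" for m n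
  proof -
    have "(1 / 2) *\<^sub>R (y m + y n) \<in> V"
      by (intro subspace_scale subspace_add V y)
    then have "d \<le> norm (x - (1 / 2) *\<^sub>R (y m + y n))"
      by (rule d_le)
    then have "d\<^sup>2 \<le> (norm (x - (1 / 2) *\<^sub>R (y m + y n)))\<^sup>2"
      using d0 by (intro power_mono) auto
    moreover have "(norm (y m - y n))\<^sup>2 + 4 * (norm (x - (1 / 2) *\<^sub>R (y m + y n)))\<^sup>2
        = 2 * (norm (x - y m))\<^sup>2 + 2 * (norm (x - y n))\<^sup>2"
      by (simp add: power2_norm_eq_inner inner_diff_left inner_diff_right inner_add_left
          inner_add_right inner_commute algebra_simps)
    ultimately show ?thesis
      using y(2)[of m] y(2)[of n] by simp
  qed
  have "Cauchy y"
  proof (rule metric_CauchyI)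
    fix e :: real assume e: "e > 0"
    obtain N :: nat where N: "4 / e\<^sup>2 < real N"
      using reals_Archimedean2 by blast
    have "norm (y m - y n) < e" if "m \<ge> N" "n \<ge> N" for m n
    proof (rule power_less_imp_less_base[where n = 2])
      have "2 / (real k + 1) < e\<^sup>2 / 2" if "k \<ge> N" for k
      proof -
        have "4 / e\<^sup>2 < real k + 1"
          using N that by linarith
        then show ?thesis
          using e by (simp add: field_simps)
      qed
      from this[OF that(1)] this[OF that(2)] show "(norm (y m - y n))\<^sup>2 < e\<^sup>2"
        using par[of m n] by simp
    qed (use e in auto)
    then show "\<exists>M. \<forall>m\<ge>M. \<forall>n\<ge>M. dist (y m) (y n) < e"
      by (auto simp: dist_norm)
  qed
  then obtain z where z: "y \<longlonglongrightarrow> z"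
    using Cauchy_convergent convergent_def by blast
  have zV: "z \<in> V"
    by (rule Lim_in_closed_set[OF V(1) _ _ z]) (use y in auto)
  have "(norm (x - z))\<^sup>2 \<le> d\<^sup>2"
  proof (rule LIMSEQ_le)
    show "(\<lambda>n. (norm (x - y n))\<^sup>2) \<longlonglongrightarrow> (norm (x - z))\<^sup>2"
      by (intro tendsto_intros z)
    show "(\<lambda>n. d\<^sup>2 + 1 / (real n + 1)) \<longlonglongrightarrow> d\<^sup>2"
      using tendsto_add[OF tendsto_const LIMSEQ_inverse_real_of_nat, of "d\<^sup>2"]
      by (simp add: inverse_eq_divide add.commute)
    show "\<exists>N. \<forall>n\<ge>N. (norm (x - y n))\<^sup>2 \<le> d\<^sup>2 + 1 / (real n + 1)"
      using y(2) less_imp_le by blast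
  qed
  then have min: "(norm (x - z))\<^sup>2 \<le> (norm (x - v))\<^sup>2" if "v \<in> V" for v
    using d_le[OF that] d0 by (smt (verit) power_mono)
  have "inner (x - z) v = 0" if "v \<in> V" for v
  proof (cases "v = 0")
    case False
    define t where "t = inner (x - z) v / inner v v"
    have "z + t *\<^sub>R v \<in> V"
      by (intro subspace_add subspace_scale V zV that)
    from min[OF this] have "0 \<le> - 2 * t * inner (x - z) v + t * t * inner v v"
      by (simp add: power2_norm_eq_inner inner_diff_left inner_diff_right inner_add_left
          inner_add_right inner_commute algebra_simps)
    also have "\<dots> = - (inner (x - z) v)\<^sup>2 / inner v v"
      using False by (simp add: t_def field_simps power2_eq_square)
    finally have "(inner (x - z) v)\<^sup>2 / inner v v \<le> 0"
      by simp
    moreover have "0 < inner v v"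
      using False by (rule inner_gt_zero_iff[THEN iffD2])
    ultimately have "(inner (x - z) v)\<^sup>2 \<le> 0"
      by (meson divide_pos_pos not_le)
    then show ?thesis
      by simp
  qed simp
  with zV show ?thesis
    by blast
qed

definition csubspace :: "ell2 set \<Rightarrow> bool" where
  "csubspace V \<longleftrightarrow> 0 \<in> V \<and> (\<forall>x\<in>V. \<forall>y\<in>V. x + y \<in> V) \<and> (\<forall>c. \<forall>x\<in>V. c *\<^sub>C x \<in> V)"

lemma csubspace_0: "csubspace V \<Longrightarrow> 0 \<in> V"
  and csubspace_add: "csubspace V \<Longrightarrow> x \<in> V \<Longrightarrow> y \<in> V \<Longrightarrow> x + y \<in> V"
  and csubspace_cscale: "csubspace V \<Longrightarrow> x \<in> V \<Longrightarrow> c *\<^sub>C x \<in> V"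
  by (auto simp: csubspace_def)

lemma csubspace_diff: "csubspace V \<Longrightarrow> x \<in> V \<Longrightarrow> y \<in> V \<Longrightarrow> x - y \<in> V"
  using csubspace_add[of V x "- y"] csubspace_cscale[of V y "-1"] by (simp add: cscale_minus1[symmetric])

lemma csubspace_subspace: "csubspace V \<Longrightarrow> subspace V"
  by (auto simp: subspace_def csubspace_def scaleR_cscale)

lemma closure_closed_under_add:
  fixes V :: "'a::real_normed_vector set"
  assumes V: "\<And>x y. x \<in> V \<Longrightarrow> y \<in> V \<Longrightarrow> x + y \<in> V"
    and xy: "x \<in> closure V" "y \<in> closure V"
  shows "x + y \<in> closure V"
proof -
  obtain f g where f: "\<And>n. f n \<in> V" "f \<longlonglongrightarrow> x" and g: "\<And>n. g n \<in> V" "g \<longlonglongrightarrow> y"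
    using xy unfolding closure_sequential by blast
  have "(\<lambda>n. f n + g n) \<longlonglongrightarrow> x + y"
    by (intro tendsto_add f g)
  then show ?thesis
    unfolding closure_sequential using V[OF f(1) g(1)] by (intro exI[of _ "\<lambda>n. f n + g n"]) simp
qed

lemma csubspace_closure:
  assumes "csubspace V"
  shows "csubspace (closure V)"
proof -
  have add: "x + y \<in> closure V" if "x \<in> closure V" "y \<in> closure V" for x y
    by (rule closure_closed_under_add[OF _ that]) (use csubspace_add[OF assms] in blast)
  have "c *\<^sub>C x \<in> closure V" if "x \<in> closure V" for c x
  proof -
    have "(\<lambda>x. c *\<^sub>C x) ` closure V \<subseteq> closure ((\<lambda>x. c *\<^sub>C x) ` V)"
      by (rule closure_bounded_linear_image_subset[OF bounded_linear_cscale])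
    also have "\<dots> \<subseteq> closure V"
      by (rule closure_mono) (use assms in \<open>auto simp: csubspace_def\<close>)
    finally show ?thesis
      using that by blast
  qed
  then show ?thesis
    using add csubspace_0[OF assms] closure_subset[of V] by (auto simp: csubspace_def)
qed

definition cspan :: "ell2 set \<Rightarrow> ell2 set" where
  "cspan X = \<Inter>{V. csubspace V \<and> X \<subseteq> V}"

lemma csubspace_cspan: "csubspace (cspan X)"
  by (auto simp: cspan_def csubspace_def)

lemma cspan_superset: "X \<subseteq> cspan X"
  by (auto simp: cspan_def)

lemma cspan_minimal: "X \<subseteq> V \<Longrightarrow> csubspace V \<Longrightarrow> cspan X \<subseteq> V"
  by (auto simp: cspan_def)

lemma closure_cspan_minimal: "X \<subseteq> V \<Longrightarrow> csubspace V \<Longrightarrow> closed V \<Longrightarrow> closure (cspan X) \<subseteq> V"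
  by (intro closure_minimal cspan_minimal)

lemma closure_cspan_superset: "X \<subseteq> closure (cspan X)"
  using cspan_superset closure_subset by blast

lemma csubspace_closure_cspan: "csubspace (closure (cspan X))"
  by (intro csubspace_closure csubspace_cspan)

definition bclinear :: "(ell2 \<Rightarrow> ell2) \<Rightarrow> bool" where
  "bclinear T \<longleftrightarrow> bounded_linear T \<and> (\<forall>c x. T (c *\<^sub>C x) = c *\<^sub>C T x)"

lemma bclinear_bl: "bclinear T \<Longrightarrow> bounded_linear T"
  by (simp add: bclinear_def)

lemma bclinear_simps:
  assumes "bclinear T"
  shows "T (x + y) = T x + T y" "T (x - y) = T x - T y" "T 0 = 0" "T (- x) = - T x"
    "T (c *\<^sub>C x) = c *\<^sub>C T x"
  using assms by (auto simp: bclinear_def linear_simps)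

lemma bclinearI:
  assumes "\<And>x y. T (x + y) = T x + T y" "\<And>c x. T (c *\<^sub>C x) = c *\<^sub>C T x"
    "\<And>x. norm (T x) \<le> C * norm x"
  shows "bclinear T"
  unfolding bclinear_def
  by (intro conjI bounded_linear_intro[where K = C])
    (use assms in \<open>auto simp: scaleR_cscale mult.commute\<close>)

lemma bclinear_bound: "bclinear T \<Longrightarrow> \<exists>C. \<forall>x. norm (T x) \<le> C * norm x"
  using bounded_linear.bounded[of T] by (auto simp: bclinear_def mult.commute)

lemma bclinear_id: "bclinear (\<lambda>x. x)"
  by (simp add: bclinear_def)

lemma bclinear_comp: "bclinear S \<Longrightarrow> bclinear T \<Longrightarrow> bclinear (\<lambda>x. S (T x))"
  by (simp add: bclinear_def bounded_linear_compose)

lemma bclinear_add: "bclinear S \<Longrightarrow> bclinear T \<Longrightarrow> bclinear (\<lambda>x. S x + T x)"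
  by (simp add: bclinear_def bounded_linear_add)

lemma bclinear_diff: "bclinear S \<Longrightarrow> bclinear T \<Longrightarrow> bclinear (\<lambda>x. S x - T x)"
  by (simp add: bclinear_def bounded_linear_sub)

lemma bclinear_cscale: "bclinear T \<Longrightarrow> bclinear (\<lambda>x. c *\<^sub>C T x)"
  by (simp add: bclinear_def bounded_linear_compose[OF bounded_linear_cscale] mult.commute)

lemma bclinear_0: "bclinear (\<lambda>x. 0)"
  by (simp add: bclinear_def)

lemma bclinear_continuous: "bclinear T \<Longrightarrow> continuous_on A T"
  by (simp add: bclinear_def linear_continuous_on)

lemma closed_bclinear_eq:
  assumes "bclinear S" "bclinear T"
  shows "closed {x. S x = T x}" "csubspace {x. S x = T x}"
  using closed_Collect_eq[OF bclinear_continuous[OF assms(1)] bclinear_continuous[OF assms(2)]] assms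
  by (auto simp: csubspace_def bclinear_simps)

text \<open>Unspecified unless \<open>V\<close> is a closed subspace.\<close>

definition orth_proj :: "ell2 set \<Rightarrow> ell2 \<Rightarrow> ell2" where
  "orth_proj V x = (SOME y. y \<in> V \<and> (\<forall>z\<in>V. cin (x - y) z = 0))"

definition is_proj :: "(ell2 \<Rightarrow> ell2) \<Rightarrow> bool" where
  "is_proj P \<longleftrightarrow> bclinear P \<and> (\<forall>x. P (P x) = P x) \<and> (\<forall>x y. cin (P x) y = cin x (P y))"

lemma is_projD:
  assumes "is_proj P"
  shows "bclinear P" "P (P x) = P x" "cin (P x) y = cin x (P y)"
  using assms by (auto simp: is_proj_def)

context
  fixes V assumes V: "closed V" "csubspace V"
begin

lemma orth_proj_in: "orth_proj V x \<in> V"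
  and orth_proj_orth: "z \<in> V \<Longrightarrow> cin (x - orth_proj V x) z = 0"
proof -
  obtain y where y: "y \<in> V" "\<And>z. z \<in> V \<Longrightarrow> inner (x - y) z = 0"
    using closed_subspace_projection[OF V(1) csubspace_subspace[OF V(2)]] by blast
  have "cin (x - y) z = 0" if "z \<in> V" for z
    using y(2)[OF that] y(2)[OF csubspace_cscale[OF V(2) that, of \<i>]]
    by (simp add: inner_ell2_def complex_eq_iff)
  then have "\<exists>y. y \<in> V \<and> (\<forall>z\<in>V. cin (x - y) z = 0)"
    using y by blast
  from someI_ex[OF this] show "orth_proj V x \<in> V" "z \<in> V \<Longrightarrow> cin (x - orth_proj V x) z = 0"
    by (auto simp: orth_proj_def)
qed

lemma orth_proj_unique:
  assumes "y \<in> V" "\<And>z. z \<in> V \<Longrightarrow> cin (x - y) z = 0"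
  shows "orth_proj V x = y"
proof -
  have d: "orth_proj V x - y \<in> V"
    by (intro csubspace_diff V orth_proj_in assms)
  have "cin (orth_proj V x - y) (orth_proj V x - y) = 0"
    using assms(2)[OF d] orth_proj_orth[OF d, of x] cin_diff_left[of "x - y" "x - orth_proj V x" "orth_proj V x - y"]
    by simp
  then show ?thesis
    by (simp add: cin_self)
qed

lemma orth_proj_fix: "x \<in> V \<Longrightarrow> orth_proj V x = x"
  by (rule orth_proj_unique) auto

lemma range_orth_proj: "range (orth_proj V) = V"
  using orth_proj_in orth_proj_fix by (auto simp: image_iff) metis

lemma orth_proj_norm: "norm (orth_proj V x) \<le> norm x"
proof -
  have "cin x x = cin (orth_proj V x) (orth_proj V x) + cin (x - orth_proj V x) (x - orth_proj V x)"
    using orth_proj_orth[OF orth_proj_in, of x x] cin_commute[of "orth_proj V x" "x - orth_proj V x"]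
    by (simp add: cin_diff_left cin_diff_right)
  then have "(norm x)\<^sup>2 = (norm (orth_proj V x))\<^sup>2 + (norm (x - orth_proj V x))\<^sup>2"
    unfolding cin_self of_real_add[symmetric] of_real_eq_iff .
  then have "(norm (orth_proj V x))\<^sup>2 \<le> (norm x)\<^sup>2"
    by simp
  then show ?thesis
    by (rule power2_le_imp_le) simp
qed

lemma is_proj_orth_proj: "is_proj (orth_proj V)"
proof -
  have add: "orth_proj V (x + y) = orth_proj V x + orth_proj V y" for x y
    using orth_proj_orth[of _ x] orth_proj_orth[of _ y]
    by (intro orth_proj_unique csubspace_add V orth_proj_in) (simp add: cin_diff_left cin_add_left)
  have scale: "orth_proj V (c *\<^sub>C x) = c *\<^sub>C orth_proj V x" for c x
    using orth_proj_orth[of _ x]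
    by (intro orth_proj_unique csubspace_cscale V orth_proj_in) (simp flip: cscale_simps(2))
  have sa: "cin (orth_proj V x) y = cin x (orth_proj V y)" for x y
  proof -
    have "cin (orth_proj V x) (y - orth_proj V y) = 0"
      using orth_proj_orth[OF orth_proj_in[of x], of y] cin_commute[of "orth_proj V x" "y - orth_proj V y"] by simp
    then show ?thesis
      using orth_proj_orth[OF orth_proj_in[of y], of x] by (simp add: cin_diff_left cin_diff_right)
  qed
  show ?thesis
    unfolding is_proj_def using add scale orth_proj_norm sa orth_proj_fix[OF orth_proj_in]
    by (intro conjI bclinearI[where C = 1]) auto
qed

end

lemma range_is_proj: "is_proj P \<Longrightarrow> range P = {x. P x = x}"
  using is_projD(2) by (auto simp: image_iff) metis

lemma is_proj_range_closed: "is_proj P \<Longrightarrow> closed (range P)" "is_proj P \<Longrightarrow> csubspace (range P)"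
  using closed_bclinear_eq[OF is_projD(1) bclinear_id] by (simp_all add: range_is_proj)

lemma is_proj_eq_orth_proj: "is_proj P \<Longrightarrow> P = orth_proj (range P)"
proof
  fix x assume P: "is_proj P"
  have "cin (x - P x) (P z) = 0" for z
    using is_projD[OF P] by (metis cin_diff_left is_projD(3)[OF P] cancel_comm_monoid_add_class.diff_cancel)
  then show "P x = orth_proj (range P) x"
    using P by (intro orth_proj_unique[symmetric] is_proj_range_closed) auto
qed

lemma is_proj_unique: "is_proj P \<Longrightarrow> is_proj Q \<Longrightarrow> range P = range Q \<Longrightarrow> P = Q"
  by (metis is_proj_eq_orth_proj)

lemma is_proj_compl:
  assumes "is_proj P"
  shows "is_proj (\<lambda>x. x - P x)"
  using is_projD[OF assms]
  by (auto simp: is_proj_def bclinear_simps cin_diff_left cin_diff_right intro!: bclinear_diff bclinear_id)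

lemma is_proj_0: "is_proj (\<lambda>x. 0)"
  by (simp add: is_proj_def bclinear_0)

definition delta :: "nat \<Rightarrow> ell2" where
  "delta k = Abs_ell2 (\<lambda>n. if n = k then 1 else 0)"

lemma coef_delta [simp]: "coef (delta k) n = (if n = k then 1 else 0)"
proof -
  have "(\<lambda>n. (cmod (if n = k then 1 else 0))\<^sup>2) summable_on UNIV"
    by (rule finite_nonzero_values_imp_summable_on) (auto intro: finite_subset[of _ "{k}"])
  then have "(\<lambda>n. if n = k then 1 else 0) \<in> l2"
    by (simp add: l2_def)
  then show ?thesis
    by (simp add: delta_def)
qed

lemma cin_delta_right [simp]: "cin x (delta k) = coef x k"
proof -
  have "((\<lambda>n. coef x n * cnj (coef (delta k) n)) has_sum coef x k) UNIV"
    by (rule has_sum_finite_neutralI[of "{k}"]) auto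
  then show ?thesis
    using cin_has_sum has_sum_unique by blast
qed

lemma cin_delta_left [simp]: "cin (delta k) x = cnj (coef x k)"
  by (metis cin_commute cin_delta_right)

lemma norm_delta [simp]: "norm (delta k) = 1"
proof -
  have "complex_of_real ((norm (delta k))\<^sup>2) = 1"
    unfolding cin_self[symmetric] by simp
  then show ?thesis
    by (metis norm_ge_zero of_real_eq_1_iff power2_eq_1_iff one_neq_neg_one
        dual_order.trans not_one_le_zero zero_le_one neg_0_le_iff_le)
qed

text \<open>The difference of a vector and its projection onto \<open>V\<close> is orthogonal to the
  basis vectors, so all its coefficients vanish.\<close>

lemma delta_total:
  assumes V: "closed V" "csubspace V" and d: "\<And>k. delta k \<in> V"
  shows "V = UNIV"
proof -
  have "x \<in> V" for x
  proof -
    have "coef (x - orth_proj V x) k = 0" for k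
      using orth_proj_orth[OF V d[of k], of x] by simp
    then have "x = orth_proj V x"
      by (intro ell2_eqI) simp
    then show ?thesis
      using orth_proj_in[OF V, of x] by simp
  qed
  then show ?thesis
    by blast
qed

lemma bclinear_eqI:
  assumes "bclinear S" "bclinear T" "\<And>k. S (delta k) = T (delta k)"
  shows "S = T"
  using delta_total[OF closed_bclinear_eq[OF assms(1,2)]] assms(3) by auto

text \<open>Both sides are continuous and sesquilinear, so the matrix entries decide.\<close>

lemma adjoint_eqI:
  assumes S: "bclinear S" and T: "bclinear T"
    and e: "\<And>m n. coef (S (delta m)) n = cnj (coef (T (delta n)) m)"
  shows "cin (S x) y = cin x (T y)"
proof -
  have cont: "continuous_on UNIV (\<lambda>x. cin (S x) y)" "continuous_on UNIV (\<lambda>x. cin x (T y))"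
    "continuous_on UNIV (\<lambda>y. cin (S x) y)" "continuous_on UNIV (\<lambda>y. cin x (T y))" for x y
    by (intro linear_continuous_on bounded_linear_compose[OF bounded_linear_cin_left]
        bounded_linear_compose[OF bounded_linear_cin_right] bclinear_bl S T bounded_linear_cin_left
        bounded_linear_cin_right)+
  have 1: "cin (S (delta m)) y = cin (delta m) (T y)" for m y
  proof -
    have "{y. cin (S (delta m)) y = cin (delta m) (T y)} = UNIV"
      by (rule delta_total)
        (use T e in \<open>auto simp del: cin_delta_left intro!: closed_Collect_eq cont
           simp: csubspace_def cin_add_right bclinear_simps\<close>, simp)
    then show ?thesis
      by blast
  qed
  have "{x. cin (S x) y = cin x (T y)} = UNIV"
    by (rule delta_total)
      (use S 1 in \<open>auto simp del: cin_delta_left intro!: closed_Collect_eq cont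
         simp: csubspace_def cin_add_left bclinear_simps\<close>)
  then show ?thesis
    by blast
qed

section \<open>Shifts by XOR and their commutant\<close>

unbundle bit_operations_syntax

lemma xor_cancel [simp]: "((n::nat) XOR k) XOR k = n" "k XOR (k XOR n) = n"
  by (auto simp: bit_eq_iff bit_xor_iff)

lemma xor_eq_iff: "(n::nat) XOR k = m \<longleftrightarrow> n = m XOR k"
  by auto

lemma xor_right_commute: "((n::nat) XOR j) XOR k = (n XOR k) XOR j"
  by (auto simp: bit_eq_iff bit_xor_iff)

lemma bij_xor: "bij (\<lambda>n::nat. n XOR k)"
  by (rule bij_betw_byWitness[where f' = "\<lambda>n. n XOR k"]) auto

lemma infsum_xor: "(\<Sum>\<^sub>\<infinity>n. f ((n::nat) XOR k)) = (\<Sum>\<^sub>\<infinity>n. f n)"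
  by (rule infsum_reindex_bij_betw[OF bij_xor])

lemma summable_on_xor: "(\<lambda>n. f ((n::nat) XOR k)) summable_on UNIV \<longleftrightarrow> f summable_on UNIV"
  by (rule summable_on_reindex_bij_betw[OF bij_xor])

lemma has_sum_xor: "((\<lambda>n. f ((n::nat) XOR k)) has_sum S) UNIV \<longleftrightarrow> (f has_sum S) UNIV"
  by (rule has_sum_reindex_bij_betw[OF bij_xor])

text \<open>On the Cantor group this is the multiplication by the Walsh function of index
  \<open>k\<close>.\<close>

definition shift :: "nat \<Rightarrow> ell2 \<Rightarrow> ell2" where
  "shift k x = Abs_ell2 (\<lambda>n. coef x (n XOR k))"

lemma coef_shift [simp]: "coef (shift k x) n = coef x (n XOR k)"
proof -
  have "(\<lambda>n. coef x (n XOR k)) \<in> l2"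
    using coef_l2[of x] summable_on_xor[of "\<lambda>n. (cmod (coef x n))\<^sup>2" k] by (simp add: l2_def)
  then show ?thesis
    by (simp add: shift_def)
qed

lemma cin_shift: "cin (shift k x) y = cin x (shift k y)"
  using infsum_xor[of "\<lambda>n. coef x n * cnj (coef y (n XOR k))" k] by (simp add: cin_def)

lemma shift_shift: "shift j (shift k x) = shift (j XOR k) x"
  by (rule ell2_eqI) (simp add: xor.assoc)

lemma shift_shift_0: "shift 0 x = x"
  by (rule ell2_eqI) simp

lemma shift_shift_same [simp]: "shift k (shift k x) = x"
  by (rule ell2_eqI) simp

lemma norm_shift [simp]: "norm (shift k x) = norm x"
proof -
  have "complex_of_real ((norm (shift k x))\<^sup>2) = complex_of_real ((norm x)\<^sup>2)"
    unfolding cin_self[symmetric] by (simp add: cin_shift)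
  then show ?thesis
    by (metis norm_ge_zero of_real_eq_iff power2_eq_iff_nonneg)
qed

lemma bclinear_shift: "bclinear (shift k)"
  by (rule bclinearI[where C = 1]) (auto intro: ell2_eqI)

lemma shift_delta: "shift k (delta m) = delta (m XOR k)"
  by (rule ell2_eqI) (simp add: xor_eq_iff)

lemma delta_lam0: "delta m = shift m (delta 0)"
  by (simp add: shift_delta)

text \<open>On the Cantor group this is the convolution by the distribution with Fourier
  coefficients \<open>t\<close>. It is an operator only for bounded \<open>t\<close>.\<close>

definition diag :: "(nat \<Rightarrow> complex) \<Rightarrow> ell2 \<Rightarrow> ell2" where
  "diag t x = Abs_ell2 (\<lambda>n. t n * coef x n)"

context
  fixes t :: "nat \<Rightarrow> complex" and C :: real
  assumes t: "\<And>n. cmod (t n) \<le> C"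
begin

lemma coef_diag: "coef (diag t x) n = t n * coef x n"
  using l2_mult_bounded[OF coef_l2 t] by (simp add: diag_def)

lemma norm_diag: "norm (diag t x) \<le> C * norm x"
proof (rule power2_le_imp_le)
  have C: "0 \<le> C"
    using norm_ge_zero t[of 0] by (rule order_trans)
  show "(norm (diag t x))\<^sup>2 \<le> (C * norm x)\<^sup>2"
  proof (rule has_sum_le_finite_sums[OF has_sum_norm_sq])
    fix F :: "nat set" assume F: "finite F"
    have "(cmod (coef (diag t x) n))\<^sup>2 \<le> C\<^sup>2 * (cmod (coef x n))\<^sup>2" for n
      using t[of n] by (auto simp: coef_diag norm_mult power_mult_distrib intro!: mult_right_mono power_mono)
    then have "(\<Sum>n\<in>F. (cmod (coef (diag t x) n))\<^sup>2) \<le> (\<Sum>n\<in>F. C\<^sup>2 * (cmod (coef x n))\<^sup>2)"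
      by (intro sum_mono)
    also have "\<dots> \<le> C\<^sup>2 * (norm x)\<^sup>2"
      using sum_norm_sq_le[OF F, of x] by (auto simp flip: sum_distrib_left intro: mult_left_mono)
    finally show "(\<Sum>n\<in>F. (cmod (coef (diag t x) n))\<^sup>2) \<le> (C * norm x)\<^sup>2"
      by (simp add: power_mult_distrib)
  qed
  show "0 \<le> C * norm x"
    using C by simp
qed

lemma bclinear_diag: "bclinear (diag t)"
  by (rule bclinearI[OF _ _ norm_diag]) (auto intro!: ell2_eqI simp: coef_diag algebra_simps)

end

text \<open>The convolution operators for the group \<open>nat\<close> with \<open>XOR\<close>. On
  the Cantor group they are the multiplications by bounded functions.\<close>

definition conv_ops :: "(ell2 \<Rightarrow> ell2) set" where
  "conv_ops = {A. bclinear A \<and> (\<forall>k x. A (shift k x) = shift k (A x))}"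

lemma conv_ops_bclinear: "A \<in> conv_ops \<Longrightarrow> bclinear A"
  and conv_ops_shift: "A \<in> conv_ops \<Longrightarrow> A (shift k x) = shift k (A x)"
  by (auto simp: conv_ops_def)

lemma shift_conv_ops: "shift k \<in> conv_ops"
  by (simp add: conv_ops_def bclinear_shift shift_shift xor.commute[of k])

lemma conv_ops_id: "(\<lambda>x. x) \<in> conv_ops"
  by (simp add: conv_ops_def bclinear_id)

lemma conv_ops_0: "(\<lambda>x. 0) \<in> conv_ops"
  by (simp add: conv_ops_def bclinear_0 bclinear_simps[OF bclinear_shift])

lemma conv_ops_comp: "A \<in> conv_ops \<Longrightarrow> B \<in> conv_ops \<Longrightarrow> (\<lambda>x. A (B x)) \<in> conv_ops"
  by (simp add: conv_ops_def bclinear_comp)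

lemma conv_ops_add: "A \<in> conv_ops \<Longrightarrow> B \<in> conv_ops \<Longrightarrow> (\<lambda>x. A x + B x) \<in> conv_ops"
  by (simp add: conv_ops_def bclinear_add bclinear_simps[OF bclinear_shift])

lemma conv_ops_diff: "A \<in> conv_ops \<Longrightarrow> B \<in> conv_ops \<Longrightarrow> (\<lambda>x. A x - B x) \<in> conv_ops"
  by (simp add: conv_ops_def bclinear_diff bclinear_simps[OF bclinear_shift])

lemma conv_ops_cscale: "A \<in> conv_ops \<Longrightarrow> (\<lambda>x. c *\<^sub>C A x) \<in> conv_ops"
  by (simp add: conv_ops_def bclinear_cscale bclinear_simps[OF bclinear_shift])

lemma conv_ops_delta:
  assumes "A \<in> conv_ops"
  shows "coef (A (delta m)) n = coef (A (delta 0)) (n XOR m)"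
  by (subst delta_lam0) (simp add: conv_ops_shift[OF assms])

definition conj_vec :: "ell2 \<Rightarrow> ell2" where
  "conj_vec x = Abs_ell2 (\<lambda>n. cnj (coef x n))"

lemma coef_conj_vec [simp]: "coef (conj_vec x) n = cnj (coef x n)"
proof -
  have "(\<lambda>n. cnj (coef x n)) \<in> l2"
    using coef_l2[of x] by (simp add: l2_def)
  then show ?thesis
    by (simp add: conj_vec_def)
qed

lemma norm_conj_vec [simp]: "norm (conj_vec x) = norm x"
proof -
  have "(norm (conj_vec x))\<^sup>2 = (norm x)\<^sup>2"
    using has_sum_unique[OF has_sum_norm_sq[of "conj_vec x"]] has_sum_norm_sq[of x] by simp
  then show ?thesis
    by simp
qed

lemma conj_vec_simps: "conj_vec (x + y) = conj_vec x + conj_vec y" "conj_vec (c *\<^sub>C x) = cnj c *\<^sub>C conj_vec x" "conj_vec (shift k x) = shift k (conj_vec x)"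
  "conj_vec (delta k) = delta k"
  by (rule ell2_eqI; simp)+

text \<open>The matrix of a convolution operator is symmetric, since every element of the group is
  its own inverse. So the entrywise conjugate is the adjoint.\<close>

definition adj :: "(ell2 \<Rightarrow> ell2) \<Rightarrow> ell2 \<Rightarrow> ell2" where
  "adj A x = conj_vec (A (conj_vec x))"

lemma adj_conv_ops:
  assumes "A \<in> conv_ops"
  shows "adj A \<in> conv_ops"
proof -
  obtain C where "\<And>x. norm (A x) \<le> C * norm x"
    using bclinear_bound[OF conv_ops_bclinear[OF assms]] by blast
  then have "norm (adj A x) \<le> C * norm x" for x
    by (metis adj_def norm_conj_vec)
  moreover have "adj A (x + y) = adj A x + adj A y" "adj A (c *\<^sub>C x) = c *\<^sub>C adj A x" for c x y
    by (auto simp: adj_def conj_vec_simps bclinear_simps[OF conv_ops_bclinear[OF assms]])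
  ultimately have "bclinear (adj A)"
    by (intro bclinearI)
  then show ?thesis
    using assms by (simp add: conv_ops_def adj_def conj_vec_simps)
qed

lemma cin_adj:
  assumes "A \<in> conv_ops"
  shows "cin (A x) y = cin x (adj A y)"
proof (rule adjoint_eqI)
  show "bclinear A" "bclinear (adj A)"
    using assms adj_conv_ops conv_ops_bclinear by auto
  fix m n
  have "coef (A (delta m)) n = coef (A (delta n)) m"
    using conv_ops_delta[OF assms, of m n] conv_ops_delta[OF assms, of n m] by (simp add: xor.commute)
  then show "coef (A (delta m)) n = cnj (coef (adj A (delta n)) m)"
    by (simp add: adj_def conj_vec_simps)
qed

lemma conv_ops_has_sum:
  assumes "A \<in> conv_ops"
  shows "((\<lambda>m. coef x m * coef (A (delta 0)) (m XOR n)) has_sum coef (A x) n) UNIV"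
proof -
  have "cin x (adj A (delta n)) = coef (A x) n"
    by (simp flip: cin_adj[OF assms])
  then show ?thesis
    using cin_has_sum[of x "adj A (delta n)"] by (simp add: adj_def conj_vec_simps conv_ops_delta[OF assms, of n])
qed

lemma conv_ops_eqI:
  assumes "A \<in> conv_ops" "B \<in> conv_ops" "A (delta 0) = B (delta 0)"
  shows "A = B"
proof (rule bclinear_eqI)
  show "A (delta k) = B (delta k)" for k
    unfolding delta_lam0[of k] by (simp add: assms conv_ops_shift[OF assms(1)] conv_ops_shift[OF assms(2)])
qed (use assms conv_ops_bclinear in auto)

text \<open>A convolution operator is determined by its value at \<open>delta 0\<close>, and
  \<open>A (B (delta 0))\<close> is the convolution of \<open>A (delta 0)\<close> and
  \<open>B (delta 0)\<close>. Reindexing by \<open>m \<mapsto> m XOR n\<close> shows that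
  convolution is commutative.\<close>

lemma conv_ops_commute:
  assumes "A \<in> conv_ops" "B \<in> conv_ops"
  shows "A (B x) = B (A x)"
proof -
  have "(\<lambda>x. A (B x)) = (\<lambda>x. B (A x))"
  proof (rule conv_ops_eqI)
    show "A (B (delta 0)) = B (A (delta 0))"
    proof (rule ell2_eqI)
      fix n
      have "((\<lambda>m. coef (B (delta 0)) (m XOR n) * coef (A (delta 0)) m) has_sum coef (A (B (delta 0))) n) UNIV"
        using conv_ops_has_sum[OF assms(1), of "B (delta 0)" n]
          has_sum_xor[of "\<lambda>m. coef (B (delta 0)) m * coef (A (delta 0)) (m XOR n)" n] by simp
      moreover have "((\<lambda>m. coef (B (delta 0)) (m XOR n) * coef (A (delta 0)) m) has_sum coef (B (A (delta 0))) n) UNIV"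
        using conv_ops_has_sum[OF assms(2), of "A (delta 0)" n] by (simp add: mult.commute)
      ultimately show "coef (A (B (delta 0))) n = coef (B (A (delta 0))) n"
        by (rule has_sum_unique)
    qed
  qed (rule conv_ops_comp[OF assms] conv_ops_comp[OF assms(2,1)])+
  then show ?thesis
    by (rule fun_cong)
qed

text \<open>The shifts are self-adjoint, so the orthogonal complement of \<open>V\<close> is
  invariant together with \<open>V\<close>.\<close>

lemma orth_proj_conv_ops:
  assumes V: "closed V" "csubspace V" and inv: "\<And>k x. x \<in> V \<Longrightarrow> shift k x \<in> V"
  shows "orth_proj V \<in> conv_ops"
proof -
  have "orth_proj V (shift k x) = shift k (orth_proj V x)" for k x
  proof (rule orth_proj_unique[OF V])
    show "shift k (orth_proj V x) \<in> V"
      by (intro inv orth_proj_in V)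
    show "cin (shift k x - shift k (orth_proj V x)) z = 0" if "z \<in> V" for z
      using orth_proj_orth[OF V inv[OF that, of k], of x] by (simp add: cin_shift bclinear_simps(2)[OF bclinear_shift, symmetric])
  qed
  then show ?thesis
    using is_proj_orth_proj[OF V] by (auto simp: conv_ops_def is_proj_def)
qed

definition conv_proj :: "(ell2 \<Rightarrow> ell2) \<Rightarrow> bool" where
  "conv_proj P \<longleftrightarrow> is_proj P \<and> P \<in> conv_ops"

lemma conv_proj_bclinear: "conv_proj P \<Longrightarrow> bclinear P"
  by (simp add: conv_proj_def is_proj_def)

lemma conv_proj_comp:
  assumes "conv_proj P" "conv_proj Q"
  shows "conv_proj (\<lambda>x. P (Q x))"
proof -
  have PQ: "P \<in> conv_ops" "Q \<in> conv_ops" "is_proj P" "is_proj Q"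
    using assms by (auto simp: conv_proj_def)
  have "P (Q (P (Q x))) = P (Q x)" for x
    by (metis conv_ops_commute[OF PQ(1,2)] is_projD(2)[OF PQ(3)] is_projD(2)[OF PQ(4)])
  moreover have "cin (P (Q x)) y = cin x (P (Q y))" for x y
    by (metis conv_ops_commute[OF PQ(1,2)] is_projD(3)[OF PQ(3)] is_projD(3)[OF PQ(4)])
  ultimately show ?thesis
    using PQ by (simp add: conv_proj_def is_proj_def conv_ops_comp bclinear_comp)
qed

text \<open>The spectral projections of the symmetry \<open>shift k\<close> for its eigenvalues
  \<open>1\<close> (\<open>b = False\<close>) and \<open>- 1\<close>. On the Cantor group they are
  the indicator functions of the two halves cut out by a Walsh function.\<close>

definition half :: "bool \<Rightarrow> nat \<Rightarrow> ell2 \<Rightarrow> ell2" where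
  "half b k x = (1 / 2) *\<^sub>C (x + (if b then - shift k x else shift k x))"

lemma conv_proj_half: "conv_proj (half b k)"
proof -
  have c: "bclinear (half b k)"
    unfolding half_def
    by (cases b) (auto intro!: bclinear_cscale bclinear_add bclinear_diff bclinear_id bclinear_shift)
  moreover have "half b k (half b k x) = half b k x" for x
    by (rule ell2_eqI) (simp add: half_def field_simps)
  moreover have "cin (half b k x) y = cin x (half b k y)" for x y
    by (simp add: half_def cin_diff_left cin_diff_right cin_add_left cin_add_right cin_shift)
  moreover have "half b k (shift j x) = shift j (half b k x)" for j x
    by (rule ell2_eqI) (simp add: half_def xor_right_commute[of _ j k])
  ultimately show ?thesis
    by (simp add: conv_proj_def is_proj_def conv_ops_def)
qed

lemma half_sum: "half False k x + half True k x = x"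
  by (rule ell2_eqI) (simp add: half_def)

lemma half_diff: "half False k x - half True k x = shift k x"
  by (rule ell2_eqI) (simp add: half_def)

lemma half_orth: "b \<noteq> c \<Longrightarrow> half b k (half c k x) = 0"
  by (rule ell2_eqI) (auto simp: half_def field_simps)

section \<open>Fourier coefficients of a one-parameter group of unimodular functions\<close>

lemma sum_lessThan_double: "(\<Sum>m<2 * (N::nat). h m) = (\<Sum>m<N. h (2 * m) + h (2 * m + 1 :: nat) :: 'a::comm_monoid_add)"
  by (induction N) (simp_all add: add.assoc)

text \<open>Multiplying out the product yields one term for each choice of \<open>K\<close> digits.
  Both the \<open>\<ell>\<^sup>1\<close> norms and the \<open>XOR\<close> convolutions of the
  functions below are such sums.\<close>

lemma sum_prod_bits:
  fixes F :: "nat \<Rightarrow> bool \<Rightarrow> 'a::comm_semiring_1"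
  shows "(\<Sum>m<2 ^ K. \<Prod>k<K. F k (bit (m::nat) k)) = (\<Prod>k<K. F k False + F k True)"
proof (induction K arbitrary: F)
  case (Suc K)
  have 1: "(\<Prod>k<Suc K. F k (bit (2 * m) k)) = F 0 False * (\<Prod>k<K. F (Suc k) (bit m k))"
    and 2: "(\<Prod>k<Suc K. F k (bit (2 * m + 1) k)) = F 0 True * (\<Prod>k<K. F (Suc k) (bit m k))" for m :: nat
    unfolding prod.lessThan_Suc_shift by (simp_all add: bit_0 bit_Suc)
  have "(\<Sum>m<2 ^ Suc K. \<Prod>k<Suc K. F k (bit (m::nat) k))
      = (\<Sum>m<2 ^ K. F 0 False * (\<Prod>k<K. F (Suc k) (bit m k)) + F 0 True * (\<Prod>k<K. F (Suc k) (bit (m::nat) k)))"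
    unfolding power_Suc sum_lessThan_double 1 2 ..
  also have "\<dots> = (F 0 False + F 0 True) * (\<Prod>k<K. F (Suc k) False + F (Suc k) True)"
    by (simp add: sum.distrib Suc.IH[of "\<lambda>k. F (Suc k)"] distrib_right flip: sum_distrib_left)
  finally show ?case
    unfolding prod.lessThan_Suc_shift .
qed simp

lemma bit_ge_False:
  assumes "n < 2 ^ K" "K \<le> k"
  shows "\<not> bit (n::nat) k"
proof -
  have "n < 2 ^ k"
    by (rule less_le_trans[OF assms(1) power_increasing[OF assms(2)]]) simp
  then show ?thesis
    by (simp add: bit_iff_odd)
qed

text \<open>For \<open>k \<ge> 2\<close>, the two Fourier coefficients of the function
  \<open>exp (i t r / (k + 1)\<^sup>2)\<close> of one binary coordinate, where
  \<open>r = \<plusminus>1\<close> is its Rademacher function. For the coordinates \<open>0\<close>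
  and \<open>1\<close>, the Fourier coefficients of the indicator function of
  \<open>x\<^sub>k = 0\<close>.\<close>

definition bit_factor :: "real \<Rightarrow> nat \<Rightarrow> bool \<Rightarrow> complex" where
  "bit_factor t k b = (if k < 2 then 1 / 2
     else if b then \<i> * complex_of_real (sin (t / (real k + 1)\<^sup>2))
     else complex_of_real (cos (t / (real k + 1)\<^sup>2)))"

lemma norm_bit_factor: "cmod (bit_factor t k b) \<le> 1"
  by (auto simp: bit_factor_def norm_mult abs_sin_le_one)

lemma bit_factor_neg: "bit_factor (- t) k b = cnj (bit_factor t k b)"
  by (simp add: bit_factor_def)

text \<open>Products of functions of one coordinate: the addition theorems for
  \<open>k \<ge> 2\<close>, and the idempotence of an indicator function for
  \<open>k < 2\<close>.\<close>

lemma bit_factor_conv: "bit_factor s k False * bit_factor t k (False \<noteq> c) + bit_factor s k True * bit_factor t k (True \<noteq> c) = bit_factor (s + t) k c"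
  by (cases c) (simp_all add: bit_factor_def add_divide_distrib sin_add cos_add algebra_simps)

lemma abs_cos_minus_1: "\<bar>cos x - 1\<bar> \<le> \<bar>x\<bar>" for x :: real
proof -
  have "cos x = 1 - 2 * (sin (x / 2))\<^sup>2"
    using cos_double_sin[of "x / 2"] by simp
  moreover have "(sin (x / 2))\<^sup>2 \<le> \<bar>sin (x / 2)\<bar>"
    using mult_left_le[of "\<bar>sin (x / 2)\<bar>" "\<bar>sin (x / 2)\<bar>"]
    by (simp add: power2_eq_square flip: abs_mult)
  moreover have "\<bar>sin (x / 2)\<bar> \<le> \<bar>x / 2\<bar>"
    by (rule abs_sin_x_le_abs_x)
  ultimately show ?thesis
    by simp
qed

lemma bit_factor_False_near_1: "2 \<le> k \<Longrightarrow> cmod (bit_factor t k False - 1) \<le> \<bar>t\<bar> * (1 / (real k + 1)\<^sup>2)"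
  using abs_cos_minus_1[of "t / (real k + 1)\<^sup>2"]
    norm_of_real[of "cos (t / (real k + 1)\<^sup>2) - 1", where 'a = complex]
  by (simp add: bit_factor_def)

lemma summable_rate: "summable (\<lambda>k. 1 / (real k + 1)\<^sup>2)"
  using summable_Suc_iff[of "\<lambda>n. inverse (real n ^ 2)"] inverse_power_summable[of 2, where 'a = real]
  by (simp add: inverse_eq_divide add.commute)

definition partial_coeff :: "real \<Rightarrow> nat \<Rightarrow> nat \<Rightarrow> complex" where
  "partial_coeff t K n = (\<Prod>k<K. bit_factor t k (bit n k))"

text \<open>The Fourier coefficients of \<open>exp (i t h)\<close> on the subgroup
  \<open>x\<^sub>0 = x\<^sub>1 = 0\<close> and of \<open>0\<close> off it, where \<open>h\<close> is
  the sum of the Rademacher functions \<open>r\<^sub>k\<close> with weights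
  \<open>1 / (k + 1)\<^sup>2\<close>, \<open>k \<ge> 2\<close>.\<close>

definition phase_coeff :: "real \<Rightarrow> nat \<Rightarrow> complex" where
  "phase_coeff t n = lim (\<lambda>K. partial_coeff t K n)"

lemma phase_coeff_LIMSEQ: "(\<lambda>K. partial_coeff t K n) \<longlonglongrightarrow> phase_coeff t n"
proof -
  obtain N :: nat where N: "n < 2 ^ N"
    using less_exp by blast
  have "summable (\<lambda>k. norm (bit_factor t k (bit n k) - 1))"
  proof (rule summable_comparison_test_ev)
    show "summable (\<lambda>k. \<bar>t\<bar> * (1 / (real k + 1)\<^sup>2))"
      by (intro summable_mult summable_rate)
    have "norm (norm (bit_factor t k (bit n k) - 1)) \<le> \<bar>t\<bar> * (1 / (real k + 1)\<^sup>2)" if "k \<ge> N + 2" for k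
      using that bit_ge_False[OF N, of k] bit_factor_False_near_1[of k t] by simp
    then show "\<forall>\<^sub>F k in sequentially. norm (norm (bit_factor t k (bit n k) - 1)) \<le> \<bar>t\<bar> * (1 / (real k + 1)\<^sup>2)"
      by (rule eventually_sequentiallyI)
  qed
  then have "convergent_prod (\<lambda>k. bit_factor t k (bit n k))"
    by (intro abs_convergent_prod_imp_convergent_prod summable_imp_abs_convergent_prod)
  then have "(\<lambda>K. partial_coeff t K n) \<longlonglongrightarrow> prodinf (\<lambda>k. bit_factor t k (bit n k))"
    unfolding partial_coeff_def LIMSEQ_lessThan_iff_atMost by (rule convergent_prod_LIMSEQ)
  then show ?thesis
    unfolding phase_coeff_def by (simp add: limI)
qed

lemma partial_coeff_le_1: "cmod (partial_coeff t K n) \<le> 1"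
proof -
  have "cmod (partial_coeff t K n) = (\<Prod>k<K. cmod (bit_factor t k (bit n k)))"
    unfolding partial_coeff_def by (rule prod_norm[symmetric])
  also have "\<dots> \<le> 1"
    by (rule prod_le_1) (simp add: norm_bit_factor)
  finally show ?thesis .
qed

lemma phase_coeff_le_1: "cmod (phase_coeff t n) \<le> 1"
proof (rule tendsto_upperbound[OF tendsto_norm[OF phase_coeff_LIMSEQ]])
  show "\<forall>\<^sub>F K in sequentially. cmod (partial_coeff t K n) \<le> 1"
    by (simp add: partial_coeff_le_1)
qed simp

lemma phase_coeff_neg: "phase_coeff (- t) n = cnj (phase_coeff t n)"
proof (rule LIMSEQ_unique[OF phase_coeff_LIMSEQ])
  have "partial_coeff (- t) K n = cnj (partial_coeff t K n)" for K
    by (simp add: partial_coeff_def bit_factor_neg)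
  then show "(\<lambda>K. partial_coeff (- t) K n) \<longlonglongrightarrow> cnj (phase_coeff t n)"
    using tendsto_cnj[OF phase_coeff_LIMSEQ] by simp
qed

lemma phase_coeff_xor_low:
  assumes "j < 2"
  shows "phase_coeff t (n XOR 2 ^ j) = phase_coeff t n"
proof -
  have "bit_factor t k (bit (n XOR 2 ^ j) k) = bit_factor t k (bit n k)" for k
  proof (cases "k < 2")
    case False
    with assms have "j \<noteq> k"
      by linarith
    then have "bit (n XOR 2 ^ j) k = bit n k"
      unfolding bit_xor_iff bit_exp_iff by blast
    then show ?thesis
      by (simp only:)
  qed (simp add: bit_factor_def)
  then show ?thesis
    unfolding phase_coeff_def partial_coeff_def by (simp only:)
qed

lemma phase_coeff_0_0: "phase_coeff 0 0 = 1 / 4"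
proof (rule LIMSEQ_unique[OF phase_coeff_LIMSEQ])
  have "partial_coeff 0 (K + 2) 0 = 1 / 4" for K
    by (induction K) (simp_all add: partial_coeff_def bit_factor_def numeral_2_eq_2)
  then have "(\<lambda>K. partial_coeff 0 (K + 2) 0) \<longlonglongrightarrow> 1 / 4"
    by (simp only: tendsto_const)
  then show "(\<lambda>K. partial_coeff 0 K 0) \<longlonglongrightarrow> 1 / 4"
    by (rule LIMSEQ_offset)
qed

definition rate_tail :: "nat \<Rightarrow> real" where
  "rate_tail K = (\<Sum>k. 1 / (real (k + K) + 1)\<^sup>2)"

lemma rate_tail_0: "rate_tail \<longlonglongrightarrow> 0"
proof -
  have "rate_tail = (\<lambda>K. (\<Sum>k. 1 / (real k + 1)\<^sup>2) - (\<Sum>k<K. 1 / (real k + 1)\<^sup>2))"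
    unfolding rate_tail_def using suminf_minus_initial_segment[OF summable_rate] by simp
  then show ?thesis
    using tendsto_diff[OF tendsto_const summable_LIMSEQ[OF summable_rate], of "\<Sum>k. 1 / (real k + 1)\<^sup>2"]
    by simp
qed

text \<open>The factors from \<open>K\<close> on are cosines of small angles, so their product is
  \<open>1\<close> up to the sum of these angles. The factor
  \<open>cmod (partial_coeff t K n)\<close> makes the error summable over \<open>n\<close>.\<close>

lemma phase_coeff_partial_coeff:
  assumes "n < 2 ^ K" "2 \<le> K"
  shows "cmod (phase_coeff t n - partial_coeff t K n) \<le> cmod (partial_coeff t K n) * (\<bar>t\<bar> * rate_tail K)"
proof (rule tendsto_upperbound)
  show "((\<lambda>L. cmod (partial_coeff t L n - partial_coeff t K n)) \<longlongrightarrow> cmod (phase_coeff t n - partial_coeff t K n)) sequentially"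
    by (intro tendsto_intros phase_coeff_LIMSEQ)
  show "\<forall>\<^sub>F L in sequentially. cmod (partial_coeff t L n - partial_coeff t K n) \<le> cmod (partial_coeff t K n) * (\<bar>t\<bar> * rate_tail K)"
  proof (rule eventually_sequentiallyI)
    fix L assume L: "K \<le> L"
    define q where "q = (\<Prod>k\<in>{K..<L}. bit_factor t k False)"
    have "{..<L} = {..<K} \<union> {K..<L}"
      using L by auto
    then have "partial_coeff t L n = partial_coeff t K n * (\<Prod>k\<in>{K..<L}. bit_factor t k (bit n k))"
      unfolding partial_coeff_def by (simp add: prod.union_disjoint ivl_disj_int)
    also have "(\<Prod>k\<in>{K..<L}. bit_factor t k (bit n k)) = q"
      unfolding q_def by (intro prod.cong) (auto simp: bit_ge_False[OF assms(1)])
    finally have eq: "partial_coeff t L n - partial_coeff t K n = partial_coeff t K n * (q - 1)"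
      by (simp add: algebra_simps)
    have "cmod (q - 1) \<le> (\<Sum>k\<in>{K..<L}. cmod (bit_factor t k False - 1))"
      unfolding q_def using norm_prod_diff[of "{K..<L}" "\<lambda>k. bit_factor t k False" "\<lambda>_. 1"] norm_bit_factor by simp
    also have "\<dots> \<le> (\<Sum>k\<in>{K..<L}. \<bar>t\<bar> * (1 / (real k + 1)\<^sup>2))"
      using assms(2) by (intro sum_mono bit_factor_False_near_1) auto
    also have "\<dots> = \<bar>t\<bar> * (\<Sum>k=0 + K..<(L - K) + K. 1 / (real k + 1)\<^sup>2)"
      using L by (simp add: sum_distrib_left)
    also have "\<dots> = \<bar>t\<bar> * (\<Sum>k<L - K. 1 / (real (k + K) + 1)\<^sup>2)"
      unfolding sum.shift_bounds_nat_ivl lessThan_atLeast0 ..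
    also have "\<dots> \<le> \<bar>t\<bar> * rate_tail K"
      unfolding rate_tail_def
      by (intro mult_left_mono sum_le_suminf)
        (auto simp: summable_iff_shift[of "\<lambda>k. 1 / (real k + 1)\<^sup>2", simplified] summable_rate)
    finally show "cmod (partial_coeff t L n - partial_coeff t K n) \<le> cmod (partial_coeff t K n) * (\<bar>t\<bar> * rate_tail K)"
      unfolding eq norm_mult by (intro mult_left_mono) auto
  qed
qed simp

lemma partial_coeff_l1: "(\<Sum>n<2 ^ K. cmod (partial_coeff t K n)) \<le> exp (\<bar>t\<bar> * rate_tail 0)"
proof -
  have "(\<Sum>n<2 ^ K. cmod (partial_coeff t K n)) = (\<Sum>n<(2::nat) ^ K. \<Prod>k<K. cmod (bit_factor t k (bit n k)))"
    unfolding partial_coeff_def by (rule sum.cong[OF refl prod_norm[symmetric]])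
  also have "\<dots> = (\<Prod>k<K. cmod (bit_factor t k False) + cmod (bit_factor t k True))"
    by (rule sum_prod_bits)
  also have "\<dots> \<le> (\<Prod>k<K. exp (\<bar>t\<bar> * (1 / (real k + 1)\<^sup>2)))"
  proof (rule prod_mono)
    fix k
    have "cmod (bit_factor t k False) + cmod (bit_factor t k True) \<le> 1 + \<bar>t\<bar> * (1 / (real k + 1)\<^sup>2)"
      using add_mono[OF abs_cos_le_one abs_sin_x_le_abs_x, of "t / (real k + 1)\<^sup>2" "t / (real k + 1)\<^sup>2"]
      by (auto simp: bit_factor_def norm_mult)
    also have "\<dots> \<le> exp (\<bar>t\<bar> * (1 / (real k + 1)\<^sup>2))"
      by (rule exp_ge_add_one_self)
    finally show "0 \<le> cmod (bit_factor t k False) + cmod (bit_factor t k True) \<and>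
        cmod (bit_factor t k False) + cmod (bit_factor t k True) \<le> exp (\<bar>t\<bar> * (1 / (real k + 1)\<^sup>2))"
      by simp
  qed
  also have "\<dots> = exp (\<bar>t\<bar> * (\<Sum>k<K. 1 / (real k + 1)\<^sup>2))"
    by (simp add: exp_sum sum_distrib_left)
  also have "\<dots> \<le> exp (\<bar>t\<bar> * rate_tail 0)"
    unfolding rate_tail_def using sum_le_suminf[OF summable_rate, of "{..<K}"]
    by (auto intro!: mult_left_mono)
  finally show ?thesis .
qed

lemma phase_coeff_l1: "phase_coeff t abs_summable_on UNIV"
proof (rule nonneg_bdd_above_summable_on)
  show "bdd_above (sum (\<lambda>n. cmod (phase_coeff t n)) ` {F. F \<subseteq> UNIV \<and> finite F})"
  proof (rule bdd_aboveI2)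
    fix F :: "nat set" assume "F \<in> {F. F \<subseteq> UNIV \<and> finite F}"
    then have F: "finite F"
      by simp
    then obtain N0 where "F \<subseteq> {..<N0}"
      using finite_nat_iff_bounded by blast
    then have N: "F \<subseteq> {..<2 ^ N0}"
      by (meson lessThan_subset_iff less_exp less_imp_le order_trans)
    have "(\<lambda>K. \<Sum>n\<in>F. cmod (partial_coeff t K n)) \<longlonglongrightarrow> (\<Sum>n\<in>F. cmod (phase_coeff t n))"
      by (intro tendsto_intros phase_coeff_LIMSEQ)
    moreover have "(\<Sum>n\<in>F. cmod (partial_coeff t K n)) \<le> exp (\<bar>t\<bar> * rate_tail 0)" if "K \<ge> N0" for K
    proof -
      have "F \<subseteq> {..<2 ^ K}"
        using N power_increasing[OF that, of "2::nat"]
        by (meson lessThan_subset_iff one_le_numeral order_trans)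
      then have "(\<Sum>n\<in>F. cmod (partial_coeff t K n)) \<le> (\<Sum>n<2 ^ K. cmod (partial_coeff t K n))"
        by (intro sum_mono2) auto
      then show ?thesis
        using partial_coeff_l1 order_trans by blast
    qed
    ultimately show "(\<Sum>n\<in>F. cmod (phase_coeff t n)) \<le> exp (\<bar>t\<bar> * rate_tail 0)"
      by (intro tendsto_upperbound[where F = sequentially]) (auto intro: eventually_sequentiallyI)
  qed
qed simp

lemma partial_coeff_conv: "(\<Sum>m<2 ^ K. partial_coeff s K m * partial_coeff t K (m XOR n)) = partial_coeff (s + t) K n"
  unfolding partial_coeff_def prod.distrib[symmetric] bit_xor_iff
  using sum_prod_bits[where K = K and F = "\<lambda>k b. bit_factor s k b * bit_factor t k (b \<noteq> bit n k)"]
  unfolding bit_factor_conv .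

lemma abs_summable_mult_bounded:
  fixes f g :: "'i \<Rightarrow> complex"
  assumes "f abs_summable_on A" "\<And>m. m \<in> A \<Longrightarrow> cmod (g m) \<le> C"
  shows "(\<lambda>m. f m * g m) abs_summable_on A"
proof (rule summable_on_comparison_test)
  show "(\<lambda>m. norm (f m) * C) summable_on A"
    by (intro summable_on_cmult_left assms)
qed (auto simp: norm_mult intro: mult_left_mono assms)

lemma xor_less_exp: "m < 2 ^ K \<Longrightarrow> n < 2 ^ K \<Longrightarrow> (m XOR n :: nat) < 2 ^ K"
  by (metis take_bit_nat_eq_self_iff take_bit_xor)

text \<open>The functions with these coefficients multiply like exponentials. For the partial
  products the identity is exact; \<open>phase_coeff_partial_coeff\<close> and
  \<open>partial_coeff_l1\<close> bound the difference of the two sums.\<close>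

lemma phase_coeff_conv: "((\<lambda>m. phase_coeff s m * phase_coeff t (m XOR n)) has_sum phase_coeff (s + t) n) UNIV"
proof -
  define S where "S = (\<Sum>\<^sub>\<infinity>m. phase_coeff s m * phase_coeff t (m XOR n))"
  have hs: "((\<lambda>m. phase_coeff s m * phase_coeff t (m XOR n)) has_sum S) UNIV"
    unfolding S_def
    by (rule has_sum_infsum[OF abs_summable_summable[OF abs_summable_mult_bounded[OF phase_coeff_l1 phase_coeff_le_1]]])
  then have "(\<lambda>K. \<Sum>m<2 ^ K. phase_coeff s m * phase_coeff t (m XOR n)) \<longlonglongrightarrow> S"
    using LIMSEQ_subseq_LIMSEQ[OF has_sum_imp_sums[OF hs, unfolded sums_def], of "\<lambda>K. 2 ^ K"]
    by (simp add: strict_mono_def o_def)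
  moreover have "(\<lambda>K. (\<Sum>m<2 ^ K. phase_coeff s m * phase_coeff t (m XOR n)) - partial_coeff (s + t) K n) \<longlonglongrightarrow> 0"
  proof (rule Lim_null_comparison)
    define C where "C = exp (\<bar>s\<bar> * rate_tail 0) * \<bar>s\<bar> + exp (\<bar>s\<bar> * rate_tail 0) * \<bar>t\<bar>"
    obtain N where N: "n < 2 ^ N"
      using less_exp by blast
    have "cmod ((\<Sum>m<2 ^ K. phase_coeff s m * phase_coeff t (m XOR n)) - partial_coeff (s + t) K n) \<le> C * rate_tail K"
      if K: "K \<ge> N + 2" for K
    proof -
      have n: "n < 2 ^ K"
        by (rule less_le_trans[OF N power_increasing]) (use K in auto)
      have t0: "0 \<le> rate_tail K"
        unfolding rate_tail_def by (intro suminf_nonneg)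
          (auto simp: summable_iff_shift[of "\<lambda>k. 1 / (real k + 1)\<^sup>2", simplified] summable_rate)
      have est: "cmod (phase_coeff s m * phase_coeff t (m XOR n) - partial_coeff s K m * partial_coeff t K (m XOR n))
          \<le> cmod (partial_coeff s K m) * ((\<bar>s\<bar> + \<bar>t\<bar>) * rate_tail K)" if m: "m < 2 ^ K" for m
      proof -
        have "cmod (phase_coeff t (m XOR n) - partial_coeff t K (m XOR n)) \<le> cmod (partial_coeff t K (m XOR n)) * (\<bar>t\<bar> * rate_tail K)"
          using phase_coeff_partial_coeff[OF xor_less_exp[OF m n], of t] K by simp
        also have "\<dots> \<le> 1 * (\<bar>t\<bar> * rate_tail K)"
          by (intro mult_right_mono partial_coeff_le_1) (use t0 in auto)
        finally have b: "cmod (phase_coeff t (m XOR n) - partial_coeff t K (m XOR n)) \<le> \<bar>t\<bar> * rate_tail K"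
          by simp
        have eq: "phase_coeff s m * phase_coeff t (m XOR n) - partial_coeff s K m * partial_coeff t K (m XOR n)
           = (phase_coeff s m - partial_coeff s K m) * phase_coeff t (m XOR n) + partial_coeff s K m * (phase_coeff t (m XOR n) - partial_coeff t K (m XOR n))"
          by (simp add: algebra_simps)
        have "cmod (phase_coeff s m * phase_coeff t (m XOR n) - partial_coeff s K m * partial_coeff t K (m XOR n))
           \<le> cmod (phase_coeff s m - partial_coeff s K m) * cmod (phase_coeff t (m XOR n))
             + cmod (partial_coeff s K m) * cmod (phase_coeff t (m XOR n) - partial_coeff t K (m XOR n))"
          unfolding eq norm_mult[symmetric] by (rule norm_triangle_ineq)
        also have "\<dots> \<le> cmod (partial_coeff s K m) * (\<bar>s\<bar> * rate_tail K) * 1 + cmod (partial_coeff s K m) * (\<bar>t\<bar> * rate_tail K)"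
          using phase_coeff_partial_coeff[OF m, of s] K phase_coeff_le_1 t0 b by (intro add_mono mult_mono) auto
        also have "\<dots> = cmod (partial_coeff s K m) * ((\<bar>s\<bar> + \<bar>t\<bar>) * rate_tail K)"
          by (simp add: algebra_simps)
        finally show ?thesis .
      qed
      have "cmod ((\<Sum>m<2 ^ K. phase_coeff s m * phase_coeff t (m XOR n)) - partial_coeff (s + t) K n)
         = cmod (\<Sum>m<2 ^ K. phase_coeff s m * phase_coeff t (m XOR n) - partial_coeff s K m * partial_coeff t K (m XOR n))"
        unfolding partial_coeff_conv[symmetric] by (simp add: sum_subtractf)
      also have "\<dots> \<le> (\<Sum>m<2 ^ K. cmod (partial_coeff s K m) * ((\<bar>s\<bar> + \<bar>t\<bar>) * rate_tail K))"
        using est by (intro order_trans[OF norm_sum] sum_mono) simp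
      also have "\<dots> = (\<Sum>m<2 ^ K. cmod (partial_coeff s K m)) * ((\<bar>s\<bar> + \<bar>t\<bar>) * rate_tail K)"
        by (simp add: sum_distrib_right)
      also have "\<dots> \<le> exp (\<bar>s\<bar> * rate_tail 0) * ((\<bar>s\<bar> + \<bar>t\<bar>) * rate_tail K)"
        by (intro mult_right_mono partial_coeff_l1) (use t0 in auto)
      finally show ?thesis
        by (simp add: C_def algebra_simps)
    qed
    then show "\<forall>\<^sub>F K in sequentially. cmod ((\<Sum>m<2 ^ K. phase_coeff s m * phase_coeff t (m XOR n)) - partial_coeff (s + t) K n) \<le> C * rate_tail K"
      by (rule eventually_sequentiallyI)
    show "(\<lambda>K. C * rate_tail K) \<longlonglongrightarrow> 0"
      using tendsto_mult_left[OF rate_tail_0, of C] by simp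
  qed
  ultimately have "(\<lambda>K. partial_coeff (s + t) K n) \<longlonglongrightarrow> S - 0"
    using tendsto_diff by fastforce
  then have "S = phase_coeff (s + t) n"
    using LIMSEQ_unique[OF phase_coeff_LIMSEQ] by auto
  then show ?thesis
    using hs by simp
qed

section \<open>Decay of the coefficients\<close>

lemma power8_times_geometric_bounded:
  fixes r :: real
  assumes "0 < r" "r < 1"
  shows "\<exists>B\<ge>0. \<forall>m. real m ^ 8 * r ^ m \<le> B"
proof -
  define x where "x = root 8 (1 / r)"
  have x: "1 < x" "x ^ 8 = 1 / r"
    using assms by (auto simp: x_def real_root_gt_1_iff)
  have "(\<lambda>n. real n / x ^ n) \<longlonglongrightarrow> 0"
    using lim_n_over_pown[of x] x(1) by simp
  then have "Bseq (\<lambda>n. real n / x ^ n)"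
    by (intro convergent_imp_Bseq convergentI)
  then obtain C where C: "norm (real n / x ^ n) \<le> C" for n
    unfolding Bseq_def by auto
  have "real m ^ 8 * r ^ m \<le> C ^ 8" for m
  proof -
    have "(x ^ m) ^ 8 = (x ^ 8) ^ m"
      unfolding power_mult[symmetric] by (simp only: mult.commute)
    then have "(x ^ m) ^ 8 = 1 / r ^ m"
      unfolding x(2) power_one_over .
    then have "real m ^ 8 * r ^ m = (real m / x ^ m) ^ 8"
      unfolding power_divide by simp
    also have "\<dots> \<le> C ^ 8"
      using C[of m] x(1) by (intro power_mono) auto
    finally show ?thesis .
  qed
  then show ?thesis
    by (metis zero_le_even_power'[of C 4] even_numeral zero_le_even_power)
qed

lemma norm_bit_factor_window:
  assumes "2 \<le> k" "1 / 100 \<le> t / (real k + 1)\<^sup>2" "t / (real k + 1)\<^sup>2 \<le> 1 / 2"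
  shows "cmod (bit_factor t k c) \<le> max (cos (1 / 100)) (1 / 2)"
proof -
  define x where "x = t / (real k + 1)\<^sup>2"
  have pi: "(2::real) \<le> pi"
    by (rule pi_ge_two)
  have x: "1 / 100 \<le> x" "x \<le> 1 / 2"
    using assms by (simp_all only: x_def)
  have "0 \<le> cos x"
    using x pi by (intro cos_ge_zero) auto
  moreover have "cos x \<le> cos (1 / 100)"
    using x pi by (intro cos_monotone_0_pi_le) auto
  moreover have "\<bar>sin x\<bar> \<le> 1 / 2"
    using abs_sin_x_le_abs_x[of x] x by linarith
  ultimately show ?thesis
    using assms(1) by (auto simp: bit_factor_def norm_mult simp flip: x_def)
qed

text \<open>For about \<open>sqrt t\<close> indices \<open>k\<close> the angle
  \<open>t / (k + 1)\<^sup>2\<close> stays away from \<open>0\<close> and from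
  \<open>\<pi> / 2\<close>. Then cosine and sine both have modulus below a constant
  \<open>r < 1\<close>, so that the digits of \<open>n\<close> do not matter. The result is a bound
  \<open>r\<close> to the power \<open>sqrt t\<close>, and any power of \<open>t\<close> could
  replace the fourth one.\<close>

lemma phase_coeff_decay: "\<exists>C\<ge>0. \<forall>t\<ge>1. \<forall>n. cmod (phase_coeff t n) \<le> C / t ^ 4"
proof -
  define r :: real where "r = max (cos (1 / 100)) (1 / 2)"
  have "cos (1 / 100) < cos (0::real)"
    using pi_ge_two by (intro cos_monotone_0_pi) auto
  then have r: "0 < r" "r < 1"
    by (auto simp: r_def)
  obtain B where B: "0 \<le> B" "\<And>m. real m ^ 8 * r ^ m \<le> B"
    using power8_times_geometric_bounded[OF r] by blast
  have "cmod (phase_coeff t n) \<le> B / t ^ 4" if t: "1 \<le> t" for t n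
  proof -
    define m where "m = nat \<lceil>sqrt t\<rceil>"
    have s1: "1 \<le> sqrt t"
      using t by simp
    have m: "sqrt t \<le> real m" "real m \<le> 2 * sqrt t"
      using s1 unfolding m_def by linarith+
    have tm: "t \<le> (real m)\<^sup>2" "(real m)\<^sup>2 \<le> 4 * t"
    proof -
      have "(sqrt t)\<^sup>2 \<le> (real m)\<^sup>2" "(real m)\<^sup>2 \<le> (2 * sqrt t)\<^sup>2"
        using m s1 by (intro power_mono; simp)+
      then show "t \<le> (real m)\<^sup>2" "(real m)\<^sup>2 \<le> 4 * t"
        using t by (auto simp: power_mult_distrib)
    qed
    have m1: "1 \<le> real m"
      using s1 m(1) by linarith
    \<comment> \<open>This window has \<open>m\<close> elements, and \<open>(k + 1)\<^sup>2\<close> lies between \<open>4 t\<close> and \<open>100 t\<close> for \<open>k\<close> in it.\<close>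
    define W where "W = {2 * m + 2..<3 * m + 2}"
    have win: "cmod (bit_factor t k c) \<le> r" if k: "k \<in> W" for k c
      unfolding r_def
    proof (rule norm_bit_factor_window)
      have k2: "2 * real m \<le> real k + 1" "real k + 1 \<le> 5 * real m"
        using k m1 by (auto simp: W_def)
      have "(2 * real m)\<^sup>2 \<le> (real k + 1)\<^sup>2" "(real k + 1)\<^sup>2 \<le> (5 * real m)\<^sup>2"
        using k2 m1 by (intro power_mono; simp)+
      then have k3: "4 * t \<le> (real k + 1)\<^sup>2" "(real k + 1)\<^sup>2 \<le> 100 * t"
        using tm by (auto simp: power_mult_distrib)
      have k0: "0 < (real k + 1)\<^sup>2"
        by simp
      show "2 \<le> k"
        using k by (simp add: W_def)
      show "1 / 100 \<le> t / (real k + 1)\<^sup>2"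
        using k3(2) by (subst pos_le_divide_eq[OF k0]) simp
      show "t / (real k + 1)\<^sup>2 \<le> 1 / 2"
        using k3(1) t by (subst pos_divide_le_eq[OF k0]) simp
    qed
    have "cmod (partial_coeff t K n) \<le> r ^ m" if K: "K \<ge> 3 * m + 2" for K
    proof -
      have WK: "W \<subseteq> {..<K}"
        using K by (auto simp: W_def)
      have "cmod (partial_coeff t K n) = (\<Prod>k<K. cmod (bit_factor t k (bit n k)))"
        unfolding partial_coeff_def by (rule prod_norm[symmetric])
      also have "\<dots> = (\<Prod>k\<in>{..<K} - W. cmod (bit_factor t k (bit n k))) * (\<Prod>k\<in>W. cmod (bit_factor t k (bit n k)))"
        by (rule prod.subset_diff[OF WK]) simp
      also have "\<dots> \<le> 1 * (\<Prod>k\<in>W. r)"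
        by (intro mult_mono prod_le_1 prod_mono prod_nonneg) (auto simp: norm_bit_factor win)
      also have "\<dots> = r ^ m"
        by (simp add: W_def)
      finally show ?thesis .
    qed
    then have "cmod (phase_coeff t n) \<le> r ^ m"
      by (intro tendsto_upperbound[OF tendsto_norm[OF phase_coeff_LIMSEQ]] eventually_sequentiallyI) auto
    also have "r ^ m \<le> B / real m ^ 8"
      using B(2)[of m] m1 by (simp add: field_simps)
    also have "\<dots> \<le> B / t ^ 4"
    proof (rule divide_left_mono)
      have "t ^ 4 \<le> ((real m)\<^sup>2) ^ 4"
        using tm t by (intro power_mono) auto
      then show "t ^ 4 \<le> real m ^ 8"
        by (simp flip: power_mult)
      show "0 < real m ^ 8 * t ^ 4"
        using t m1 by simp
    qed (rule B)
    finally show ?thesis .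
  qed
  then show ?thesis
    using B(1) by blast
qed

lemma summable_on_inverse_square_int: "(\<lambda>u::int. 1 / (real_of_int u)\<^sup>2) summable_on UNIV"
proof -
  have s: "(\<lambda>n. 1 / (real n + 1)\<^sup>2) summable_on UNIV"
    by (subst summable_on_UNIV_nonneg_real_iff) (simp_all add: summable_rate)
  have p: "(\<lambda>u::int. 1 / (real_of_int u)\<^sup>2) summable_on (range (\<lambda>n. int n + 1))"
    by (subst summable_on_reindex) (use s in \<open>auto simp: o_def inj_on_def\<close>)
  have n: "(\<lambda>u::int. 1 / (real_of_int u)\<^sup>2) summable_on (range (\<lambda>n. - (int n + 1)))"
  proof (subst summable_on_reindex)
    have "(real_of_int (- (int n + 1)))\<^sup>2 = (real n + 1)\<^sup>2" for n
      unfolding of_int_minus power2_minus by simp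
    then show "((\<lambda>u::int. 1 / (real_of_int u)\<^sup>2) \<circ> (\<lambda>n. - (int n + 1))) summable_on UNIV"
      unfolding o_def using s by (simp only:)
  qed (auto simp: inj_on_def)
  have "UNIV = {0::int} \<union> (range (\<lambda>n. int n + 1) \<union> range (\<lambda>n. - (int n + 1)))"
  proof -
    have "u \<in> {0} \<union> (range (\<lambda>n. int n + 1) \<union> range (\<lambda>n. - (int n + 1)))" for u :: int
    proof (cases u "0::int" rule: linorder_cases)
      case less
      then have "u = - (int (nat (- u - 1)) + 1)"
        by simp
      then show ?thesis
        by blast
    next
      case greater
      then have "u = int (nat (u - 1)) + 1"
        by simp
      then show ?thesis
        by blast
    qed simp
    then show ?thesis
      by blast
  qed
  then show ?thesis
    using summable_on_union[OF summable_on_finite[of "{0}"] summable_on_union[OF p n]] by simp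
qed

text \<open>Here \<open>e u\<close> stands for the Fourier coefficients of \<open>V\<^sup>u\<close>
  on the subgroup \<open>x\<^sub>0 = x\<^sub>1 = 0\<close>, with \<open>0\<close> off it, where
  \<open>V = exp (i h)\<close> is unimodular. The sum of \<open>u\<^sup>2 b u\<close> controls a
  second order Taylor remainder in the level. The last condition says that the density of the level
  \<open>0\<close> has nonzero total mass.\<close>

locale phase =
  fixes e :: "int \<Rightarrow> nat \<Rightarrow> complex" and b :: "int \<Rightarrow> real"
  assumes e_l1: "e u abs_summable_on UNIV"
    and e_conv: "((\<lambda>m. e u m * e v (m XOR n)) has_sum e (u + v) n) UNIV"
    and e_cnj: "e (- u) n = cnj (e u n)"
    and e_bound: "cmod (e u n) \<le> b u"
    and b_summable: "(\<lambda>u. (1 + (real_of_int u)\<^sup>2) * b u) summable_on UNIV"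
    and e_low: "j < 2 \<Longrightarrow> e u (n XOR 2 ^ j) = e u n"
    and e_sum_0: "(\<Sum>\<^sub>\<infinity>u. e u 0) \<noteq> 0"

text \<open>The function \<open>h\<close> is scaled by a large factor \<open>M\<close>. This makes
  the coefficients with \<open>u \<noteq> 0\<close> small, while the one with \<open>u = 0\<close>
  has the value \<open>1 / 4\<close> at \<open>0\<close> for every \<open>M\<close>, so the sum at
  \<open>0\<close> is not \<open>0\<close>.\<close>

lemma phase_exists: "\<exists>e b. phase e b"
proof -
  obtain C where C: "0 \<le> C" "\<And>t n. 1 \<le> t \<Longrightarrow> cmod (phase_coeff t n) \<le> C / t ^ 4"
    using phase_coeff_decay by blast
  define Z where "Z = (\<Sum>\<^sub>\<infinity>u\<in>UNIV - {0::int}. 1 / (real_of_int u)\<^sup>2)"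
  have Z0: "0 \<le> Z"
    unfolding Z_def by (rule infsum_nonneg) simp
  \<comment> \<open>Then \<open>C / M * Z < 1 / 4\<close>, and \<open>M \<ge> 1\<close> makes the bound for the decay applicable to all \<open>u \<noteq> 0\<close>.\<close>
  define M where "M = 1 + 4 * C * Z"
  have M: "1 \<le> M" "4 * C * Z < M"
    using C(1) Z0 by (auto simp: M_def)
  define e where "e u n = phase_coeff (M * real_of_int u) n" for u n
  define b where "b u = (if u = 0 then 1 else C / M * (1 / (real_of_int u) ^ 4))" for u
  have eb: "cmod (e u n) \<le> b u" for u n
  proof (cases "u = 0")
    case False
    have pos: "cmod (phase_coeff (M * real_of_int v) n) \<le> C / M * (1 / (real_of_int v) ^ 4)" if "v > 0" for v
    proof -
      have v1: "1 \<le> real_of_int v"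
        using that by simp
      then have "1 \<le> M * real_of_int v"
        using M(1) mult_mono[of 1 M 1 "real_of_int v"] by simp
      then have "cmod (phase_coeff (M * real_of_int v) n) \<le> C / (M * real_of_int v) ^ 4"
        by (rule C(2))
      also have "\<dots> \<le> C / (M * real_of_int v ^ 4)"
      proof (rule divide_left_mono)
        have "M ^ 1 \<le> M ^ 4"
          by (rule power_increasing) (use M(1) in auto)
        then show "M * real_of_int v ^ 4 \<le> (M * real_of_int v) ^ 4"
          using v1 by (auto simp: power_mult_distrib intro!: mult_right_mono)
        show "0 < (M * real_of_int v) ^ 4 * (M * real_of_int v ^ 4)"
          using v1 M(1) by simp
      qed (rule C(1))
      finally show ?thesis
        by simp
    qed
    show ?thesis
    proof (cases "u > 0")
      case True
      then show ?thesis
        using pos[OF True] False by (simp add: e_def b_def)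
    next
      case False
      with \<open>u \<noteq> 0\<close> have "- u > 0"
        by simp
      moreover have "phase_coeff (M * real_of_int u) n = cnj (phase_coeff (M * real_of_int (- u)) n)"
        using phase_coeff_neg[of "M * real_of_int (- u)" n] by simp
      ultimately show ?thesis
        using pos[of "- u"] \<open>u \<noteq> 0\<close> by (simp add: e_def b_def)
    qed
  qed (simp add: e_def b_def phase_coeff_le_1)
  have sq: "(\<lambda>u. 1 / (real_of_int u)\<^sup>2) summable_on (UNIV - {0})"
    by (rule summable_on_subset_banach[OF summable_on_inverse_square_int]) auto
  have u1: "1 \<le> (real_of_int u)\<^sup>2" if "u \<noteq> 0" for u
    using that by (simp add: int_one_le_iff_zero_less flip: of_int_power)
  have bs: "(\<lambda>u. (1 + (real_of_int u)\<^sup>2) * b u) summable_on UNIV"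
  proof -
    have "(\<lambda>u. (1 + (real_of_int u)\<^sup>2) * b u) summable_on (UNIV - {0})"
    proof (rule summable_on_comparison_test)
      show "(\<lambda>u. 2 * C / M * (1 / (real_of_int u)\<^sup>2)) summable_on (UNIV - {0})"
        by (intro summable_on_cmult_right sq)
      fix u :: int assume "u \<in> UNIV - {0}"
      then have u: "u \<noteq> 0"
        by simp
      have "(1 + (real_of_int u)\<^sup>2) * b u \<le> (2 * (real_of_int u)\<^sup>2) * b u"
        using u1[OF u] C(1) M(1) u by (intro mult_right_mono) (auto simp: b_def)
      also have "\<dots> = 2 * C / M * (1 / (real_of_int u)\<^sup>2)"
        using u by (simp add: b_def power2_eq_square power4_eq_xxxx)
      finally show "(1 + (real_of_int u)\<^sup>2) * b u \<le> 2 * C / M * (1 / (real_of_int u)\<^sup>2)" .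
      show "0 \<le> (1 + (real_of_int u)\<^sup>2) * b u"
        using C(1) M(1) by (auto simp: b_def intro!: mult_nonneg_nonneg)
    qed
    then have "(\<lambda>u. (1 + (real_of_int u)\<^sup>2) * b u) summable_on (insert 0 (UNIV - {0}))"
      unfolding summable_on_insert_iff .
    moreover have "insert 0 (UNIV - {0::int}) = UNIV"
      by blast
    ultimately show ?thesis
      by (simp only:)
  qed
  have "(\<Sum>\<^sub>\<infinity>u. e u 0) \<noteq> 0"
  proof -
    have le: "norm (norm (e u 0)) \<le> C / M * (1 / (real_of_int u)\<^sup>2)" if "u \<in> UNIV - {0}" for u
    proof -
      have u: "u \<noteq> 0"
        using that by simp
      have "cmod (e u 0) \<le> C / M * (1 / (real_of_int u) ^ 4)"
        using eb[of u 0] u by (simp add: b_def)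
      also have "\<dots> \<le> C / M * (1 / (real_of_int u)\<^sup>2)"
      proof -
        have "(real_of_int u)\<^sup>2 * 1 \<le> (real_of_int u)\<^sup>2 * (real_of_int u)\<^sup>2"
          using u1[OF u] by (intro mult_left_mono) auto
        then have "(real_of_int u)\<^sup>2 \<le> (real_of_int u) ^ 4"
          by (simp add: power2_eq_square power4_eq_xxxx)
        then show ?thesis
          using u C(1) M(1) by (intro mult_left_mono divide_left_mono) auto
      qed
      finally show ?thesis
        by simp
    qed
    have abs: "(\<lambda>u. e u 0) abs_summable_on (UNIV - {0})"
      by (rule summable_on_comparison_test[OF summable_on_cmult_right[OF sq, of "C / M"]]) (use le in auto)
    have "norm (\<Sum>\<^sub>\<infinity>u\<in>UNIV - {0}. e u 0) \<le> (\<Sum>\<^sub>\<infinity>u\<in>UNIV - {0}. norm (e u 0))"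
      by (rule norm_infsum_bound[OF abs])
    also have "\<dots> \<le> (\<Sum>\<^sub>\<infinity>u\<in>UNIV - {0}. C / M * (1 / (real_of_int u)\<^sup>2))"
      by (rule infsum_mono[OF abs summable_on_cmult_right[OF sq]]) (use le in auto)
    also have "\<dots> = C / M * Z"
      unfolding Z_def by (rule infsum_cmult_right[OF sq])
    also have "\<dots> < 1 / 4"
      using M by (simp add: field_simps)
    finally have small: "norm (\<Sum>\<^sub>\<infinity>u\<in>UNIV - {0}. e u 0) < 1 / 4" .
    have "(\<Sum>\<^sub>\<infinity>u\<in>insert 0 (UNIV - {0}). e u 0) = e 0 0 + (\<Sum>\<^sub>\<infinity>u\<in>UNIV - {0}. e u 0)"
      by (rule infsum_insert[OF abs_summable_summable[OF abs]]) simp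
    moreover have "insert 0 (UNIV - {0::int}) = UNIV" "e 0 0 = 1 / 4"
      by (auto simp: e_def phase_coeff_0_0)
    ultimately have eq: "(\<Sum>\<^sub>\<infinity>u. e u 0) = 1 / 4 + (\<Sum>\<^sub>\<infinity>u\<in>UNIV - {0}. e u 0)"
      by (simp only:)
    show ?thesis
    proof
      assume "(\<Sum>\<^sub>\<infinity>u. e u 0) = 0"
      then have "(\<Sum>\<^sub>\<infinity>u\<in>UNIV - {0}. e u 0) = - (1 / 4)"
        unfolding eq by (simp add: add_eq_0_iff)
      then show False
        using small by simp
    qed
  qed
  then have "phase e b"
    using eb bs
  proof unfold_locales
    show "e u abs_summable_on UNIV" for u
      unfolding e_def by (rule phase_coeff_l1)
    show "((\<lambda>m. e u m * e v (m XOR n)) has_sum e (u + v) n) UNIV" for u v n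
      using phase_coeff_conv[of "M * real_of_int u" "M * real_of_int v" n] by (simp add: e_def distrib_left)
    show "e (- u) n = cnj (e u n)" for u n
      using phase_coeff_neg[of "M * real_of_int u" n] by (simp add: e_def)
    show "e u (n XOR 2 ^ j) = e u n" if "j < 2" for u n j
      unfolding e_def by (rule phase_coeff_xor_low[OF that])
  qed auto
  then show ?thesis
    by blast
qed

section \<open>Pairings and the positivity of autocorrelations\<close>

definition nonneg_real :: "complex \<Rightarrow> bool" where
  "nonneg_real z \<longleftrightarrow> Im z = 0 \<and> 0 \<le> Re z"

lemma nonneg_real_add: "nonneg_real z \<Longrightarrow> nonneg_real w \<Longrightarrow> nonneg_real (z + w)"
  by (simp add: nonneg_real_def)

lemma nonneg_real_add_eq_0: "nonneg_real z \<Longrightarrow> nonneg_real w \<Longrightarrow> z + w = 0 \<Longrightarrow> z = 0 \<and> w = 0"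
  by (auto simp: nonneg_real_def complex_eq_iff)

lemma nonneg_real_cin_self: "nonneg_real (cin x x)"
  by (simp add: nonneg_real_def cin_self)

lemma nonneg_real_infsum: "(\<And>x. x \<in> A \<Longrightarrow> nonneg_real (f x)) \<Longrightarrow> nonneg_real (infsum f A)"
proof (cases "f summable_on A")
  case True
  assume f: "\<And>x. x \<in> A \<Longrightarrow> nonneg_real (f x)"
  have "infsum (\<lambda>x. Im (f x)) A = infsum (\<lambda>_. 0) A"
    using f by (intro infsum_cong) (simp add: nonneg_real_def)
  then show ?thesis
    using f by (auto simp: nonneg_real_def infsum_Re[OF True, symmetric] infsum_Im[OF True, symmetric]
        intro!: infsum_nonneg)
qed (simp add: infsum_not_exists nonneg_real_def)

lemma nonneg_real_LIMSEQ:
  assumes "\<And>n. nonneg_real (f n)" "f \<longlonglongrightarrow> l"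
  shows "nonneg_real l"
proof -
  have "(\<lambda>n. Im (f n)) \<longlonglongrightarrow> Im l" "(\<lambda>n. Re (f n)) \<longlonglongrightarrow> Re l"
    by (intro tendsto_intros assms)+
  then show ?thesis
    using assms(1) by (auto simp: nonneg_real_def LIMSEQ_const_iff intro: LIMSEQ_le_const)
qed

text \<open>The vector \<open>delta 0\<close> is the constant function \<open>1\<close> on the
  Cantor group. If \<open>P\<close> and \<open>Q\<close> are the multiplications by the indicator
  functions of \<open>A\<close> and \<open>B\<close>, this is the mass that the convolution kernel
  puts on \<open>A \<times> B\<close>.\<close>

definition pairing :: "(nat \<Rightarrow> complex) \<Rightarrow> (ell2 \<Rightarrow> ell2) \<Rightarrow> (ell2 \<Rightarrow> ell2) \<Rightarrow> complex" where
  "pairing t P Q = cin (diag t (P (delta 0))) (Q (delta 0))"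

lemma norm_is_proj: "is_proj P \<Longrightarrow> norm (P x) \<le> norm x"
  by (metis is_proj_eq_orth_proj is_proj_range_closed orth_proj_norm)

lemma pairing_bound:
  assumes "\<And>n. cmod (t n) \<le> C" "conv_proj P" "conv_proj Q"
  shows "cmod (pairing t P Q) \<le> C"
proof -
  have C: "0 \<le> C"
    using norm_ge_zero assms(1)[of 0] by (rule order_trans)
  define p where "p = P (delta 0)"
  have p: "norm p \<le> 1"
    using norm_is_proj[of P "delta 0"] assms(2) by (simp add: conv_proj_def p_def)
  have q: "norm (Q (delta 0)) \<le> 1"
    using norm_is_proj[of Q "delta 0"] assms(3) by (simp add: conv_proj_def)
  have "norm (diag t p) \<le> C * norm p"
    by (rule norm_diag[OF assms(1)])
  also have "\<dots> \<le> C * 1"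
    by (intro mult_left_mono p C)
  finally have "norm (diag t p) * norm (Q (delta 0)) \<le> C * 1"
    using C q by (intro mult_mono) auto
  then show ?thesis
    unfolding pairing_def p_def[symmetric] using cin_bound order_trans by fastforce
qed

lemma pairing_has_sum:
  assumes "\<And>n. cmod (t n) \<le> C"
  shows "((\<lambda>n. t n * (coef (P (delta 0)) n * cnj (coef (Q (delta 0)) n))) has_sum pairing t P Q) UNIV"
  using cin_has_sum[of "diag t (P (delta 0))" "Q (delta 0)"] coef_diag[OF assms]
  by (simp add: pairing_def mult.assoc)

lemma pairing_add:
  assumes "\<And>n. cmod (t n) \<le> C" "\<And>n. cmod (s n) \<le> D"
  shows "pairing (\<lambda>n. t n + s n) P Q = pairing t P Q + pairing s P Q"
proof -
  have "cmod (t n + s n) \<le> C + D" for n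
    using norm_triangle_mono[OF assms] .
  from pairing_has_sum[where t = "\<lambda>n. t n + s n", OF this, of P Q]
    has_sum_add[OF pairing_has_sum[where t = t, OF assms(1), of P Q] pairing_has_sum[where t = s, OF assms(2), of P Q]]
  show ?thesis
    by (auto simp: distrib_right intro: has_sum_unique)
qed

lemma pairing_cmult: "pairing (\<lambda>n. c * t n) P Q = c * pairing t P Q" if "\<And>n. cmod (t n) \<le> C"
proof -
  have "cmod (c * t n) \<le> cmod c * C" for n
    using that[of n] by (auto simp: norm_mult intro: mult_left_mono)
  from pairing_has_sum[where t = "\<lambda>n. c * t n", OF this, of P Q]
    has_sum_cmult_right[OF pairing_has_sum[where t = t, OF that, of P Q], of c]
  show ?thesis
    by (auto simp: mult.assoc intro: has_sum_unique)
qed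

lemma pairing_sum:
  assumes "finite I" "\<And>i n. cmod (t i n) \<le> C"
  shows "pairing (\<lambda>n. \<Sum>i\<in>I. t i n) P Q = (\<Sum>i\<in>I. pairing (t i) P Q)"
  using assms(1)
proof (induction I)
  case empty
  have "((\<lambda>n. 0 * (coef (P (delta 0)) n * cnj (coef (Q (delta 0)) n))) has_sum pairing (\<lambda>n. 0) P Q) UNIV"
    by (rule pairing_has_sum[where C = 0]) simp
  then show ?case
    using has_sum_unique[OF _ has_sum_0[of UNIV "\<lambda>_. 0"]] by simp
next
  case (insert i I)
  have "cmod (\<Sum>i\<in>I. t i n) \<le> of_nat (card I) * C" for n
    using assms(2) by (intro sum_norm_bound) auto
  from pairing_add[OF assms(2) this] insert show ?case
    by simp
qed

lemma pairing_infsum: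
  fixes f :: "'i \<Rightarrow> nat \<Rightarrow> complex"
  assumes f: "\<And>u n. cmod (f u n) \<le> b u" and b: "b summable_on UNIV"
  shows "pairing (\<lambda>n. \<Sum>\<^sub>\<infinity>u. f u n) P Q = (\<Sum>\<^sub>\<infinity>u. pairing (f u) P Q)"
proof -
  define w where "w n = coef (P (delta 0)) n * cnj (coef (Q (delta 0)) n)" for n
  have w: "w abs_summable_on UNIV"
    unfolding w_def by (rule cin_summable)
  have b0: "0 \<le> b u" for u
    using norm_ge_zero f[of u 0] by (rule order_trans)
  have fn: "(\<lambda>u. f u n) abs_summable_on UNIV" for n
    by (rule summable_on_comparison_test[OF b]) (use f in auto)
  have bound: "cmod (\<Sum>\<^sub>\<infinity>u. f u n) \<le> infsum b UNIV" for n
    using norm_infsum_bound[OF fn, of n] infsum_mono[OF fn b, of n] f by (meson UNIV_I order_trans)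
  have "(\<lambda>(u, n). f u n * w n) abs_summable_on UNIV \<times> UNIV"
  proof (rule Infinite_Sum.abs_summable_on_comparison_test)
    show "(\<lambda>(u, n). b u * w n) abs_summable_on UNIV \<times> UNIV"
      unfolding Infinite_Sum.abs_summable_on_Sigma_iff using w b b0
      by (auto simp: norm_mult infsum_cmult_right' summable_on_cmult_right summable_on_cmult_left
          abs_mult infsum_nonneg)
    show "norm (case x of (u, n) \<Rightarrow> f u n * w n) \<le> norm (case x of (u, n) \<Rightarrow> b u * w n)" for x
      using f b0 by (auto simp: norm_mult split: prod.split intro: mult_right_mono)
  qed
  then have sm: "(\<lambda>(u, n). f u n * w n) summable_on UNIV \<times> UNIV"
    by (rule abs_summable_summable)
  have "pairing (\<lambda>n. \<Sum>\<^sub>\<infinity>u. f u n) P Q = (\<Sum>\<^sub>\<infinity>n. (\<Sum>\<^sub>\<infinity>u. f u n) * w n)"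
    using pairing_has_sum[where t = "\<lambda>n. \<Sum>\<^sub>\<infinity>u. f u n", OF bound, of P Q]
    unfolding w_def by (simp add: infsumI)
  also have "\<dots> = (\<Sum>\<^sub>\<infinity>n. \<Sum>\<^sub>\<infinity>u. f u n * w n)"
    by (simp only: infsum_cmult_left')
  also have "\<dots> = (\<Sum>\<^sub>\<infinity>u. \<Sum>\<^sub>\<infinity>n. f u n * w n)"
    by (rule infsum_swap_banach[OF sm, symmetric])
  also have "\<dots> = (\<Sum>\<^sub>\<infinity>u. pairing (f u) P Q)"
  proof (rule infsum_cong)
    fix u
    show "(\<Sum>\<^sub>\<infinity>n. f u n * w n) = pairing (f u) P Q"
      using pairing_has_sum[where t = "f u", OF f, of P Q] unfolding w_def by (rule infsumI)
  qed
  finally show ?thesis .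
qed

text \<open>A self-adjoint symmetric matrix is real.\<close>

lemma conv_proj_coef_real:
  assumes "conv_proj Q"
  shows "cnj (coef (Q (delta 0)) n) = coef (Q (delta 0)) n"
proof -
  have Q: "is_proj Q" "Q \<in> conv_ops"
    using assms by (auto simp: conv_proj_def)
  have "coef (Q (delta 0)) n = cnj (coef (Q (delta n)) 0)"
    using is_projD(3)[OF Q(1), of "delta 0" "delta n"] by simp
  also have "coef (Q (delta n)) 0 = coef (Q (delta 0)) n"
    using conv_ops_delta[OF Q(2), of n 0] by simp
  finally show ?thesis
    by (metis complex_cnj_cnj)
qed

text \<open>The symbol is that of the convolution by \<open>\<bar>f\<bar>\<^sup>2\<close>, where
  \<open>f\<close> has the Fourier coefficients \<open>k\<close>, so its kernel is nonnegative. On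
  the side of the coefficients, this is the Schur product theorem: expanding the coefficients
  \<open>p\<close> of \<open>P = P P\<close> as an autocorrelation turns the pairing into a sum of
  squares \<open>\<parallel>Q w\<^sub>l\<parallel>\<^sup>2\<close> over \<open>l\<close>.\<close>

lemma pairing_autocorrelation:
  assumes k: "k abs_summable_on UNIV" and PQ: "conv_proj P" "conv_proj Q"
  shows "nonneg_real (pairing (\<lambda>n. \<Sum>\<^sub>\<infinity>j. k j * cnj (k (j XOR n))) P Q)"
proof -
  define p where "p = coef (P (delta 0))"
  define q where "q = coef (Q (delta 0))"
  have P: "is_proj P" "P \<in> conv_ops" and Q: "is_proj Q" "Q \<in> conv_ops"
    using PQ by (auto simp: conv_proj_def)
  have q_real: "cnj (q n) = q n" and p_real: "cnj (p n) = p n" for n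
    unfolding p_def q_def by (rule conv_proj_coef_real[OF PQ(2)], rule conv_proj_coef_real[OF PQ(1)])
  define K where "K = (\<Sum>\<^sub>\<infinity>j. cmod (k j))"
  define g where "g j n = k j * cnj (k (j XOR n))" for j n
  have kx: "(\<lambda>n. cmod (k (j XOR n))) summable_on UNIV" "(\<Sum>\<^sub>\<infinity>n. cmod (k (j XOR n))) = K" for j
    using summable_on_xor[of "\<lambda>n. cmod (k n)" j] infsum_xor[of "\<lambda>n. cmod (k n)" j] k
    by (simp_all add: K_def xor.commute[of j])
  have K0: "0 \<le> K"
    unfolding K_def by (rule infsum_nonneg) simp
  have g: "(\<lambda>(j, n). g j n) abs_summable_on UNIV \<times> UNIV"
    unfolding Infinite_Sum.abs_summable_on_Sigma_iff using kx k K0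
    by (auto simp: g_def norm_mult infsum_cmult_right' abs_mult
        intro!: summable_on_cmult_right summable_on_cmult_left)
  have k_le: "cmod (k j) \<le> K" for j
    unfolding K_def using finite_sum_le_infsum[OF k, of "{j}"] by simp
  have kap: "cmod (\<Sum>\<^sub>\<infinity>j. g j n) \<le> K * K" for n
  proof -
    have s: "(\<lambda>j. K * cmod (k j)) summable_on UNIV"
      by (intro summable_on_cmult_right k)
    have le: "cmod (g j n) \<le> K * cmod (k j)" for j
      using mult_left_mono[OF k_le[of "j XOR n"], of "cmod (k j)"] by (simp add: g_def norm_mult mult.commute)
    have a: "(\<lambda>j. g j n) abs_summable_on UNIV"
      by (rule summable_on_comparison_test[OF s]) (use le in auto)
    have "cmod (\<Sum>\<^sub>\<infinity>j. g j n) \<le> (\<Sum>\<^sub>\<infinity>j. K * cmod (k j))"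
      using norm_infsum_bound[OF a] infsum_mono[OF a s] le by (meson UNIV_I order_trans)
    then show ?thesis
      by (simp add: infsum_cmult_right' K_def)
  qed
  have pl: "((\<lambda>l. p (l XOR j) * p ((l XOR j) XOR n)) has_sum p n) UNIV" for j n
    using conv_ops_has_sum[OF P(2), of "P (delta 0)" n] is_projD(2)[OF P(1)]
      has_sum_xor[of "\<lambda>l. p l * p (l XOR n)" j] by (simp add: p_def)
  have p_l2: "p \<in> l2"
    by (simp add: p_def)
  \<comment> \<open>The pairing is the sum of \<open>f\<close> over all indices. Summing over \<open>l\<close> last gives squares of norms.\<close>
  define f where "f x l = (case x of (j, n) \<Rightarrow> g j n * q n * (p (l XOR j) * p ((l XOR j) XOR n)))"
    for x :: "nat \<times> nat" and l
  have pp: "(\<lambda>l. p (l XOR j) * p ((l XOR j) XOR n)) abs_summable_on UNIV" 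
    "(\<Sum>\<^sub>\<infinity>l. cmod (p (l XOR j) * p ((l XOR j) XOR n))) \<le> (norm (P (delta 0)))\<^sup>2" for j n
  proof -
    have h0: "((\<lambda>l. (cmod (p l))\<^sup>2) has_sum (norm (P (delta 0)))\<^sup>2) UNIV"
      unfolding p_def by (rule has_sum_norm_sq)
    then have h1: "((\<lambda>l. (cmod (p (l XOR j)))\<^sup>2) has_sum (norm (P (delta 0)))\<^sup>2) UNIV"
      using has_sum_xor[of "\<lambda>l. (cmod (p l))\<^sup>2"] by simp
    have h2: "((\<lambda>l. (cmod (p ((l XOR j) XOR n)))\<^sup>2) has_sum (norm (P (delta 0)))\<^sup>2) UNIV"
      using h0 has_sum_xor[of "\<lambda>l. (cmod (p (l XOR n)))\<^sup>2"] has_sum_xor[of "\<lambda>l. (cmod (p l))\<^sup>2"] by simp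
    have h: "((\<lambda>l. 1 / 2 * ((cmod (p (l XOR j)))\<^sup>2 + (cmod (p ((l XOR j) XOR n)))\<^sup>2)) has_sum
        (norm (P (delta 0)))\<^sup>2) UNIV"
      using has_sum_cmult_right[OF has_sum_add[OF h1 h2], of "1 / 2"] by simp
    have le: "cmod (p (l XOR j) * p ((l XOR j) XOR n))
        \<le> 1 / 2 * ((cmod (p (l XOR j)))\<^sup>2 + (cmod (p ((l XOR j) XOR n)))\<^sup>2)" for l
      using sum_squares_bound[of "cmod (p (l XOR j))" "cmod (p ((l XOR j) XOR n))"]
      by (simp add: norm_mult)
    show a: "(\<lambda>l. p (l XOR j) * p ((l XOR j) XOR n)) abs_summable_on UNIV"
      by (rule summable_on_comparison_test[OF has_sum_imp_summable[OF h]]) (use le in auto)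
    show "(\<Sum>\<^sub>\<infinity>l. cmod (p (l XOR j) * p ((l XOR j) XOR n))) \<le> (norm (P (delta 0)))\<^sup>2"
      using infsum_mono[OF a has_sum_imp_summable[OF h]] le infsumI[OF h] by simp
  qed
  have q_le: "cmod (q n) \<le> norm (Q (delta 0))" for n
    unfolding q_def by (rule coef_le_norm)
  define C where "C = norm (Q (delta 0)) * (norm (P (delta 0)))\<^sup>2"
  have "(\<lambda>(x, l). f x l) abs_summable_on (UNIV \<times> UNIV) \<times> UNIV"
  proof (subst Infinite_Sum.abs_summable_on_Sigma_iff, intro conjI ballI)
    fix x :: "nat \<times> nat"
    show "(\<lambda>l. case (x, l) of (x, l) \<Rightarrow> f x l) abs_summable_on UNIV"
      using pp(1) by (cases x) (simp add: f_def norm_mult summable_on_cmult_right)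
  next
    show "(\<lambda>x. \<Sum>\<^sub>\<infinity>l. norm (case (x, l) of (x, l) \<Rightarrow> f x l)) abs_summable_on UNIV \<times> UNIV"
    proof (rule Infinite_Sum.abs_summable_on_comparison_test)
      show "(\<lambda>x. (case x of (j, n) \<Rightarrow> g j n) * complex_of_real C) abs_summable_on UNIV \<times> UNIV"
        unfolding norm_mult by (intro summable_on_cmult_left g)
      fix x :: "nat \<times> nat"
      obtain j n where x: "x = (j, n)"
        by (cases x)
      have "(\<Sum>\<^sub>\<infinity>l. cmod (f x l)) = cmod (g j n) * cmod (q n) * (\<Sum>\<^sub>\<infinity>l. cmod (p (l XOR j) * p ((l XOR j) XOR n)))"
        unfolding f_def x by (simp add: norm_mult infsum_cmult_right')
      also have "\<dots> \<le> cmod (g j n) * norm (Q (delta 0)) * (norm (P (delta 0)))\<^sup>2"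
        using pp(2) q_le by (intro mult_mono infsum_nonneg) auto
      finally show "norm (\<Sum>\<^sub>\<infinity>l. norm (case (x, l) of (x, l) \<Rightarrow> f x l))
          \<le> norm ((case x of (j, n) \<Rightarrow> g j n) * complex_of_real C)"
        by (simp add: x norm_mult norm_power C_def infsum_nonneg abs_mult mult.assoc)
    qed
  qed
  then have fsum: "(\<lambda>(x, l). f x l) summable_on (UNIV \<times> UNIV) \<times> UNIV"
    by (rule abs_summable_summable)
  have gq: "(\<lambda>(j, n). g j n * (p n * cnj (q n))) summable_on UNIV \<times> UNIV"
  proof (rule abs_summable_summable, rule Infinite_Sum.abs_summable_on_comparison_test)
    show "(\<lambda>x. (case x of (j, n) \<Rightarrow> g j n) * complex_of_real (norm (P (delta 0)) * norm (Q (delta 0))))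
        abs_summable_on UNIV \<times> UNIV"
      unfolding norm_mult by (intro summable_on_cmult_left g)
    fix x :: "nat \<times> nat"
    show "norm (case x of (j, n) \<Rightarrow> g j n * (p n * cnj (q n)))
       \<le> norm ((case x of (j, n) \<Rightarrow> g j n) * complex_of_real (norm (P (delta 0)) * norm (Q (delta 0))))"
      using q_le coef_le_norm[of "P (delta 0)"]
      by (auto simp: norm_mult abs_mult p_def split: prod.split intro!: mult_left_mono mult_mono)
  qed
  have inner: "(\<Sum>\<^sub>\<infinity>x\<in>UNIV \<times> UNIV. f x l) = cin (Q (Abs_ell2 (\<lambda>j. cnj (k j) * p (l XOR j))))
      (Abs_ell2 (\<lambda>j. cnj (k j) * p (l XOR j)))" for l
  proof -
    define w where "w = Abs_ell2 (\<lambda>j. cnj (k j) * p (l XOR j))"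
    have "(\<lambda>j. p (l XOR j)) \<in> l2"
      using p_l2 summable_on_xor[of "\<lambda>n. (cmod (p n))\<^sup>2" l] by (simp add: l2_def xor.commute[of l])
    then have "(\<lambda>j. cnj (k j) * p (l XOR j)) \<in> l2"
      by (rule l2_mult_bounded) (use k_le in simp)
    then have w: "coef w j = cnj (k j) * p (l XOR j)" for j
      by (simp add: w_def)
    have fl: "(\<lambda>(j, n). f (j, n) l) summable_on UNIV \<times> UNIV"
    proof -
      have "(\<lambda>x. f x l) summable_on UNIV \<times> UNIV"
        using summable_on_SigmaD1[of "\<lambda>l x. f x l" UNIV "\<lambda>_. UNIV \<times> UNIV" l]
          summable_on_swap[of "\<lambda>(x, l). f x l" "UNIV \<times> UNIV" UNIV] fsum
        by (simp add: case_prod_unfold)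
      then show ?thesis
        by (simp add: case_prod_unfold)
    qed
    have "(\<Sum>\<^sub>\<infinity>x\<in>UNIV \<times> UNIV. f x l) = (\<Sum>\<^sub>\<infinity>j. \<Sum>\<^sub>\<infinity>n. f (j, n) l)"
      using infsum_Sigma'_banach[OF fl] by (simp add: case_prod_unfold)
    also have "\<dots> = (\<Sum>\<^sub>\<infinity>j. cnj (coef w j) * coef (Q w) j)"
    proof (rule infsum_cong)
      fix j
      have "(\<Sum>\<^sub>\<infinity>n. f (j, n) l) = (\<Sum>\<^sub>\<infinity>n. k j * p (l XOR j) * (coef w (n XOR j) * q n))"
      proof (rule infsum_cong)
        fix n
        have "j XOR n = n XOR j" "(l XOR j) XOR n = l XOR (n XOR j)"
          by (auto simp: bit_eq_iff bit_xor_iff)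
        then show "f (j, n) l = k j * p (l XOR j) * (coef w (n XOR j) * q n)"
          by (simp only: f_def g_def w prod.case mult_ac)
      qed
      also have "\<dots> = k j * p (l XOR j) * (\<Sum>\<^sub>\<infinity>n. coef w (n XOR j) * q n)"
        by (rule infsum_cmult_right')
      also have "(\<Sum>\<^sub>\<infinity>n. coef w (n XOR j) * q n) = (\<Sum>\<^sub>\<infinity>n. coef w n * q (n XOR j))"
        using infsum_xor[of "\<lambda>n. coef w n * q (n XOR j)" j] by simp
      also have "\<dots> = coef (Q w) j"
        using conv_ops_has_sum[OF Q(2), of w j] by (simp add: q_def infsumI)
      also have "k j * p (l XOR j) = cnj (coef w j)"
        by (simp add: w p_real)
      finally show "(\<Sum>\<^sub>\<infinity>n. f (j, n) l) = cnj (coef w j) * coef (Q w) j" .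
    qed
    also have "\<dots> = cin (Q w) w"
      unfolding cin_def by (simp add: mult.commute)
    finally show ?thesis
      by (simp add: w_def)
  qed
  have "pairing (\<lambda>n. \<Sum>\<^sub>\<infinity>j. g j n) P Q = (\<Sum>\<^sub>\<infinity>n. (\<Sum>\<^sub>\<infinity>j. g j n) * (p n * cnj (q n)))"
    using pairing_has_sum[where t = "\<lambda>n. \<Sum>\<^sub>\<infinity>j. g j n", OF kap, of P Q] unfolding p_def q_def by (simp add: infsumI)
  also have "\<dots> = (\<Sum>\<^sub>\<infinity>n. \<Sum>\<^sub>\<infinity>j. g j n * (p n * cnj (q n)))"
    by (simp only: infsum_cmult_left')
  also have "\<dots> = (\<Sum>\<^sub>\<infinity>j. \<Sum>\<^sub>\<infinity>n. g j n * (p n * cnj (q n)))"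
    by (rule infsum_swap_banach[OF gq, symmetric])
  also have "\<dots> = (\<Sum>\<^sub>\<infinity>(j, n)\<in>UNIV \<times> UNIV. g j n * (p n * cnj (q n)))"
    by (rule infsum_Sigma'_banach[OF gq])
  also have "\<dots> = (\<Sum>\<^sub>\<infinity>x\<in>UNIV \<times> UNIV. \<Sum>\<^sub>\<infinity>l. f x l)"
    by (rule infsum_cong)
      (auto simp: f_def infsum_cmult_right' infsumI[OF pl] q_real mult_ac)
  also have "\<dots> = (\<Sum>\<^sub>\<infinity>l. \<Sum>\<^sub>\<infinity>x\<in>UNIV \<times> UNIV. f x l)"
    by (rule infsum_swap_banach[OF fsum])
  also have "nonneg_real \<dots>"
  proof (rule nonneg_real_infsum)
    fix l
    have "cin (Q w) w = cin (Q w) (Q w)" for w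
      by (metis is_projD(2,3)[OF Q(1)])
    then show "nonneg_real (\<Sum>\<^sub>\<infinity>x\<in>UNIV \<times> UNIV. f x l)"
      unfolding inner using nonneg_real_cin_self by simp
  qed
  finally show ?thesis
    by (simp add: g_def)
qed

section \<open>The density of a level and its derivative\<close>

lemma has_sum_finite_sum:
  fixes f :: "'i \<Rightarrow> 'x \<Rightarrow> 'a::topological_comm_monoid_add"
  assumes "finite I" "\<And>i. i \<in> I \<Longrightarrow> (f i has_sum s i) A"
  shows "((\<lambda>x. \<Sum>i\<in>I. f i x) has_sum (\<Sum>i\<in>I. s i)) A"
  using assms
proof (induction I)
  case (insert i I)
  then have "((\<lambda>x. f i x + (\<Sum>i\<in>I. f i x)) has_sum (s i + (\<Sum>i\<in>I. s i))) A"
    by (intro has_sum_add) auto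
  with insert show ?case
    by simp
qed simp

text \<open>Divided by \<open>m\<close>, the assumed double sum is a Fejer mean. It differs from the
  full sum by at most \<open>1 / m\<close> times the sum of
  \<open>\<bar>d\<bar> \<bar>g d\<bar>\<close>, because for each \<open>d\<close> at most
  \<open>\<bar>d\<bar>\<close> of the \<open>m\<close> rows miss the difference
  \<open>d\<close>.\<close>

lemma nonneg_real_fejer:
  fixes g :: "int \<Rightarrow> complex"
  assumes g: "g abs_summable_on UNIV" and dg: "(\<lambda>d. real_of_int \<bar>d\<bar> * cmod (g d)) summable_on UNIV"
    and pos: "\<And>m. nonneg_real (\<Sum>u<m. \<Sum>v<m. g (int u - int v))"
  shows "nonneg_real (\<Sum>\<^sub>\<infinity>d. g d)"
proof -
  define G where "G = (\<Sum>\<^sub>\<infinity>d. g d)"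
  define K where "K = (\<Sum>\<^sub>\<infinity>d. real_of_int \<bar>d\<bar> * cmod (g d))"
  define S where "S m = (\<Sum>u<m. \<Sum>v<m. g (int u - int v))" for m :: nat
  have est: "cmod (of_nat m * G - S m) \<le> K" for m
  proof -
    define D where "D u = (\<lambda>v. int u - int v) ` {..<m}" for u
    define h where "h u d = (if d \<in> D u then 0 else cmod (g d))" for u d
    have h: "(h u has_sum infsum (h u) UNIV) UNIV" for u
      by (intro has_sum_infsum summable_on_comparison_test[OF g]) (auto simp: h_def)
    have "cmod (G - (\<Sum>v<m. g (int u - int v))) \<le> infsum (h u) UNIV" for u
    proof -
      have gs: "g summable_on A" for A
        using summable_on_subset_banach[OF abs_summable_summable[OF g]] by auto
      have ga: "g abs_summable_on (- D u)"
        using summable_on_subset_banach[OF g] by auto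
      have "infsum g (D u \<union> - D u) = infsum g (D u) + infsum g (- D u)"
        by (intro infsum_Un_disjoint gs) auto
      moreover have "infsum g (D u) = (\<Sum>v<m. g (int u - int v))"
        unfolding D_def by (simp add: sum.reindex inj_on_def)
      ultimately have "G - (\<Sum>v<m. g (int u - int v)) = infsum g (- D u)"
        by (simp add: G_def)
      also have "cmod \<dots> \<le> infsum (\<lambda>d. cmod (g d)) (- D u)"
        by (rule norm_infsum_bound[OF ga])
      also have "\<dots> = infsum (h u) UNIV"
        by (rule infsum_cong_neutral) (auto simp: h_def)
      finally show ?thesis .
    qed
    then have "(\<Sum>u<m. cmod (G - (\<Sum>v<m. g (int u - int v)))) \<le> (\<Sum>u<m. infsum (h u) UNIV)"
      by (intro sum_mono)
    moreover have "of_nat m * G - S m = (\<Sum>u<m. G - (\<Sum>v<m. g (int u - int v)))"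
      by (simp add: S_def sum_subtractf)
    ultimately have "cmod (of_nat m * G - S m) \<le> (\<Sum>u<m. infsum (h u) UNIV)"
      using norm_sum order_trans by fastforce
    also have "(\<Sum>u<m. infsum (h u) UNIV) \<le> K"
    proof (rule has_sum_mono)
      show "((\<lambda>d. \<Sum>u<m. h u d) has_sum (\<Sum>u<m. infsum (h u) UNIV)) UNIV"
        by (intro has_sum_finite_sum h) auto
      show "((\<lambda>d. real_of_int \<bar>d\<bar> * cmod (g d)) has_sum K) UNIV"
        unfolding K_def by (rule has_sum_infsum[OF dg])
      fix d :: int
      have "(\<Sum>u<m. h u d) = (\<Sum>u\<in>{u. u < m \<and> d \<notin> D u}. cmod (g d))"
        by (rule sum.mono_neutral_cong_right) (auto simp: h_def)
      also have "\<dots> = real (card {u. u < m \<and> d \<notin> D u}) * cmod (g d)"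
        by simp
      also have "\<dots> \<le> real_of_int \<bar>d\<bar> * cmod (g d)"
      proof (rule mult_right_mono)
        have "{u. u < m \<and> d \<notin> D u} \<subseteq> (if d \<ge> 0 then {..<nat d} else {m - nat (- d)..<m})"
        proof
          fix u assume "u \<in> {u. u < m \<and> d \<notin> D u}"
          then have u: "u < m" "d \<notin> D u"
            by auto
          have "\<not> (0 \<le> int u - d \<and> int u - d < int m)"
          proof
            assume "0 \<le> int u - d \<and> int u - d < int m"
            then have "d = int u - int (nat (int u - d))" "nat (int u - d) < m"
              by auto
            then show False
              using u(2) unfolding D_def by blast
          qed
          then show "u \<in> (if d \<ge> 0 then {..<nat d} else {m - nat (- d)..<m})"
            using u(1) by auto
        qed
        then have "card {u. u < m \<and> d \<notin> D u} \<le> card (if d \<ge> 0 then {..<nat d} else {m - nat (- d)..<m})"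
          by (intro card_mono) auto
        also have "\<dots> \<le> nat \<bar>d\<bar>"
          by auto
        finally show "real (card {u. u < m \<and> d \<notin> D u}) \<le> real_of_int \<bar>d\<bar>"
          by linarith
      qed simp
      finally show "(\<Sum>u<m. h u d) \<le> real_of_int \<bar>d\<bar> * cmod (g d)" .
    qed
    finally show ?thesis .
  qed
  have "(\<lambda>m. complex_of_real (inverse (real (Suc m))) * S (Suc m) - G) \<longlonglongrightarrow> 0"
  proof (rule Lim_null_comparison)
    have "cmod (complex_of_real (inverse (real (Suc m))) * S (Suc m) - G) \<le> inverse (real (Suc m)) * K" for m
    proof -
      have "complex_of_real (inverse (real (Suc m))) * S (Suc m) - G
          = - (complex_of_real (inverse (real (Suc m))) * (of_nat (Suc m) * G - S (Suc m)))"
        by (simp add: field_simps del: of_nat_Suc)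
      then have "cmod (complex_of_real (inverse (real (Suc m))) * S (Suc m) - G)
          = inverse (real (Suc m)) * cmod (of_nat (Suc m) * G - S (Suc m))"
        by (simp only: norm_minus_cancel norm_mult norm_of_real) simp
      also have "\<dots> \<le> inverse (real (Suc m)) * K"
        by (intro mult_left_mono est) simp
      finally show ?thesis .
    qed
    then show "\<forall>\<^sub>F m in sequentially. cmod (complex_of_real (inverse (real (Suc m))) * S (Suc m) - G)
        \<le> inverse (real (Suc m)) * K"
      by simp
    show "(\<lambda>m. inverse (real (Suc m)) * K) \<longlonglongrightarrow> 0"
      using tendsto_mult_right[OF LIMSEQ_inverse_real_of_nat, of K] by simp
  qed
  then have lim: "(\<lambda>m. complex_of_real (inverse (real (Suc m))) * S (Suc m)) \<longlonglongrightarrow> G"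
    by (rule iffD2[OF Lim_null])
  have "nonneg_real (complex_of_real (inverse (real (Suc m))) * S (Suc m))" for m
    using pos[of "Suc m"] unfolding S_def[symmetric] by (simp add: nonneg_real_def)
  from nonneg_real_LIMSEQ[where f = "\<lambda>m. complex_of_real (inverse (real (Suc m))) * S (Suc m)", OF this lim]
  show ?thesis
    unfolding G_def .
qed

lemma cis_taylor2: "cmod (cis x - 1 - \<i> * complex_of_real x) \<le> x\<^sup>2"
  using Taylor_exp[of "\<i> * complex_of_real x" 1]
  by (simp add: cis_conv_exp norm_mult power2_eq_square algebra_simps abs_mult_self_eq)

text \<open>The function of \<open>c\<close> in the second assumption is nonnegative and vanishes at
  \<open>0\<close>, so it has a minimum there. The conclusion says that its derivative at
  \<open>0\<close> is \<open>0\<close>. The second order Taylor remainder is at most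
  \<open>c\<^sup>2 K\<close>.\<close>

lemma derivative_0_at_minimum:
  fixes g :: "int \<Rightarrow> complex"
  assumes g: "(\<lambda>u. (1 + (real_of_int u)\<^sup>2) * cmod (g u)) summable_on UNIV"
    and pos: "\<And>c. nonneg_real (\<Sum>\<^sub>\<infinity>u. cis (- (of_int u * c)) * g u)"
    and zero: "(\<Sum>\<^sub>\<infinity>u. g u) = 0"
  shows "(\<Sum>\<^sub>\<infinity>u. of_int u * g u) = 0"
proof -
  define D where "D = (\<Sum>\<^sub>\<infinity>u. of_int u * g u)"
  define F where "F c = (\<Sum>\<^sub>\<infinity>u. cis (- (of_int u * c)) * g u)" for c
  define K where "K = (\<Sum>\<^sub>\<infinity>u. (1 + (real_of_int u)\<^sup>2) * cmod (g u))"
  have dom: "f summable_on UNIV" if "\<And>u. cmod (f u) \<le> (1 + (real_of_int u)\<^sup>2) * cmod (g u)" for f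
    by (rule abs_summable_summable, rule summable_on_comparison_test[OF g]) (use that in auto)
  have one: "cmod (g u) \<le> (1 + (real_of_int u)\<^sup>2) * cmod (g u)" for u
    using mult_right_mono[of 1 "1 + (real_of_int u)\<^sup>2" "cmod (g u)"] by simp
  have abs: "\<bar>real_of_int u\<bar> \<le> 1 + (real_of_int u)\<^sup>2" for u
    using sum_squares_bound[of 1 "\<bar>real_of_int u\<bar>"] by simp
  have s: "g summable_on UNIV" "(\<lambda>u. of_int u * g u) summable_on UNIV"
    by (rule dom, use one mult_right_mono[OF abs norm_ge_zero] in \<open>simp add: norm_mult\<close>)+
  have sc: "(\<lambda>u. cis (- (of_int u * c)) * g u) summable_on UNIV" for c
    using one by (intro dom) (simp add: norm_mult)
  have "cmod (F c + \<i> * complex_of_real c * D) \<le> c\<^sup>2 * K" for c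
  proof -
    have "((\<lambda>u. cis (- (of_int u * c)) * g u + (- 1) * g u + \<i> * complex_of_real c * (of_int u * g u))
        has_sum (F c + (- 1) * (\<Sum>\<^sub>\<infinity>u. g u) + \<i> * complex_of_real c * D)) UNIV"
      unfolding F_def D_def
      by (intro has_sum_add has_sum_cmult_right has_sum_infsum s sc)
    then have h: "((\<lambda>u. cis (- (of_int u * c)) * g u - g u + \<i> * complex_of_real c * (of_int u * g u))
        has_sum (F c + \<i> * complex_of_real c * D)) UNIV"
      by (simp add: zero)
    have k: "((\<lambda>u. c\<^sup>2 * ((1 + (real_of_int u)\<^sup>2) * cmod (g u))) has_sum c\<^sup>2 * K) UNIV"
      unfolding K_def by (intro has_sum_cmult_right has_sum_infsum g)
    have "cmod (cis (- (of_int u * c)) * g u - g u + \<i> * complex_of_real c * (of_int u * g u))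
        \<le> c\<^sup>2 * ((1 + (real_of_int u)\<^sup>2) * cmod (g u))" for u
    proof -
      have "cis (- (of_int u * c)) * g u - g u + \<i> * complex_of_real c * (of_int u * g u)
          = (cis (- (of_int u * c)) - 1 - \<i> * complex_of_real (- (of_int u * c))) * g u"
        by (simp add: algebra_simps)
      then have "cmod (cis (- (of_int u * c)) * g u - g u + \<i> * complex_of_real c * (of_int u * g u))
          \<le> (- (of_int u * c))\<^sup>2 * cmod (g u)"
        by (simp only: norm_mult) (intro mult_right_mono cis_taylor2 norm_ge_zero)
      also have "\<dots> = c\<^sup>2 * ((real_of_int u)\<^sup>2 * cmod (g u))"
        by (simp add: power_mult_distrib)
      also have "\<dots> \<le> c\<^sup>2 * ((1 + (real_of_int u)\<^sup>2) * cmod (g u))"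
        by (intro mult_left_mono mult_right_mono) auto
      finally show ?thesis .
    qed
    from norm_infsum_le[OF h k this] show ?thesis
      by simp
  qed
  then have est: "\<bar>Re (F c) - c * Im D\<bar> \<le> c\<^sup>2 * K" "\<bar>Im (F c) + c * Re D\<bar> \<le> c\<^sup>2 * K" for c
    using abs_Re_le_cmod[of "F c + \<i> * complex_of_real c * D"]
      abs_Im_le_cmod[of "F c + \<i> * complex_of_real c * D"] 
    by (simp_all add: mult.assoc) (meson order_trans)+
  have F: "Im (F c) = 0" "0 \<le> Re (F c)" for c
    using pos[of c] by (auto simp: nonneg_real_def F_def)
  have lim: "((\<lambda>c. c * K) \<longlongrightarrow> 0) (at_right 0)"
    by (auto intro!: tendsto_eq_intros)
  have "\<bar>Re D\<bar> \<le> 0"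
  proof (rule tendsto_lowerbound[OF lim])
    have "\<bar>Re D\<bar> \<le> c * K" if "c > 0" for c
      using est(2)[of c] F(1)[of c] that by (simp add: abs_mult power2_eq_square)
    then show "\<forall>\<^sub>F c in at_right 0. \<bar>Re D\<bar> \<le> c * K"
      by (simp add: eventually_at_right_less eventually_mono[OF eventually_at_right_less])
  qed simp
  moreover have "\<bar>Im D\<bar> \<le> 0"
  proof (rule tendsto_lowerbound[OF lim])
    have "\<bar>Im D\<bar> \<le> c * K" if c: "c > 0" for c
    proof -
      have "c * (- Im D) \<le> c * (c * K)" "c * Im D \<le> c * (c * K)"
        using est(1)[of c] est(1)[of "- c"] F(2)[of c] F(2)[of "- c"]
        by (auto simp: power2_eq_square mult.assoc)
      then have "- Im D \<le> c * K" "Im D \<le> c * K"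
        using c mult_le_cancel_left_pos by blast+
      then show ?thesis
        by simp
    qed
    then show "\<forall>\<^sub>F c in at_right 0. \<bar>Im D\<bar> \<le> c * K"
      by (simp add: eventually_mono[OF eventually_at_right_less])
  qed simp
  ultimately show ?thesis
    by (simp add: D_def[symmetric] complex_eq_iff)
qed

context phase
begin

lemma b_nonneg: "0 \<le> b u"
  using norm_ge_zero e_bound[of u 0] by (rule order_trans)

lemma b_sum: "b summable_on UNIV" "(\<lambda>u. \<bar>real_of_int u\<bar> * b u) summable_on UNIV"
proof -
  have "b u \<le> (1 + (real_of_int u)\<^sup>2) * b u" "\<bar>real_of_int u\<bar> * b u \<le> (1 + (real_of_int u)\<^sup>2) * b u" for u
    using mult_right_mono[of 1 "1 + (real_of_int u)\<^sup>2" "b u"] b_nonneg[of u]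
      mult_right_mono[of "\<bar>real_of_int u\<bar>" "1 + (real_of_int u)\<^sup>2" "b u"]
      sum_squares_bound[of 1 "\<bar>real_of_int u\<bar>"] by auto
  then show "b summable_on UNIV" "(\<lambda>u. \<bar>real_of_int u\<bar> * b u) summable_on UNIV"
    using b_nonneg by (auto intro!: summable_on_comparison_test[OF b_summable])
qed

text \<open>By Poisson summation, the Fourier coefficients of the measure
  \<open>\<nu>\<^sub>0\<close> on the level set \<open>h = 0\<close> modulo
  \<open>2 \<pi>\<close>.\<close>

definition level_symbol :: "nat \<Rightarrow> complex" where
  "level_symbol n = (\<Sum>\<^sub>\<infinity>u. e u n)"

text \<open>With factors \<open>exp (- i u c)\<close> in the sum that defines
  \<open>level_symbol\<close> one gets the level \<open>c\<close>. So this is \<open>i\<close> times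
  the derivative in \<open>c\<close> at \<open>0\<close>.\<close>

definition level_deriv :: "nat \<Rightarrow> complex" where
  "level_deriv n = (\<Sum>\<^sub>\<infinity>u. of_int u * e u n)"

lemma de_bound: "cmod (of_int u * e u n) \<le> \<bar>real_of_int u\<bar> * b u"
  using e_bound[of u n] by (simp add: norm_mult mult_left_mono)

lemma level_symbol_abs: "(\<lambda>u. e u n) abs_summable_on UNIV"
  by (rule summable_on_comparison_test[OF b_sum(1)]) (use e_bound in auto)

lemma level_deriv_abs: "(\<lambda>u. of_int u * e u n) abs_summable_on UNIV"
  by (rule summable_on_comparison_test[OF b_sum(2)]) (use de_bound in auto)

lemma level_symbol_bound: "cmod (level_symbol n) \<le> infsum b UNIV"
  unfolding level_symbol_def
  by (rule norm_infsum_le[OF has_sum_infsum has_sum_infsum[OF b_sum(1)] e_bound])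
    (rule abs_summable_summable[OF level_symbol_abs])

lemma level_deriv_bound: "cmod (level_deriv n) \<le> (\<Sum>\<^sub>\<infinity>u. \<bar>real_of_int u\<bar> * b u)"
  unfolding level_deriv_def
  by (rule norm_infsum_le[OF has_sum_infsum has_sum_infsum[OF b_sum(2)] de_bound])
    (rule abs_summable_summable[OF level_deriv_abs])

lemma e_bound_unif: "cmod (e u n) \<le> infsum b UNIV"
  using e_bound[of u n] finite_sum_le_infsum[OF b_sum(1), of "{u}"] b_nonneg by fastforce

text \<open>The double sum is the pairing with the autocorrelation of the trigonometric polynomial
  in \<open>V\<close> with coefficients \<open>exp (- i u c)\<close>, \<open>u < m\<close>.\<close>

lemma pairing_toeplitz:
  assumes "conv_proj P" "conv_proj Q"
  shows "nonneg_real (\<Sum>u<m. \<Sum>v<m. cis (- (real_of_int (int u - int v) * c)) * pairing (e (int u - int v)) P Q)"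
proof -
  define z where "z u = cis (- (real u * c))" for u
  define k where "k n = (\<Sum>u<m. z u * e (int u) n)" for n
  have z: "cmod (z u) = 1" "z u * cnj (z v) = cis (- (real_of_int (int u - int v) * c))" for u v
    by (auto simp: z_def cis_mult cis_cnj algebra_simps)
  have "(\<lambda>n. \<Sum>u<m. cmod (e (int u) n)) summable_on UNIV"
    using has_sum_finite_sum[of "{..<m}" "\<lambda>u n. cmod (e (int u) n)", OF _ has_sum_infsum[OF e_l1]]
      has_sum_imp_summable by blast
  then have k: "k abs_summable_on UNIV"
    by (rule summable_on_comparison_test)
      (auto simp: k_def z norm_mult intro!: order_trans[OF norm_sum])
  have "((\<lambda>j. k j * cnj (k (j XOR n))) has_sum
      (\<Sum>u<m. \<Sum>v<m. z u * cnj (z v) * e (int u - int v) n)) UNIV" for n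
  proof -
    have "((\<lambda>j. \<Sum>u<m. \<Sum>v<m. z u * cnj (z v) * (e (int u) j * e (- int v) (j XOR n))) has_sum
      (\<Sum>u<m. \<Sum>v<m. z u * cnj (z v) * e (int u - int v) n)) UNIV"
      using e_conv[of "int _" "- int _" n]
      by (intro has_sum_finite_sum has_sum_cmult_right) auto
    moreover have "k j * cnj (k (j XOR n)) = (\<Sum>u<m. \<Sum>v<m. z u * cnj (z v) * (e (int u) j * e (- int v) (j XOR n)))" for j
      by (simp add: k_def e_cnj sum_product mult_ac)
    ultimately show ?thesis
      by simp
  qed
  then have eq: "(\<lambda>n. \<Sum>\<^sub>\<infinity>j. k j * cnj (k (j XOR n)))
      = (\<lambda>n. \<Sum>u<m. \<Sum>v<m. z u * cnj (z v) * e (int u - int v) n)"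
    by (intro ext infsumI)
  have b1: "cmod (z u * cnj (z v) * e (int u - int v) n) \<le> infsum b UNIV" for u v n
    using e_bound_unif by (simp add: norm_mult z)
  have b2: "cmod (\<Sum>v<m. z u * cnj (z v) * e (int u - int v) n) \<le> of_nat (card {..<m}) * infsum b UNIV" for u n
    by (intro sum_norm_bound b1)
  have "pairing (\<lambda>n. \<Sum>u<m. \<Sum>v<m. z u * cnj (z v) * e (int u - int v) n) P Q
     = (\<Sum>u<m. pairing (\<lambda>n. \<Sum>v<m. z u * cnj (z v) * e (int u - int v) n) P Q)"
    by (rule pairing_sum[OF finite_lessThan b2])
  also have "\<dots> = (\<Sum>u<m. \<Sum>v<m. pairing (\<lambda>n. z u * cnj (z v) * e (int u - int v) n) P Q)"
    by (intro sum.cong refl pairing_sum[OF finite_lessThan b1])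
  also have "\<dots> = (\<Sum>u<m. \<Sum>v<m. z u * cnj (z v) * pairing (e (int u - int v)) P Q)"
    by (intro sum.cong refl pairing_cmult[OF e_bound])
  finally show ?thesis
    using pairing_autocorrelation[OF k assms] unfolding eq z(2)[symmetric] by simp
qed

lemma
  assumes PQ: "conv_proj P" "conv_proj Q"
  shows nonneg_real_pairing_level_symbol: "nonneg_real (pairing level_symbol P Q)"
    and pairing_level_deriv_eq_0: "pairing level_symbol P Q = 0 \<Longrightarrow> pairing level_deriv P Q = 0"
proof -
  define g where "g u = pairing (e u) P Q" for u
  have gb: "cmod (g u) \<le> b u" for u
    unfolding g_def by (rule pairing_bound[OF e_bound PQ])
  have gsum: "(\<lambda>u. (1 + (real_of_int u)\<^sup>2) * cmod (g u)) summable_on UNIV"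
    by (rule summable_on_comparison_test[OF b_summable]) (auto intro: mult_left_mono gb)
  have level_symbol: "pairing level_symbol P Q = (\<Sum>\<^sub>\<infinity>u. g u)"
    unfolding level_symbol_def g_def by (rule pairing_infsum[OF e_bound b_sum(1)])
  have level_deriv: "pairing level_deriv P Q = (\<Sum>\<^sub>\<infinity>u. of_int u * g u)"
    unfolding level_deriv_def g_def pairing_infsum[OF de_bound b_sum(2)]
    by (intro infsum_cong pairing_cmult[OF e_bound])
  have pos: "nonneg_real (\<Sum>\<^sub>\<infinity>u. cis (- (of_int u * c)) * g u)" for c
  proof (rule nonneg_real_fejer)
    show "(\<lambda>u. cis (- (of_int u * c)) * g u) abs_summable_on UNIV"
      by (rule summable_on_comparison_test[OF b_sum(1)]) (use gb in \<open>auto simp: norm_mult\<close>)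
    show "(\<lambda>d. real_of_int \<bar>d\<bar> * cmod (cis (- (of_int d * c)) * g d)) summable_on UNIV"
      by (rule summable_on_comparison_test[OF b_sum(2)])
        (use gb in \<open>auto simp: norm_mult intro!: mult_left_mono\<close>)
    show "nonneg_real (\<Sum>u<m. \<Sum>v<m. cis (- (of_int (int u - int v) * c)) * g (int u - int v))" for m
      unfolding g_def by (rule pairing_toeplitz[OF PQ])
  qed
  from pos[of 0] show "nonneg_real (pairing level_symbol P Q)"
    by (simp add: level_symbol)
  show "pairing level_deriv P Q = 0" if "pairing level_symbol P Q = 0"
    unfolding level_deriv by (rule derivative_0_at_minimum[OF gsum pos]) (use that level_symbol in simp)
qed

end

section \<open>The reflexive hull and its grading\<close>

declare One_nat_def [simp del]

text \<open>Translations of the Cantor group by a point appear as \<open>diag t\<close> with a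
  character \<open>t\<close>.\<close>

definition is_char :: "(nat \<Rightarrow> complex) \<Rightarrow> bool" where
  "is_char t \<longleftrightarrow> (\<forall>m n. t (m XOR n) = t m * t n) \<and> (\<forall>n. t n = 1 \<or> t n = - 1)"

definition chi :: "nat \<Rightarrow> nat \<Rightarrow> complex" where
  "chi j n = (if bit n j then - 1 else 1)"

lemma is_char_chi: "is_char (chi j)"
  by (auto simp: is_char_def chi_def bit_xor_iff)

lemma is_char_mult: "is_char s \<Longrightarrow> is_char t \<Longrightarrow> is_char (\<lambda>n. s n * t n)"
proof -
  assume a: "is_char s" "is_char t"
  have "s n * t n = 1 \<or> s n * t n = - 1" for n
  proof -
    have "s n = 1 \<or> s n = - 1" "t n = 1 \<or> t n = - 1"
      using a by (simp_all add: is_char_def)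
    then show ?thesis
      by auto
  qed
  moreover have "s (m XOR n) * t (m XOR n) = s m * t m * (s n * t n)" for m n
    using a by (simp add: is_char_def)
  ultimately show ?thesis
    by (simp add: is_char_def)
qed

context
  fixes t assumes t: "is_char t"
begin

lemma char_xor: "t (m XOR n) = t m * t n"
  using t by (simp add: is_char_def)

lemma char_cases: "t n = 1 \<or> t n = - 1"
  using t by (simp add: is_char_def)

lemma char_square: "t n * t n = 1"
  using char_cases[of n] by auto

lemma char_0: "t 0 = 1"
  using char_xor[of 0 0] char_square[of 0] by simp

lemma char_cnj: "cnj (t n) = t n"
  using char_cases[of n] by auto

lemma char_bound: "cmod (t n) \<le> 1"
  using char_cases[of n] by auto

lemma coef_char: "coef (diag t x) n = t n * coef x n"
  by (rule coef_diag[OF char_bound])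

lemma bclinear_char: "bclinear (diag t)"
  by (rule bclinear_diag[OF char_bound])

lemma char_char [simp]: "diag t (diag t x) = x"
  by (rule ell2_eqI) (simp add: coef_char char_square flip: mult.assoc)

lemma char_shift: "diag t (shift k x) = t k *\<^sub>C shift k (diag t x)"
  by (rule ell2_eqI) (simp add: coef_char char_xor char_square mult_ac flip: mult.assoc)

lemma cin_char: "cin (diag t x) y = cin x (diag t y)"
  by (simp add: cin_def coef_char char_cnj mult_ac)

lemma char_delta_0: "diag t (delta 0) = delta 0"
  by (rule ell2_eqI) (simp add: coef_char char_0)

lemma char_half: "diag t (half a k x) = half (a \<noteq> (t k = - 1)) k (diag t x)"
proof -
  have "t k = 1 \<or> t k = - 1"
    using t by (simp add: is_char_def)
  then show ?thesis
    by (auto simp: half_def bclinear_simps[OF bclinear_char] char_shift cscale_minus_left)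
qed

lemma conv_proj_char:
  assumes "conv_proj P"
  shows "conv_proj (\<lambda>x. diag t (P (diag t x)))"
proof -
  have P: "is_proj P" "P \<in> conv_ops"
    using assms by (auto simp: conv_proj_def)
  have "diag t (P (diag t (shift k x))) = shift k (diag t (P (diag t x)))" for k x
    by (simp add: char_shift bclinear_simps[OF bclinear_char] bclinear_simps[OF conv_ops_bclinear[OF P(2)]] conv_ops_shift[OF P(2)] char_square)
  then show ?thesis
    using is_projD[OF P(1)] bclinear_comp[OF bclinear_char bclinear_comp[OF is_projD(1)[OF P(1)] bclinear_char]]
    by (simp add: conv_proj_def is_proj_def conv_ops_def cin_char)
qed

text \<open>Translating the set of \<open>P\<close> turns the pairing into the measure of the
  intersection of two sets.\<close>

lemma nonneg_real_pairing_char: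
  assumes "conv_proj P" "conv_proj Q"
  shows "nonneg_real (pairing t P Q)"
proof -
  define R where "R x = Q (diag t (P (diag t x)))" for x
  have R: "is_proj R"
    using conv_proj_comp[OF assms(2) conv_proj_char[OF assms(1)]] unfolding R_def conv_proj_def by blast
  have Q: "is_proj Q"
    using assms by (simp add: conv_proj_def)
  have "pairing t P Q = cin (R (delta 0)) (delta 0)"
    unfolding pairing_def R_def char_delta_0 by (rule is_projD(3)[OF Q, symmetric])
  also have "\<dots> = cin (R (delta 0)) (R (delta 0))"
    by (metis is_projD(2,3)[OF R])
  finally show ?thesis
    by (simp add: nonneg_real_cin_self)
qed

end

lemma pairing_eq_0_of_comp_0:
  assumes "is_proj Q" "\<And>x. Q (diag t (P x)) = 0"
  shows "pairing t P Q = 0"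
  using is_projD(3)[OF assms(1), of "diag t (P (delta 0))" "delta 0"] assms(2) by (simp add: pairing_def)

text \<open>Only projections of the masa \<open>conv_ops\<close> are tested. This gives the
  reflexive hull of the bimodule generated by \<open>S\<close>.\<close>

definition reflexive_hull :: "(ell2 \<Rightarrow> ell2) \<Rightarrow> (ell2 \<Rightarrow> ell2) set" where
  "reflexive_hull S = {T. bclinear T \<and> (\<forall>P Q. conv_proj P \<and> conv_proj Q \<and> (\<forall>x. Q (S (P x)) = 0)
      \<longrightarrow> (\<forall>x. Q (T (P x)) = 0))}"

lemma reflexive_hullD:
  "T \<in> reflexive_hull S \<Longrightarrow> conv_proj P \<Longrightarrow> conv_proj Q \<Longrightarrow> (\<And>x. Q (S (P x)) = 0) \<Longrightarrow> Q (T (P x)) = 0"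
  by (auto simp: reflexive_hull_def)

lemma reflexive_hullI:
  assumes "bclinear T" "\<And>P Q x. conv_proj P \<Longrightarrow> conv_proj Q \<Longrightarrow> (\<And>x. Q (S (P x)) = 0) \<Longrightarrow> Q (T (P x)) = 0"
  shows "T \<in> reflexive_hull S"
  using assms by (auto simp: reflexive_hull_def)

lemma reflexive_hull_bclinear: "T \<in> reflexive_hull S \<Longrightarrow> bclinear T"
  by (simp add: reflexive_hull_def)

lemma reflexive_hull_self: "bclinear S \<Longrightarrow> S \<in> reflexive_hull S"
  by (rule reflexive_hullI)

lemma reflexive_hull_0: "(\<lambda>x. 0) \<in> reflexive_hull S"
  by (rule reflexive_hullI) (simp_all add: bclinear_0 bclinear_simps[OF conv_proj_bclinear])

lemma reflexive_hull_add:
  assumes "T \<in> reflexive_hull S" "T' \<in> reflexive_hull S"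
  shows "(\<lambda>x. T x + T' x) \<in> reflexive_hull S"
proof (rule reflexive_hullI)
  show "bclinear (\<lambda>x. T x + T' x)"
    by (intro bclinear_add reflexive_hull_bclinear[OF assms(1)] reflexive_hull_bclinear[OF assms(2)])
  show "Q (T (P x) + T' (P x)) = 0" if PQ: "conv_proj P" "conv_proj Q" "\<And>x. Q (S (P x)) = 0" for P Q x
    using reflexive_hullD[OF assms(1) PQ] reflexive_hullD[OF assms(2) PQ]
    by (simp add: bclinear_simps[OF conv_proj_bclinear[OF PQ(2)]])
qed

lemma reflexive_hull_cscale:
  assumes "T \<in> reflexive_hull S"
  shows "(\<lambda>x. c *\<^sub>C T x) \<in> reflexive_hull S"
proof (rule reflexive_hullI)
  show "bclinear (\<lambda>x. c *\<^sub>C T x)"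
    by (intro bclinear_cscale reflexive_hull_bclinear[OF assms])
  show "Q (c *\<^sub>C T (P x)) = 0" if PQ: "conv_proj P" "conv_proj Q" "\<And>x. Q (S (P x)) = 0" for P Q x
    using reflexive_hullD[OF assms PQ] by (simp add: bclinear_simps[OF conv_proj_bclinear[OF PQ(2)]])
qed

lemma reflexive_hull_bimodule:
  assumes T: "T \<in> reflexive_hull S" and A: "A \<in> conv_ops" and B: "B \<in> conv_ops"
  shows "(\<lambda>x. B (T (A x))) \<in> reflexive_hull S"
  unfolding reflexive_hull_def
proof (intro CollectI conjI allI impI)
  show "bclinear (\<lambda>x. B (T (A x)))"
    using bclinear_comp[OF conv_ops_bclinear[OF B] bclinear_comp[OF reflexive_hull_bclinear[OF T] conv_ops_bclinear[OF A]]] .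
  fix P Q x assume PQ: "conv_proj P \<and> conv_proj Q \<and> (\<forall>x. Q (S (P x)) = 0)"
  then have D: "P \<in> conv_ops" "Q \<in> conv_ops"
    by (auto simp: conv_proj_def)
  have "Q (B (T (A (P x)))) = B (Q (T (P (A x))))"
    by (simp add: conv_ops_commute[OF D(2) B] conv_ops_commute[OF A D(1)])
  also have "Q (T (P (A x))) = 0"
    using reflexive_hullD[OF T] PQ by blast
  finally show "Q (B (T (A (P x)))) = 0"
    by (simp add: bclinear_simps[OF conv_ops_bclinear[OF B]])
qed

text \<open>Cutting \<open>P\<close> and \<open>Q\<close> down by halves preserves the vanishing of
  the pairing with \<open>s\<close>, hence of the one with \<open>t\<close>. The vectors
  \<open>half a k (delta 0)\<close> span the space, as \<open>delta k\<close> is a difference of two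
  of them, so these pairings determine the operator.\<close>

lemma diag_in_reflexive_hull:
  assumes s: "\<And>n. cmod (s n) \<le> C" and t: "\<And>n. cmod (t n) \<le> D"
    and kernel_symbol: "\<And>P Q. conv_proj P \<Longrightarrow> conv_proj Q \<Longrightarrow> pairing s P Q = 0 \<Longrightarrow> pairing t P Q = 0"
  shows "diag t \<in> reflexive_hull (diag s)"
  unfolding reflexive_hull_def
proof (intro CollectI conjI allI impI)
  have cs: "bclinear (diag s)" and ct: "bclinear (diag t)"
    by (rule bclinear_diag[OF s], rule bclinear_diag[OF t])
  show "bclinear (diag t)"
    by (rule ct)
  fix P Q x assume PQ: "conv_proj P \<and> conv_proj Q \<and> (\<forall>x. Q (diag s (P x)) = 0)"
  then have P: "is_proj P" "P \<in> conv_ops" and Q: "is_proj Q" "Q \<in> conv_ops"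
    by (auto simp: conv_proj_def)
  have z: "cin (diag t (P (half a k (delta 0)))) (Q (half c l (delta 0))) = 0" for a k c l
  proof -
    have PH: "conv_proj (\<lambda>x. P (half a k x))" and QH: "conv_proj (\<lambda>x. Q (half c l x))"
      using PQ by (auto intro: conv_proj_comp conv_proj_half)
    have h: "half c l \<in> conv_ops"
      using conv_proj_half by (simp add: conv_proj_def)
    have "Q (half c l (diag s (P (half a k x)))) = 0" for x
      using PQ by (simp add: conv_ops_commute[OF Q(2) h] bclinear_simps[OF conv_ops_bclinear[OF h]])
    then have "pairing s (\<lambda>x. P (half a k x)) (\<lambda>x. Q (half c l x)) = 0"
      using QH by (intro pairing_eq_0_of_comp_0) (auto simp: conv_proj_def)
    from kernel_symbol[OF PH QH this] show ?thesis
      by (simp add: pairing_def)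
  qed
  have "Q (diag t (P (delta k))) = 0" for k
  proof (rule ell2_eqI)
    fix l
    have d: "delta i = half False i (delta 0) - half True i (delta 0)" for i
      by (simp add: half_diff shift_delta)
    have "coef (Q (diag t (P (delta k)))) l = cin (diag t (P (delta k))) (Q (delta l))"
      using is_projD(3)[OF Q(1), of _ "delta l"] by simp
    also have "\<dots> = 0"
      by (subst d[of k], subst d[of l])
        (simp add: bclinear_simps[OF ct] bclinear_simps[OF conv_ops_bclinear[OF P(2)]] bclinear_simps[OF conv_ops_bclinear[OF Q(2)]]
          cin_diff_left cin_diff_right z)
    finally show "coef (Q (diag t (P (delta k)))) l = coef 0 l"
      by simp
  qed
  then have "(\<lambda>x. Q (diag t (P x))) = (\<lambda>x. 0)"
    by (intro bclinear_eqI bclinear_0 bclinear_comp[OF is_projD(1)[OF Q(1)] bclinear_comp[OF ct is_projD(1)[OF P(1)]]])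
  then show "Q (diag t (P x)) = 0"
    by (rule fun_cong)
qed

context phase
begin

text \<open>The coordinates \<open>x\<^sub>0\<close> and \<open>x\<^sub>1\<close> grade the
  operators: \<open>chi 0\<close> belongs to the translation that flips \<open>x\<^sub>0\<close>,
  and so on. The four terms are the level set in degree \<open>(0, 0)\<close>, one point in degree
  \<open>(1, 0)\<close> and two points in degree \<open>(0, 1)\<close>, which differ in the
  coordinate \<open>x\<^sub>2\<close>.\<close>

definition kernel_symbol :: "nat \<Rightarrow> complex" where
  "kernel_symbol n = level_symbol n + (chi 0 n + (chi 1 n + chi 1 n * chi 2 n))"

lemma chars: "is_char (chi 0)" "is_char (chi 1)" "is_char (\<lambda>n. chi 1 n * chi 2 n)"
  by (simp_all add: is_char_chi is_char_mult)

lemma kernel_symbol_bound: "cmod (kernel_symbol n) \<le> infsum b UNIV + (1 + (1 + 1))"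
  unfolding kernel_symbol_def by (intro norm_triangle_mono level_symbol_bound char_bound[OF chars(1)] char_bound[OF chars(2)]
      char_bound[OF chars(3)])

lemma bclinear_kernel_symbol: "bclinear (diag kernel_symbol)"
  by (rule bclinear_diag[OF kernel_symbol_bound])

text \<open>The four terms have positive kernels, so there is no cancellation.\<close>

lemma kernel_symbol_split:
  assumes PQ: "conv_proj P" "conv_proj Q" and z: "pairing kernel_symbol P Q = 0"
  shows "pairing level_symbol P Q = 0" "pairing (chi 0) P Q = 0" "pairing (chi 1) P Q = 0" "pairing (\<lambda>n. chi 1 n * chi 2 n) P Q = 0"
proof -
  note b = char_bound[OF chars(1)] char_bound[OF chars(2)] char_bound[OF chars(3)]
  have "pairing kernel_symbol P Q = pairing level_symbol P Q + (pairing (chi 0) P Q + (pairing (chi 1) P Q + pairing (\<lambda>n. chi 1 n * chi 2 n) P Q))"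
    unfolding kernel_symbol_def
    using pairing_add[where t = level_symbol and s = "\<lambda>n. chi 0 n + (chi 1 n + chi 1 n * chi 2 n)", OF level_symbol_bound
        norm_triangle_mono[OF b(1) norm_triangle_mono[OF b(2,3)]], of P Q]
      pairing_add[where t = "chi 0" and s = "\<lambda>n. chi 1 n + chi 1 n * chi 2 n", OF b(1) norm_triangle_mono[OF b(2,3)], of P Q]
      pairing_add[where t = "chi 1" and s = "\<lambda>n. chi 1 n * chi 2 n", OF b(2,3), of P Q]
    by simp
  with z have z1: "pairing level_symbol P Q + (pairing (chi 0) P Q + (pairing (chi 1) P Q + pairing (\<lambda>n. chi 1 n * chi 2 n) P Q)) = 0"
    by simp
  note n0 = nonneg_real_pairing_level_symbol[OF PQ] and n1 = nonneg_real_pairing_char[OF chars(1) PQ] and n2 = nonneg_real_pairing_char[OF chars(2) PQ]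
    and n3 = nonneg_real_pairing_char[OF chars(3) PQ]
  from nonneg_real_add_eq_0[OF n0 nonneg_real_add[OF n1 nonneg_real_add[OF n2 n3]] z1]
  have 1: "pairing level_symbol P Q = 0" "pairing (chi 0) P Q + (pairing (chi 1) P Q + pairing (\<lambda>n. chi 1 n * chi 2 n) P Q) = 0"
    by auto
  from nonneg_real_add_eq_0[OF n1 nonneg_real_add[OF n2 n3] 1(2)]
  have 2: "pairing (chi 0) P Q = 0" "pairing (chi 1) P Q + pairing (\<lambda>n. chi 1 n * chi 2 n) P Q = 0"
    by auto
  from nonneg_real_add_eq_0[OF n2 n3 2(2)] 1 2
  show "pairing level_symbol P Q = 0" "pairing (chi 0) P Q = 0" "pairing (chi 1) P Q = 0" "pairing (\<lambda>n. chi 1 n * chi 2 n) P Q = 0"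
    by auto
qed

definition refl_bimod :: "(ell2 \<Rightarrow> ell2) set" where
  "refl_bimod = reflexive_hull (diag kernel_symbol)"

lemma chi_refl_bimod: "diag (chi 0) \<in> refl_bimod" "diag (chi 1) \<in> refl_bimod" "diag (\<lambda>n. chi 1 n * chi 2 n) \<in> refl_bimod"
  unfolding refl_bimod_def
  by (rule diag_in_reflexive_hull[OF kernel_symbol_bound char_bound[OF chars(1)]], erule (2) kernel_symbol_split)
    (rule diag_in_reflexive_hull[OF kernel_symbol_bound char_bound[OF chars(2)]], erule (2) kernel_symbol_split,
      rule diag_in_reflexive_hull[OF kernel_symbol_bound char_bound[OF chars(3)]], erule (2) kernel_symbol_split)

lemma level_deriv_refl_bimod: "diag level_deriv \<in> refl_bimod"
  unfolding refl_bimod_def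
  by (rule diag_in_reflexive_hull[OF kernel_symbol_bound level_deriv_bound]) (blast intro: pairing_level_deriv_eq_0 kernel_symbol_split(1))

text \<open>The projection onto the functions supported by \<open>x\<^sub>0 = a\<close>,
  \<open>x\<^sub>1 = c\<close>.\<close>

definition block :: "bool \<Rightarrow> bool \<Rightarrow> ell2 \<Rightarrow> ell2" where
  "block a c x = half a 1 (half c 2 x)"

lemma conv_proj_block: "conv_proj (block a c)"
  unfolding block_def[abs_def] by (rule conv_proj_comp[OF conv_proj_half conv_proj_half])

lemma block_conv_ops: "block a c \<in> conv_ops"
  using conv_proj_block by (simp add: conv_proj_def)

lemma half_conv_ops: "half a k \<in> conv_ops"
  using conv_proj_half by (simp add: conv_proj_def)

lemma half_0 [simp]: "half a k 0 = 0"
  by (rule bclinear_simps(3)[OF conv_ops_bclinear[OF half_conv_ops]])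

lemma block_0 [simp]: "block a c 0 = 0"
  by (simp add: block_def)

lemma block_block: "block a c (block a' c' x) = (if a = a' \<and> c = c' then block a c x else 0)"
proof -
  have "block a c (block a' c' x) = half a 1 (half a' 1 (half c 2 (half c' 2 x)))"
    unfolding block_def by (simp add: conv_ops_commute[OF half_conv_ops[of c 2] half_conv_ops[of a' 1]])
  then show ?thesis
    using conv_proj_half by (auto simp: block_def half_orth conv_proj_def is_projD(2))
qed

lemma block_add: "block a c (x + y) = block a c x + block a c y"
  by (rule bclinear_simps[OF conv_ops_bclinear[OF block_conv_ops]])

lemma block_sum: "x = block False False x + block False True x + (block True False x + block True True x)"
  unfolding block_def
  by (simp add: half_sum flip: bclinear_simps(1)[OF conv_ops_bclinear[OF half_conv_ops]])

lemma diag_kernel_symbol: "diag kernel_symbol x = diag level_symbol x + (diag (chi 0) x + (diag (chi 1) x + diag (\<lambda>n. chi 1 n * chi 2 n) x))"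
  by (rule ell2_eqI)
    (simp add: coef_diag[OF kernel_symbol_bound] coef_diag[OF level_symbol_bound] coef_char[OF chars(1)] coef_char[OF chars(2)]
      coef_char[OF chars(3)] kernel_symbol_def algebra_simps)

lemma level_symbol_xor: "j < 2 \<Longrightarrow> level_symbol (n XOR 2 ^ j) = level_symbol n"
  by (simp add: level_symbol_def e_low)

lemma level_symbol_block: "diag level_symbol (block a c x) = block a c (diag level_symbol x)"
proof -
  have l: "diag level_symbol (shift (2 ^ j) x) = shift (2 ^ j) (diag level_symbol x)" if "j < 2" for j x
    by (rule ell2_eqI) (simp add: coef_diag[OF level_symbol_bound] level_symbol_xor[OF that])
  have "diag level_symbol (half a (2 ^ j) x) = half a (2 ^ j) (diag level_symbol x)" if "j < 2" for a j x
    using l[OF that] by (auto simp: half_def bclinear_simps[OF bclinear_diag[OF level_symbol_bound]])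
  from this[of 0] this[of 1] show ?thesis
    by (simp add: block_def)
qed

lemma chi_block:
  "diag (chi 0) (block a c x) = block (\<not> a) c (diag (chi 0) x)"
  "diag (chi 1) (block a c x) = block a (\<not> c) (diag (chi 1) x)"
  "diag (\<lambda>n. chi 1 n * chi 2 n) (block a c x) = block a (\<not> c) (diag (\<lambda>n. chi 1 n * chi 2 n) x)"
proof -
  have "bit (1::nat) 0" "\<not> bit (1::nat) 1" "\<not> bit (1::nat) 2" "\<not> bit (2::nat) 0" "bit (2::nat) 1" "\<not> bit (2::nat) 2"
    by (simp_all add: bit_iff_odd One_nat_def[symmetric] del: One_nat_def)
  then have "chi 0 1 = - 1" "chi 0 2 = 1" "chi 1 1 = 1" "chi 1 2 = - 1" "chi 2 1 = 1" "chi 2 2 = 1"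
    by (simp_all add: chi_def)
  then show "diag (chi 0) (block a c x) = block (\<not> a) c (diag (chi 0) x)"
    "diag (chi 1) (block a c x) = block a (\<not> c) (diag (chi 1) x)"
    "diag (\<lambda>n. chi 1 n * chi 2 n) (block a c x) = block a (\<not> c) (diag (\<lambda>n. chi 1 n * chi 2 n) x)"
    by (simp_all add: block_def char_half[OF chars(1)] char_half[OF chars(2)] char_half[OF chars(3)])
qed

text \<open>No term of \<open>kernel_symbol\<close> has degree \<open>(1, 1)\<close>.\<close>

lemma refl_bimod_vanish_flip_both:
  assumes "T \<in> refl_bimod"
  shows "block (\<not> a) (\<not> c) (T (block a c x)) = 0"
proof (rule reflexive_hullD[OF assms[unfolded refl_bimod_def] conv_proj_block conv_proj_block])
  show "block (\<not> a) (\<not> c) (diag kernel_symbol (block a c x)) = 0" for x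
    by (simp add: diag_kernel_symbol level_symbol_block chi_block block_add block_block)
qed

text \<open>The Walsh functions that do not involve the grading coordinates.\<close>

definition high :: "nat \<Rightarrow> bool" where
  "high m \<longleftrightarrow> \<not> bit m 0 \<and> \<not> bit m 1"

lemma commute_shift_of_half:
  assumes "bclinear W" "\<And>c x. half (\<not> c) m (W (half c m x)) = 0"
  shows "W (shift m x) = shift m (W x)"
proof -
  have f: "half False m (W x) = half False m (W (half False m x))" 
    "half True m (W x) = half True m (W (half True m x))" for x
    using assms(2)[of True x] assms(2)[of False x] half_sum[of m x]
    by (metis add_0 add.right_neutral bclinear_simps(1)[OF conv_ops_bclinear[OF half_conv_ops]] bclinear_simps(1)[OF assms(1)] not_not)+
  have g: "W (half False m x) = half False m (W (half False m x))"
    "W (half True m x) = half True m (W (half True m x))" for x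
    using assms(2)[of False x] assms(2)[of True x] half_sum[of m "W (half False m x)"] half_sum[of m "W (half True m x)"]
    by simp_all
  have "W (shift m x) = W (half False m x) - W (half True m x)"
    by (simp flip: half_diff bclinear_simps(2)[OF assms(1)])
  also have "\<dots> = half False m (W x) - half True m (W x)"
    using f g by metis
  finally show ?thesis
    by (simp add: half_diff)
qed

text \<open>In degree \<open>(1, 0)\<close> the generator is a single translation, which flips only
  \<open>x\<^sub>0\<close>. So members of the hull are there multiples of this translation by
  bounded functions, and commute with the Walsh functions that it fixes.\<close>

lemma refl_bimod_commute_flip_first:
  assumes T: "T \<in> refl_bimod" and m: "high m"
  shows "block (\<not> a) c (T (block a c (shift m x))) = shift m (block (\<not> a) c (T (block a c x)))"
proof (rule commute_shift_of_half)
  show "bclinear (\<lambda>x. block (\<not> a) c (T (block a c x)))"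
    using bclinear_comp[OF conv_ops_bclinear[OF block_conv_ops] bclinear_comp[OF reflexive_hull_bclinear[OF T[unfolded refl_bimod_def]] conv_ops_bclinear[OF block_conv_ops]]] .
  have P: "conv_proj (\<lambda>x. block a c (half d m x))" "conv_proj (\<lambda>x. half (\<not> d) m (block (\<not> a) c x))" for d
    by (rule conv_proj_comp[OF conv_proj_block conv_proj_half], rule conv_proj_comp[OF conv_proj_half conv_proj_block])
  have chi0: "diag (chi 0) (half d m x) = half d m (diag (chi 0) x)" for d x
    using m by (simp add: char_half[OF chars(1)] chi_def high_def)
  show "half (\<not> d) m (block (\<not> a) c (T (block a c (half d m x)))) = 0" for d x
  proof (rule reflexive_hullD[OF T[unfolded refl_bimod_def] P])
    show "half (\<not> d) m (block (\<not> a) c (diag kernel_symbol (block a c (half d m x)))) = 0" for x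
      by (simp add: diag_kernel_symbol level_symbol_block chi_block block_add block_block chi0 half_orth
          conv_ops_commute[OF half_conv_ops block_conv_ops])
  qed
qed

lemma shift_block: "shift 1 (block a c x) = (if a then - 1 else 1) *\<^sub>C block a c x"
  "shift 2 (block a c x) = (if c then - 1 else 1) *\<^sub>C block a c x"
proof -
  have l: "shift k (half a k x) = (if a then - 1 else 1) *\<^sub>C half a k x" for a k x
    by (rule ell2_eqI) (simp add: half_def algebra_simps)
  have "block a c x = half c 2 (half a 1 x)"
    unfolding block_def by (rule conv_ops_commute[OF half_conv_ops half_conv_ops])
  then show "shift 2 (block a c x) = (if c then - 1 else 1) *\<^sub>C block a c x"
    by (simp only: l)
  show "shift 1 (block a c x) = (if a then - 1 else 1) *\<^sub>C block a c x"
    unfolding block_def by (rule l)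
qed

lemma conv_ops_of_blocks:
  assumes A: "bclinear A"
    and off: "\<And>a c a' c' x. (a', c') \<noteq> (a, c) \<Longrightarrow> block a' c' (A (block a c x)) = 0"
    and dia: "\<And>a c m x. high m \<Longrightarrow> block a c (A (block a c (shift m x))) = shift m (block a c (A (block a c x)))"
  shows "A \<in> conv_ops"
proof -
  have blkA: "A (block a c x) = block a c (A (block a c x))" for a c x
    using block_sum[of "A (block a c x)"] off by (cases a; cases c) simp_all
  have red: "A (shift k x) = shift k (A x)"
    if h: "\<And>a c x. A (shift k (block a c x)) = shift k (A (block a c x))" for k x
  proof -
    have "A (shift k x) = A (shift k (block False False x + block False True x + (block True False x + block True True x)))"
      by (subst block_sum[of x]) simp
    also have "\<dots> = shift k (A (block False False x + block False True x + (block True False x + block True True x)))"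
      by (simp only: bclinear_simps(1)[OF A] bclinear_simps(1)[OF bclinear_shift] h)
    finally show ?thesis
      by (simp flip: block_sum)
  qed
  have l1: "A (shift 1 x) = shift 1 (A x)" for x
  proof (rule red)
    fix a c x
    show "A (shift 1 (block a c x)) = shift 1 (A (block a c x))"
      using shift_block(1)[of a c "A (block a c x)", folded blkA] by (simp only: shift_block bclinear_simps(5)[OF A])
  qed
  have l2: "A (shift 2 x) = shift 2 (A x)" for x
  proof (rule red)
    fix a c x
    show "A (shift 2 (block a c x)) = shift 2 (A (block a c x))"
      using shift_block(2)[of a c "A (block a c x)", folded blkA] by (simp only: shift_block bclinear_simps(5)[OF A])
  qed
  have lh: "A (shift m x) = shift m (A x)" if m: "high m" for m x
  proof (rule red)
    fix a c x
    have "A (shift m (block a c x)) = A (block a c (shift m x))"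
      by (simp only: conv_ops_shift[OF block_conv_ops])
    also have "\<dots> = block a c (A (block a c (shift m x)))"
      by (rule blkA)
    also have "\<dots> = shift m (A (block a c x))"
      unfolding dia[OF m] by (simp only: blkA[symmetric])
    finally show "A (shift m (block a c x)) = shift m (A (block a c x))" .
  qed
  have "A (shift k x) = shift k (A x)" for k x
  proof -
    \<comment> \<open>\<open>k\<close> is the XOR of its two lowest digits and of a number in \<open>high\<close>.\<close>
    define r where "r = (if bit k 0 then 1 else 0 :: nat)"
    define s where "s = (if bit k 1 then 2 else 0 :: nat)"
    define m where "m = (k XOR r) XOR s"
    have "bit (1::nat) 0" "\<not> bit (1::nat) 1" "\<not> bit (2::nat) 0" "bit (2::nat) 1"
      by (simp_all add: bit_iff_odd One_nat_def[symmetric] del: One_nat_def)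
    then have "high m"
      by (auto simp: high_def m_def r_def s_def bit_xor_iff)
    have lr: "A (shift r x) = shift r (A x)" for x
      using l1 by (auto simp: r_def shift_shift_0)
    have ls: "A (shift s x) = shift s (A x)" for x
      using l2 by (auto simp: s_def shift_shift_0)
    have k: "k = (m XOR s) XOR r"
      by (simp add: m_def)
    show ?thesis
      by (simp only: k shift_shift[symmetric] lh[OF \<open>high m\<close>] lr ls)
  qed
  then show ?thesis
    using A by (simp add: conv_ops_def)
qed

end

section \<open>One-sided multipliers\<close>

lemma char_eq_0D: "is_char t \<Longrightarrow> diag t y = 0 \<Longrightarrow> y = 0"
  by (metis char_char bclinear_char bclinear_simps(3))

lemma char_injD: "is_char t \<Longrightarrow> diag t x = diag t y \<Longrightarrow> x = y"
  by (metis char_char)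

lemma eq_0_of_commute_anticommute: "y = shift k z \<Longrightarrow> - y = shift k z \<Longrightarrow> z = 0"
  for y z :: ell2
proof -
  assume "y = shift k z" "- y = shift k z"
  then have "- y = y"
    by simp
  then have "- coef y n = coef y n" for n
    using coef_minus[of y n] by simp
  then have "coef y n = 0" for n
    by (simp add: complex_eq_iff)
  then have "shift k z = 0"
    using \<open>y = shift k z\<close> by (intro ell2_eqI) simp
  then have "shift k (shift k z) = shift k 0"
    by simp
  then show "z = 0"
    by (simp add: bclinear_simps[OF bclinear_shift])
qed

context phase
begin

lemma chi_shift:
  assumes "high m"
  shows "diag (chi 0) (shift m x) = shift m (diag (chi 0) x)" "diag (chi 1) (shift m x) = shift m (diag (chi 1) x)"
  using assms by (simp_all add: char_shift[OF chars(1)] char_shift[OF chars(2)] chi_def high_def)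

lemma high_4: "high 4"
  by (simp add: high_def bit_iff_odd)

lemma chi12_lam4: "diag (\<lambda>n. chi 1 n * chi 2 n) (shift 4 x) = - shift 4 (diag (\<lambda>n. chi 1 n * chi 2 n) x)"
proof -
  have "\<not> bit (4::nat) 1" "bit (4::nat) 2"
    by (simp_all add: bit_iff_odd)
  then have "chi 1 4 * chi 2 4 = - 1"
    by (simp add: chi_def)
  then show ?thesis
    using char_shift[OF chars(3), of 4 x] by (simp add: cscale_minus_left)
qed

text \<open>Multiplying \<open>A\<close> by a member of the bimodule of degree \<open>(1, 0)\<close>
  or \<open>(0, 1)\<close> moves the part of \<open>A\<close> of degree \<open>(0, 1)\<close> or
  \<open>(1, 0)\<close> to degree \<open>(1, 1)\<close>, where it must vanish. The two members
  \<open>chi 1\<close> and \<open>chi 1 * chi 2\<close> of degree \<open>(0, 1)\<close> move the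
  part of degree \<open>(1, 1)\<close> to degree \<open>(1, 0)\<close>. There both products commute
  with \<open>shift 4\<close>, but \<open>chi 2\<close> anticommutes with it, so this part vanishes
  as well. The part of degree \<open>(0, 0)\<close> moves to degree \<open>(1, 0)\<close> and
  commutes with the shifts.\<close>

theorem right_multipliers_in_conv_ops:
  assumes A: "bclinear A" and M: "\<And>T. T \<in> refl_bimod \<Longrightarrow> (\<lambda>x. T (A x)) \<in> refl_bimod"
  shows "A \<in> conv_ops"
proof (rule conv_ops_of_blocks[OF A])
  note M0 = M[OF chi_refl_bimod(1)] and M1 = M[OF chi_refl_bimod(2)] and M2 = M[OF chi_refl_bimod(3)]
  have 01: "block a (\<not> c) (A (block a c x)) = 0" for a c x
    using refl_bimod_vanish_flip_both[OF M0, of a c x] chi_block(1)[of a "\<not> c" "A (block a c x)"]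
    by - (rule char_eq_0D[OF chars(1)], simp)
  have 10: "block (\<not> a) c (A (block a c x)) = 0" for a c x
    using refl_bimod_vanish_flip_both[OF M1, of a c x] chi_block(2)[of "\<not> a" c "A (block a c x)"]
    by - (rule char_eq_0D[OF chars(2)], simp)
  have comm: "block (\<not> a) (\<not> c) (A (block a c (shift m x))) = shift m (block (\<not> a) (\<not> c) (A (block a c x)))"
    if m: "high m" for a c m x
    using refl_bimod_commute_flip_first[OF M1 m, of a c x]
      chi_block(2)[of "\<not> a" "\<not> c" "A (block a c (shift m x))"] chi_block(2)[of "\<not> a" "\<not> c" "A (block a c x)"]
    by - (rule char_injD[OF chars(2)], simp add: chi_shift[OF m])
  have 11: "block (\<not> a) (\<not> c) (A (block a c x)) = 0" for a c x
  proof -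
    let ?t = "\<lambda>n. chi 1 n * chi 2 n"
    have "diag ?t (block (\<not> a) (\<not> c) (A (block a c (shift 4 x)))) = shift 4 (diag ?t (block (\<not> a) (\<not> c) (A (block a c x))))"
      using refl_bimod_commute_flip_first[OF M2 high_4, of a c x]
        chi_block(3)[of "\<not> a" "\<not> c" "A (block a c (shift 4 x))"] chi_block(3)[of "\<not> a" "\<not> c" "A (block a c x)"]
      by simp
    moreover have "diag ?t (block (\<not> a) (\<not> c) (A (block a c (shift 4 x))))
        = - shift 4 (diag ?t (block (\<not> a) (\<not> c) (A (block a c x))))"
      unfolding comm[OF high_4] by (rule chi12_lam4)
    ultimately have "diag ?t (block (\<not> a) (\<not> c) (A (block a c x))) = 0"
      by - (rule eq_0_of_commute_anticommute[OF refl], simp)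
    then show ?thesis
      by (rule char_eq_0D[OF chars(3)])
  qed
  show "block a' c' (A (block a c x)) = 0" if "(a', c') \<noteq> (a, c)" for a c a' c' x
    using that 01[of a c x] 10[of a c x] 11[of a c x] by (cases a; cases a'; cases c; cases c') simp_all
  show "block a c (A (block a c (shift m x))) = shift m (block a c (A (block a c x)))" if m: "high m" for a c m x
    using refl_bimod_commute_flip_first[OF M0 m, of a c x]
      chi_block(1)[of a c "A (block a c (shift m x))"] chi_block(1)[of a c "A (block a c x)"]
    by - (rule char_injD[OF chars(1)], simp add: chi_shift[OF m])
qed

text \<open>The same argument with the product in the other order.\<close>

theorem left_multipliers_in_conv_ops:
  assumes B: "bclinear B" and M: "\<And>T. T \<in> refl_bimod \<Longrightarrow> (\<lambda>x. B (T x)) \<in> refl_bimod"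
  shows "B \<in> conv_ops"
proof (rule conv_ops_of_blocks[OF B])
  note M0 = M[OF chi_refl_bimod(1)] and M1 = M[OF chi_refl_bimod(2)] and M2 = M[OF chi_refl_bimod(3)]
  have 01: "block a (\<not> c) (B (block a c x)) = 0" for a c x
    using refl_bimod_vanish_flip_both[OF M0, of "\<not> a" c "diag (chi 0) x"] by (simp add: chi_block char_char[OF chars(1)])
  have 10: "block (\<not> a) c (B (block a c x)) = 0" for a c x
    using refl_bimod_vanish_flip_both[OF M1, of a "\<not> c" "diag (chi 1) x"] by (simp add: chi_block char_char[OF chars(2)])
  have comm: "block (\<not> a) (\<not> c) (B (block a c (shift m x))) = shift m (block (\<not> a) (\<not> c) (B (block a c x)))"
    if m: "high m" for a c m x
    using refl_bimod_commute_flip_first[OF M1 m, of a "\<not> c" "diag (chi 1) x"]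
    by (simp add: chi_block chi_shift[OF m] char_char[OF chars(2)])
  have 11: "block (\<not> a) (\<not> c) (B (block a c x)) = 0" for a c x
  proof (rule eq_0_of_commute_anticommute[OF comm[OF high_4]])
    show "- block (\<not> a) (\<not> c) (B (block a c (shift 4 x))) = shift 4 (block (\<not> a) (\<not> c) (B (block a c x)))"
      using refl_bimod_commute_flip_first[OF M2 high_4, of a "\<not> c" "diag (\<lambda>n. chi 1 n * chi 2 n) x"]
      by (simp add: chi_block chi12_lam4 char_char[OF chars(3)] bclinear_simps[OF conv_ops_bclinear[OF block_conv_ops]]
          bclinear_simps[OF B])
  qed
  show "block a' c' (B (block a c x)) = 0" if "(a', c') \<noteq> (a, c)" for a c a' c' x
    using that 01[of a c x] 10[of a c x] 11[of a c x] by (cases a; cases a'; cases c; cases c') simp_all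
  show "block a c (B (block a c (shift m x))) = shift m (block a c (B (block a c x)))" if m: "high m" for a c m x
    using refl_bimod_commute_flip_first[OF M0 m, of "\<not> a" c "diag (chi 0) x"]
    by (simp add: chi_block chi_shift[OF m] char_char[OF chars(1)])
qed

section \<open>A smaller bimodule with the same map\<close>

text \<open>The Fourier coefficients of \<open>exp (i h) - 1\<close> on the subgroup
  \<open>x\<^sub>0 = x\<^sub>1 = 0\<close>.\<close>

definition test_weight :: "nat \<Rightarrow> complex" where
  "test_weight n = e 1 n - e 0 n"

lemma test_weight_abs: "test_weight abs_summable_on UNIV"
proof (rule summable_on_comparison_test)
  show "(\<lambda>n. cmod (e 1 n) + cmod (e 0 n)) summable_on UNIV"
    by (intro summable_on_add e_l1)
qed (auto simp: test_weight_def norm_triangle_ineq4)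

text \<open>The members of the hull whose kernel is annihilated by the multiplication with
  \<open>exp (i h (x + y)) - 1\<close>, restricted to degree \<open>(0, 0)\<close>. This
  multiplication maps \<open>T\<close> to the sum of \<open>test_weight n\<close> times
  \<open>shift n T shift n\<close>; it is written weakly.\<close>

definition sub_bimod :: "(ell2 \<Rightarrow> ell2) set" where
  "sub_bimod = {T \<in> refl_bimod. \<forall>x y. (\<Sum>\<^sub>\<infinity>n. test_weight n * cin (T (shift n x)) (shift n y)) = 0}"

lemma sub_bimod_summable:
  assumes "bclinear T"
  shows "(\<lambda>n. test_weight n * cin (T (shift n x)) (shift n y)) summable_on UNIV"
proof -
  obtain C where C: "\<And>x. norm (T x) \<le> C * norm x"
    using bclinear_bound[OF assms] by blast
  have "cmod (cin (T (shift n x)) (shift n y)) \<le> C * norm x * norm y" for n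
    using cin_bound[of "T (shift n x)" "shift n y"] mult_right_mono[OF C[of "shift n x"], of "norm y"] by simp
  then show ?thesis
    by (rule abs_summable_summable[OF abs_summable_mult_bounded[OF test_weight_abs]])
qed

lemma refl_bimod_bclinear: "T \<in> refl_bimod \<Longrightarrow> bclinear T"
  unfolding refl_bimod_def by (rule reflexive_hull_bclinear)

lemma sub_bimod_refl_bimod: "sub_bimod \<subseteq> refl_bimod"
  by (auto simp: sub_bimod_def)

lemma sub_bimod_0: "(\<lambda>x. 0) \<in> sub_bimod"
  by (simp add: sub_bimod_def refl_bimod_def reflexive_hull_0)

lemma sub_bimod_add:
  assumes "T \<in> sub_bimod" "T' \<in> sub_bimod"
  shows "(\<lambda>x. T x + T' x) \<in> sub_bimod"
proof -
  have M: "T \<in> refl_bimod" "T' \<in> refl_bimod"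
    using assms by (auto simp: sub_bimod_def)
  have "(\<Sum>\<^sub>\<infinity>n. test_weight n * cin (T (shift n x) + T' (shift n x)) (shift n y)) = 0" for x y
    using assms infsum_add[OF sub_bimod_summable[OF refl_bimod_bclinear[OF M(1)]] sub_bimod_summable[OF refl_bimod_bclinear[OF M(2)]], of x y x y]
    by (simp add: sub_bimod_def cin_add_left distrib_left)
  then show ?thesis
    using reflexive_hull_add[OF M[unfolded refl_bimod_def]] by (simp add: sub_bimod_def refl_bimod_def)
qed

lemma sub_bimod_cscale:
  assumes "T \<in> sub_bimod"
  shows "(\<lambda>x. c *\<^sub>C T x) \<in> sub_bimod"
proof -
  have "(\<Sum>\<^sub>\<infinity>n. test_weight n * (c * cin (T (shift n x)) (shift n y))) = c * (\<Sum>\<^sub>\<infinity>n. test_weight n * cin (T (shift n x)) (shift n y))" for x y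
    by (subst infsum_cmult_right'[symmetric]) (simp add: mult_ac)
  then show ?thesis
    using assms reflexive_hull_cscale[of T "diag kernel_symbol" c] by (simp add: sub_bimod_def refl_bimod_def)
qed

lemma sub_bimod_bimodule:
  assumes T: "T \<in> sub_bimod" and A: "A \<in> conv_ops" and B: "B \<in> conv_ops"
  shows "(\<lambda>x. B (T (A x))) \<in> sub_bimod"
proof -
  have "cin (B (T (A (shift n x)))) (shift n y) = cin (T (shift n (A x))) (shift n (adj B y))" for n x y
    unfolding cin_adj[OF B] by (simp only: conv_ops_shift[OF A] conv_ops_shift[OF adj_conv_ops[OF B]])
  then show ?thesis
    using T reflexive_hull_bimodule[OF _ A B, of T "diag kernel_symbol"] by (simp add: sub_bimod_def refl_bimod_def)
qed

text \<open>The interchange of the sums over \<open>n\<close> and \<open>u\<close> is absolute: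
  \<open>e v\<close> is absolutely summable and \<open>B\<close> bounds the terms uniformly.\<close>

lemma e_conv_infsum:
  fixes c :: "int \<Rightarrow> complex"
  assumes c: "\<And>u. cmod (c u) * b u \<le> B u" and B: "B summable_on UNIV"
  shows "((\<lambda>n. e v n * (\<Sum>\<^sub>\<infinity>u. c u * e u (n XOR m))) has_sum (\<Sum>\<^sub>\<infinity>u. c u * e (v + u) m)) UNIV"
proof -
  have cb: "cmod (c u * e u n) \<le> B u" for u n
    using mult_left_mono[OF e_bound[of u n], of "cmod (c u)"] c[of u] by (simp add: norm_mult)
  have B0: "0 \<le> B u" for u
    using cb[of u 0] norm_ge_zero by (rule order_trans[rotated])
  have "(\<lambda>(n, u). e v n * (c u * e u (n XOR m))) abs_summable_on UNIV \<times> UNIV"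
  proof (rule Infinite_Sum.abs_summable_on_comparison_test)
    show "(\<lambda>(n, u). e v n * complex_of_real (B u)) abs_summable_on UNIV \<times> UNIV"
      unfolding Infinite_Sum.abs_summable_on_Sigma_iff using e_l1 B B0
      by (auto simp: norm_mult infsum_cmult_right' infsum_nonneg abs_mult summable_on_cmult_right summable_on_cmult_left)
    show "norm (case x of (n, u) \<Rightarrow> e v n * (c u * e u (n XOR m)))
        \<le> norm (case x of (n, u) \<Rightarrow> e v n * complex_of_real (B u))" for x
      using cb B0 by (auto simp: norm_mult[of "e v _"] split: prod.split intro!: mult_left_mono)
  qed
  then have s: "(\<lambda>(n, u). e v n * (c u * e u (n XOR m))) summable_on UNIV \<times> UNIV"
    by (rule abs_summable_summable)
  have "(\<lambda>n. \<Sum>\<^sub>\<infinity>u. e v n * (c u * e u (n XOR m))) summable_on UNIV"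
    using summable_on_Sigma_banach[OF s] .
  then have "((\<lambda>n. \<Sum>\<^sub>\<infinity>u. e v n * (c u * e u (n XOR m))) has_sum
      (\<Sum>\<^sub>\<infinity>n. \<Sum>\<^sub>\<infinity>u. e v n * (c u * e u (n XOR m)))) UNIV"
    by (rule has_sum_infsum)
  moreover have "(\<Sum>\<^sub>\<infinity>n. \<Sum>\<^sub>\<infinity>u. e v n * (c u * e u (n XOR m))) = (\<Sum>\<^sub>\<infinity>u. \<Sum>\<^sub>\<infinity>n. e v n * (c u * e u (n XOR m)))"
    by (rule infsum_swap_banach[OF s])
  moreover have "(\<Sum>\<^sub>\<infinity>n. e v n * (c u * e u (n XOR m))) = c u * e (v + u) m" for u
    using has_sum_cmult_right[OF e_conv[of v u m], of "c u"] by (simp add: infsumI mult.left_commute)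
  ultimately show ?thesis
    by (simp add: infsum_cmult_right')
qed

lemma e_conv_level_symbol: "((\<lambda>n. e v n * level_symbol (n XOR m)) has_sum level_symbol m) UNIV"
proof -
  have "(\<Sum>\<^sub>\<infinity>u. e (v + u) m) = level_symbol m"
    unfolding level_symbol_def by (rule infsum_reindex_bij_witness[of _ "\<lambda>u. u - v" "\<lambda>u. v + u"]) auto
  then show ?thesis
    using e_conv_infsum[of "\<lambda>_. 1" b v m] b_sum by (simp add: level_symbol_def)
qed

text \<open>Multiplying by \<open>V\<^sup>v\<close> replaces \<open>u\<close> by
  \<open>u - v\<close> as the factor of the coefficients of \<open>V\<^sup>u\<close>, so that the
  derivative is changed by a multiple of the density itself.\<close>

lemma e_conv_level_deriv: "((\<lambda>n. e v n * level_deriv (n XOR m)) has_sum (level_deriv m - of_int v * level_symbol m)) UNIV"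
proof -
  have "(\<Sum>\<^sub>\<infinity>u. of_int u * e (v + u) m) = (\<Sum>\<^sub>\<infinity>u. of_int (u - v) * e u m)"
    by (rule infsum_reindex_bij_witness[of _ "\<lambda>u. u - v" "\<lambda>u. v + u"]) auto
  also have "\<dots> = (\<Sum>\<^sub>\<infinity>u. of_int u * e u m + (- of_int v) * e u m)"
    by (simp add: algebra_simps)
  also have "\<dots> = level_deriv m + (- of_int v) * level_symbol m"
    unfolding level_deriv_def level_symbol_def
    by (intro infsumI has_sum_add has_sum_cmult_right has_sum_infsum)
      (rule abs_summable_summable[OF level_deriv_abs], rule abs_summable_summable[OF level_symbol_abs])
  finally show ?thesis
    using e_conv_infsum[of of_int "\<lambda>u. \<bar>real_of_int u\<bar> * b u" v m] b_sum by (simp add: level_deriv_def)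
qed

text \<open>The function with coefficients \<open>e v\<close> vanishes off
  \<open>x\<^sub>0 = x\<^sub>1 = 0\<close>, and the point of the character \<open>t\<close> is not
  in this subgroup. For the coefficients, flipping digit \<open>j\<close> changes the sign of the
  sum.\<close>

lemma e_char_sum:
  assumes t: "is_char t" and j: "j < 2" "t (2 ^ j) = - 1"
  shows "((\<lambda>n. e v n * t (n XOR m)) has_sum 0) UNIV"
proof -
  have s: "(\<lambda>n. e v n * t n) summable_on UNIV"
    by (rule abs_summable_summable[OF abs_summable_mult_bounded[OF e_l1 char_bound[OF t]]])
  have "(\<Sum>\<^sub>\<infinity>n. e v n * t n) = (\<Sum>\<^sub>\<infinity>n. e v (n XOR 2 ^ j) * t (n XOR 2 ^ j))"
    by (rule infsum_xor[symmetric])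
  also have "\<dots> = - (\<Sum>\<^sub>\<infinity>n. e v n * t n)"
    by (simp add: e_low[OF j(1)] char_xor[OF t] j infsum_uminus)
  finally have "(\<Sum>\<^sub>\<infinity>n. e v n * t n) = 0"
    by simp
  then have "((\<lambda>n. e v n * t n) has_sum 0) UNIV"
    using has_sum_infsum[OF s] by simp
  from has_sum_cmult_left[OF this, of "t m"] show ?thesis
    by (simp add: char_xor[OF t] mult.assoc)
qed

lemma test_weight_conv_kernel_symbol: "((\<lambda>n. test_weight n * kernel_symbol (n XOR m)) has_sum 0) UNIV"
proof -
  have bits: "chi 0 (2 ^ 0) = - 1" "chi 1 (2 ^ 1) = - 1" "chi 1 (2 ^ 1) * chi 2 (2 ^ 1) = - 1"
    by (simp_all add: chi_def bit_iff_odd One_nat_def)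
  have c: "((\<lambda>n. e v n * kernel_symbol (n XOR m)) has_sum (level_symbol m + (0 + (0 + 0)))) UNIV" for v
    unfolding kernel_symbol_def distrib_left
    by (intro has_sum_add e_conv_level_symbol e_char_sum[OF chars(1) _ bits(1)] e_char_sum[OF chars(2) _ bits(2)]
        e_char_sum[OF chars(3) _ bits(3)]) simp_all
  from has_sum_add[OF c[of 1] has_sum_cmult_right[OF c[of 0], of "- 1"]] show ?thesis
    by (simp add: test_weight_def algebra_simps)
qed

lemma kernel_symbol_sub_bimod: "diag kernel_symbol \<in> sub_bimod"
proof -
  have "(\<Sum>\<^sub>\<infinity>n. test_weight n * cin (diag kernel_symbol (shift n x)) (shift n y)) = 0" for x y
  proof -
    define p where "p m = coef x m * cnj (coef y m)" for m
    define C where "C = infsum b UNIV + (1 + (1 + 1))"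
    have p: "p abs_summable_on UNIV"
      unfolding p_def by (rule cin_summable)
    have C0: "0 \<le> C"
      using kernel_symbol_bound[of 0] norm_ge_zero unfolding C_def by (rule order_trans[rotated])
    have cin_eq: "cin (diag kernel_symbol (shift n x)) (shift n y) = (\<Sum>\<^sub>\<infinity>m. kernel_symbol (n XOR m) * p m)" for n
    proof -
      have "cin (diag kernel_symbol (shift n x)) (shift n y) = (\<Sum>\<^sub>\<infinity>m. kernel_symbol ((m XOR n) XOR n) * p (m XOR n))"
        unfolding cin_def p_def by (rule infsum_cong) (simp add: coef_diag[OF kernel_symbol_bound])
      also have "\<dots> = (\<Sum>\<^sub>\<infinity>m. kernel_symbol (m XOR n) * p m)"
        by (rule infsum_xor[of "\<lambda>m. kernel_symbol (m XOR n) * p m"])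
      finally show ?thesis
        by (simp add: xor.commute[of n])
    qed
    have "(\<lambda>(n, m). test_weight n * (kernel_symbol (n XOR m) * p m)) abs_summable_on UNIV \<times> UNIV"
    proof (rule Infinite_Sum.abs_summable_on_comparison_test)
      show "(\<lambda>(n, m). test_weight n * (complex_of_real C * p m)) abs_summable_on UNIV \<times> UNIV"
        unfolding Infinite_Sum.abs_summable_on_Sigma_iff using test_weight_abs p C0
        by (auto simp: norm_mult infsum_cmult_right' infsum_nonneg abs_mult summable_on_cmult_right summable_on_cmult_left)
      show "norm (case z of (n, m) \<Rightarrow> test_weight n * (kernel_symbol (n XOR m) * p m))
          \<le> norm (case z of (n, m) \<Rightarrow> test_weight n * (complex_of_real C * p m))" for z
        using kernel_symbol_bound C0 by (auto simp: norm_mult C_def split: prod.split intro!: mult_left_mono mult_right_mono)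
    qed
    then have s: "(\<lambda>(n, m). test_weight n * (kernel_symbol (n XOR m) * p m)) summable_on UNIV \<times> UNIV"
      by (rule abs_summable_summable)
    have "(\<Sum>\<^sub>\<infinity>n. test_weight n * cin (diag kernel_symbol (shift n x)) (shift n y)) = (\<Sum>\<^sub>\<infinity>n. \<Sum>\<^sub>\<infinity>m. test_weight n * (kernel_symbol (n XOR m) * p m))"
      unfolding cin_eq by (simp only: infsum_cmult_right')
    also have "\<dots> = (\<Sum>\<^sub>\<infinity>m. \<Sum>\<^sub>\<infinity>n. test_weight n * (kernel_symbol (n XOR m) * p m))"
      by (rule infsum_swap_banach[OF s])
    also have "\<dots> = (\<Sum>\<^sub>\<infinity>m::nat. 0)"
    proof (rule infsum_cong)
      fix m
      show "(\<Sum>\<^sub>\<infinity>n. test_weight n * (kernel_symbol (n XOR m) * p m)) = 0"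
        using infsumI[OF has_sum_cmult_left[OF test_weight_conv_kernel_symbol[of m], of "p m"]] by (simp add: mult.assoc)
    qed
    finally show ?thesis
      by simp
  qed
  then show ?thesis
    unfolding sub_bimod_def refl_bimod_def using reflexive_hull_self[OF bclinear_kernel_symbol] by simp
qed

lemma level_deriv_not_sub_bimod: "diag level_deriv \<notin> sub_bimod"
proof
  assume "diag level_deriv \<in> sub_bimod"
  then have "(\<Sum>\<^sub>\<infinity>n. test_weight n * cin (diag level_deriv (shift n (delta 0))) (shift n (delta 0))) = 0"
    by (simp add: sub_bimod_def)
  then have "(\<Sum>\<^sub>\<infinity>n. test_weight n * level_deriv n) = 0"
    by (simp add: shift_delta coef_diag[OF level_deriv_bound])
  moreover have "((\<lambda>n. test_weight n * level_deriv n) has_sum - level_symbol 0) UNIV"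
    using has_sum_add[OF e_conv_level_deriv[of 1 0] has_sum_cmult_right[OF e_conv_level_deriv[of 0 0], of "- 1"]]
    by (simp add: test_weight_def algebra_simps)
  ultimately have "level_symbol 0 = 0"
    by (simp add: infsumI)
  then show False
    using e_sum_0 by (simp add: level_symbol_def)
qed

text \<open>Let \<open>P\<close> project onto the smallest closed shift-invariant subspace
  containing \<open>x\<close>, and let \<open>Q\<close> project onto the orthogonal complement of
  the closed span of the images of \<open>x\<close> under the smaller bimodule. Both belong to the
  masa, and \<open>Q S P = 0\<close> for the generator \<open>S\<close>, which is in the smaller
  bimodule. Hence \<open>Q T P = 0\<close> for all \<open>T\<close> in the hull.\<close>

lemma refl_bimod_in_closure_sub_bimod:
  assumes "T \<in> refl_bimod"
  shows "T x \<in> closure (cspan {S x | S. S \<in> sub_bimod})"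
proof -
  define V where "V = closure (cspan (range (\<lambda>k. shift k x)))"
  define W where "W = closure (cspan {S x | S. S \<in> sub_bimod})"
  have V: "closed V" "csubspace V" and W: "closed W" "csubspace W"
    by (simp_all add: V_def W_def csubspace_closure_cspan)
  have pre: "closed (shift k -` Z)" "csubspace (shift k -` Z)" if "closed Z" "csubspace Z" for k Z
    using that continuous_closed_vimage[of Z "shift k"] bclinear_continuous[OF bclinear_shift[of k], of UNIV]
    by (auto simp: csubspace_def bclinear_simps[OF bclinear_shift] continuous_on_eq_continuous_at)
  have "V \<subseteq> shift k -` V" for k
    unfolding V_def
  proof (rule closure_cspan_minimal)
    show "range (\<lambda>k. shift k x) \<subseteq> shift k -` closure (cspan (range (\<lambda>k. shift k x)))"
    proof -
      have "shift j x \<in> closure (cspan (range (\<lambda>k. shift k x)))" for j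
        using closure_cspan_superset[of "range (\<lambda>k. shift k x)"] by blast
      then show ?thesis
        by (auto simp: shift_shift)
    qed
  qed (use pre V in \<open>auto simp: V_def\<close>)
  then have P: "conv_proj (orth_proj V)"
    using orth_proj_conv_ops[OF V] is_proj_orth_proj[OF V] by (auto simp: conv_proj_def)
  have "W \<subseteq> shift k -` W" for k
    unfolding W_def
  proof (rule closure_cspan_minimal)
    show "{S x | S. S \<in> sub_bimod} \<subseteq> shift k -` closure (cspan {S x | S. S \<in> sub_bimod})"
    proof
      fix z assume "z \<in> {S x | S. S \<in> sub_bimod}"
      then obtain S where S: "S \<in> sub_bimod" "z = S x"
        by blast
      have "(\<lambda>y. shift k (S y)) \<in> sub_bimod"
        using sub_bimod_bimodule[OF S(1) conv_ops_id shift_conv_ops] .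
      then show "z \<in> shift k -` closure (cspan {S x | S. S \<in> sub_bimod})"
        using closure_cspan_superset[of "{S x | S. S \<in> sub_bimod}"] S(2) by blast
    qed
  qed (use pre W in \<open>auto simp: W_def\<close>)
  then have "conv_proj (orth_proj W)"
    using orth_proj_conv_ops[OF W] is_proj_orth_proj[OF W] by (auto simp: conv_proj_def)
  then have Q: "conv_proj (\<lambda>y. y - orth_proj W y)"
    using is_proj_compl conv_ops_diff[OF conv_ops_id] by (auto simp: conv_proj_def)
  have "V \<subseteq> {z. diag kernel_symbol z \<in> W}"
    unfolding V_def
  proof (rule closure_cspan_minimal)
    show "range (\<lambda>k. shift k x) \<subseteq> {z. diag kernel_symbol z \<in> W}"
    proof
      fix z assume "z \<in> range (\<lambda>k. shift k x)"
      then obtain k where k: "z = shift k x"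
        by blast
      have "(\<lambda>y. diag kernel_symbol (shift k y)) \<in> sub_bimod"
        using sub_bimod_bimodule[OF kernel_symbol_sub_bimod shift_conv_ops conv_ops_id] .
      then show "z \<in> {z. diag kernel_symbol z \<in> W}"
        unfolding W_def k using closure_cspan_superset[of "{S x | S. S \<in> sub_bimod}"] by blast
    qed
    show "csubspace {z. diag kernel_symbol z \<in> W}"
      using W(2) by (auto simp: csubspace_def bclinear_simps[OF bclinear_kernel_symbol])
    show "closed {z. diag kernel_symbol z \<in> W}"
      using continuous_closed_vimage[OF W(1), of "diag kernel_symbol"] bclinear_continuous[OF bclinear_kernel_symbol, of UNIV]
      by (auto simp: vimage_def continuous_on_eq_continuous_at)
  qed
  then have "diag kernel_symbol (orth_proj V z) \<in> W" for z
    using orth_proj_in[OF V] by blast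
  then have "diag kernel_symbol (orth_proj V z) - orth_proj W (diag kernel_symbol (orth_proj V z)) = 0" for z
    by (simp add: orth_proj_fix[OF W])
  then have "T (orth_proj V x) - orth_proj W (T (orth_proj V x)) = 0"
    by (rule reflexive_hullD[OF assms[unfolded refl_bimod_def] P Q])
  moreover have "x \<in> V"
    using closure_cspan_superset[of "range (\<lambda>k. shift k x)"] shift_shift_0[of x] unfolding V_def
    by (metis UNIV_I image_subset_iff)
  ultimately have "T x = orth_proj W (T x)"
    by (simp add: orth_proj_fix[OF V])
  then show ?thesis
    using orth_proj_in[OF W, of "T x"] unfolding W_def by simp
qed

end

section \<open>The space of square summable sequences as a structure with a carrier\<close>

definition l2_space :: "(nat \<Rightarrow> complex) cinner_space" where
  "l2_space = \<lparr>carrier = l2, mult = undefined, one = undefined, zero = (\<lambda>_. 0),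
     add = (\<lambda>x y n. x n + y n), smult = (\<lambda>c x n. c * x n),
     cinner = (\<lambda>x y. \<Sum>\<^sub>\<infinity>n. x n * cnj (y n))\<rparr>"

lemma l2_eq_range_coef: "l2 = range coef"
  by (rule type_definition.Rep_range[OF type_definition_ell2, symmetric])

lemma coef_Abs_ell2_coef [simp]: "Abs_ell2 (coef x) = x"
  by (rule coef_inverse)

lemma carrier_l2_space: "carrier l2_space = range coef"
  by (simp add: l2_space_def l2_eq_range_coef)

lemma coef_carrier [simp]: "coef x \<in> carrier l2_space"
  by (simp add: carrier_l2_space)

lemma add_l2_space [simp]: "coef x \<oplus>\<^bsub>l2_space\<^esub> coef y = coef (x + y)"
  by (auto simp: l2_space_def)

lemma zero_l2_space [simp]: "\<zero>\<^bsub>l2_space\<^esub> = coef 0"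
  by (auto simp: l2_space_def)

lemma smult_l2_space [simp]: "c \<odot>\<^bsub>l2_space\<^esub> coef x = coef (c *\<^sub>C x)"
  by (auto simp: l2_space_def)

lemma cinner_l2_space [simp]: "cinner l2_space (coef x) (coef y) = cin x y"
  by (simp add: l2_space_def cin_def)

lemma coef_eq_iff [simp]: "coef x = coef y \<longleftrightarrow> x = y"
  by (rule coef_inject)

lemma cring_complex_ring: "cring complex_ring"
proof (rule cringI)
  show "abelian_group complex_ring"
    by (rule abelian_groupI) (auto simp: complex_ring_def intro: exI[of _ "- x" for x])
  show "comm_monoid complex_ring"
    by (rule comm_monoidI) (auto simp: complex_ring_def)
qed (auto simp: complex_ring_def algebra_simps)

lemma abelian_group_l2_space: "abelian_group l2_space"
proof (rule abelian_groupI)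
  fix x assume "x \<in> carrier l2_space"
  then obtain a where "x = coef a"
    by (auto simp: carrier_l2_space)
  then show "\<exists>y\<in>carrier l2_space. y \<oplus>\<^bsub>l2_space\<^esub> x = \<zero>\<^bsub>l2_space\<^esub>"
    by (intro bexI[of _ "coef (- a)"]) auto
qed (auto simp: carrier_l2_space algebra_simps)

lemma module_l2_space: "Module.module complex_ring l2_space"
  by (rule moduleI[OF cring_complex_ring abelian_group_l2_space])
    (auto simp: carrier_l2_space complex_ring_def cscale_add_left)

interpretation l2: complex_inner_product_space l2_space
proof (intro complex_inner_product_space.intro module_l2_space complex_inner_product_space_axioms.intro)
  fix x y z :: "nat \<Rightarrow> complex" and c :: complex
  assume "x \<in> carrier l2_space" "y \<in> carrier l2_space"
  then obtain a b where ab: "x = coef a" "y = coef b"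
    by (auto simp: carrier_l2_space)
  show "cinner l2_space x y = cnj (cinner l2_space y x)"
    unfolding ab cinner_l2_space by (rule cin_commute)
  show "cinner l2_space (c \<odot>\<^bsub>l2_space\<^esub> x) y = c * cinner l2_space x y"
    by (simp add: ab)
  assume "z \<in> carrier l2_space"
  then obtain c where "z = coef c"
    by (auto simp: carrier_l2_space)
  then show "cinner l2_space (x \<oplus>\<^bsub>l2_space\<^esub> y) z = cinner l2_space x z + cinner l2_space y z"
    by (simp add: ab cin_add_left)
next
  fix x assume "x \<in> carrier l2_space" "x \<noteq> \<zero>\<^bsub>l2_space\<^esub>"
  then obtain a where "x = coef a" "a \<noteq> 0"
    by (auto simp: carrier_l2_space)
  then show "0 < Re (cinner l2_space x x)"
    by (simp add: cin_self)
qed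

lemma hnorm_l2_space [simp]: "hnorm l2_space (coef x) = norm x"
  by (simp add: hnorm_def cin_self)

lemma diff_l2_space [simp]: "coef x \<ominus>\<^bsub>l2_space\<^esub> coef y = coef (x - y)"
proof -
  have "\<ominus>\<^bsub>l2_space\<^esub> coef y = coef (- y)"
    by (rule l2.M.minus_equality) auto
  then show ?thesis
    by (simp add: a_minus_def)
qed

lemma hdist_l2_space [simp]: "hdist l2_space (coef x) (coef y) = dist x y"
  by (simp add: hdist_def dist_norm)

lemma complex_hilbert_space_l2_space: "complex_hilbert_space l2_space"
proof (unfold_locales)
  show "l2.metric.mcomplete"
    unfolding l2.metric.mcomplete_def
  proof (intro allI impI)
    fix \<sigma> assume s: "l2.metric.MCauchy \<sigma>"
    then have "range \<sigma> \<subseteq> carrier l2_space"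
      unfolding l2.metric.MCauchy_def by blast
    then have "\<forall>n. \<exists>x. \<sigma> n = coef x"
      unfolding carrier_l2_space by blast
    then obtain X where X: "\<And>n. \<sigma> n = coef (X n)"
      by metis
    have "Cauchy X"
    proof (rule metric_CauchyI)
      fix r :: real assume "0 < r"
      then obtain N where "\<And>m n. N \<le> m \<Longrightarrow> N \<le> n \<Longrightarrow> hdist l2_space (\<sigma> m) (\<sigma> n) < r"
        using s unfolding l2.metric.MCauchy_def by meson
      then show "\<exists>M. \<forall>m\<ge>M. \<forall>n\<ge>M. dist (X m) (X n) < r"
        by (auto simp: X)
    qed
    then obtain l where "X \<longlonglongrightarrow> l"
      using Cauchy_convergent convergent_def by blast
    then have "limitin l2.metric.mtopology \<sigma> (coef l) sequentially"
      unfolding l2.metric.limit_metric_sequentially X by (simp add: LIMSEQ_def)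
    then show "\<exists>x. limitin l2.metric.mtopology \<sigma> x sequentially"
      by blast
  qed
qed

lemma closure_of_l2_space: "htop l2_space closure_of (coef ` S) = coef ` closure S"
  unfolding l2.metric.metric_closure_of
proof (intro Set.set_eqI iffI)
  fix x assume "x \<in> {x \<in> carrier l2_space. \<forall>r>0. \<exists>y\<in>coef ` S. y \<in> l2.metric.mball x r}"
  then obtain a where a: "x = coef a" "\<And>r. r > 0 \<Longrightarrow> \<exists>y\<in>S. coef y \<in> l2.metric.mball (coef a) r"
    by (auto simp: carrier_l2_space)
  have "a \<in> closure S"
    unfolding closure_approachable using a(2) by (auto simp: dist_commute)
  then show "x \<in> coef ` closure S"
    using a(1) by blast
next
  fix x assume "x \<in> coef ` closure S"
  then show "x \<in> {x \<in> carrier l2_space. \<forall>r>0. \<exists>y\<in>coef ` S. y \<in> l2.metric.mball x r}"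
    by (auto simp: closure_approachable dist_commute)
qed

lemma complex_rational_approx:
  assumes "0 < r"
  shows "\<exists>a b. cmod (z - Complex (of_rat a) (of_rat b)) < r"
proof -
  obtain a where a: "Re z - r / 2 < of_rat a" "of_rat a < Re z"
    using of_rat_dense[of "Re z - r / 2" "Re z"] assms by auto
  obtain b where b: "Im z - r / 2 < of_rat b" "of_rat b < Im z"
    using of_rat_dense[of "Im z - r / 2" "Im z"] assms by auto
  have "cmod (z - Complex (of_rat a) (of_rat b)) \<le> \<bar>Re z - of_rat a\<bar> + \<bar>Im z - of_rat b\<bar>"
    using cmod_le[of "z - Complex (of_rat a) (of_rat b)"] by simp
  also have "\<dots> < r"
    using a b by linarith
  finally show ?thesis
    by blast
qed

text \<open>The finitely supported sequences with coefficients in \<open>\<rat> + i \<rat>\<close>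
  are dense: their closure is a complex subspace and contains the basis.\<close>

lemma separable_l2_space: "separable_space (htop l2_space)"
proof -
  define Q where "Q = range (\<lambda>(a, b). Complex (of_rat a) (of_rat b))"
  define C where "C N = {x. (\<forall>n. coef x n \<in> Q) \<and> (\<forall>n\<ge>N. coef x n = 0)}" for N :: nat
  define D where "D = (\<Union>N. C N)"
  have Q0: "0 \<in> Q" "1 \<in> Q"
    unfolding Q_def by (rule image_eqI[of _ _ "(0, 0)"], simp_all add: complex_eq_iff)
      (rule image_eqI[of _ _ "(1, 0)"], simp_all add: complex_eq_iff)
  have Qadd: "x + y \<in> Q" if xy: "x \<in> Q" "y \<in> Q" for x y
  proof -
    obtain a b c d where "x = Complex (of_rat a) (of_rat b)" "y = Complex (of_rat c) (of_rat d)"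
      using xy by (auto simp: Q_def)
    then have "x + y = Complex (of_rat (a + c)) (of_rat (b + d))"
      by (simp add: complex_eq_iff of_rat_add)
    then show ?thesis
      unfolding Q_def by (intro image_eqI[of _ _ "(a + c, b + d)"]) auto
  qed
  have Qmult: "x * y \<in> Q" if xy: "x \<in> Q" "y \<in> Q" for x y
  proof -
    obtain a b c d where "x = Complex (of_rat a) (of_rat b)" "y = Complex (of_rat c) (of_rat d)"
      using xy by (auto simp: Q_def)
    then have "x * y = Complex (of_rat (a * c - b * d)) (of_rat (a * d + b * c))"
      by (simp add: complex_eq_iff of_rat_add of_rat_diff of_rat_mult)
    then show ?thesis
      unfolding Q_def by (intro image_eqI[of _ _ "(a * c - b * d, a * d + b * c)"]) auto
  qed
  have "countable Q"
    by (simp add: Q_def)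
  have "countable (C N)" for N
  proof (rule countable_image_inj_on)
    show "countable ((\<lambda>x. map (coef x) [0..<N]) ` C N)"
      by (rule countable_subset[of _ "lists Q"]) (use \<open>countable Q\<close> in \<open>auto simp: C_def\<close>)
    show "inj_on (\<lambda>x. map (coef x) [0..<N]) (C N)"
    proof (rule inj_onI)
      fix x y assume xy: "x \<in> C N" "y \<in> C N" "map (coef x) [0..<N] = map (coef y) [0..<N]"
      show "x = y"
      proof (rule ell2_eqI)
        fix n
        show "coef x n = coef y n"
          using xy by (cases "n < N") (auto simp: C_def)
      qed
    qed
  qed
  then have cD: "countable D"
    unfolding D_def by simp
  have Dadd: "x + y \<in> D" if xy: "x \<in> D" "y \<in> D" for x y
  proof -
    obtain M N where "x \<in> C M" "y \<in> C N"
      using xy by (auto simp: D_def)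
    then have "x + y \<in> C (max M N)"
      using Qadd by (simp add: C_def)
    then show ?thesis
      unfolding D_def by blast
  qed
  have Dscale: "c *\<^sub>C x \<in> D" if "c \<in> Q" "x \<in> D" for c x
    using that Qmult by (auto simp: D_def C_def)
  have "closure D = UNIV"
  proof (rule delta_total)
    have add: "x + y \<in> closure D" if "x \<in> closure D" "y \<in> closure D" for x y
      by (rule closure_closed_under_add[OF _ that]) (use Dadd in blast)
    have sc: "c *\<^sub>C x \<in> closure D" if x: "x \<in> D" for c x
      unfolding closure_approachable
    proof (intro allI impI)
      fix r :: real assume r: "0 < r"
      have "0 < r / (norm x + 1)"
        using r by (simp add: add_nonneg_pos)
      then obtain a b where ab: "cmod (c - Complex (of_rat a) (of_rat b)) < r / (norm x + 1)"
        using complex_rational_approx by blast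
      define q where "q = Complex (of_rat a) (of_rat b)"
      have "dist (q *\<^sub>C x) (c *\<^sub>C x) = cmod (c - q) * norm x"
        unfolding dist_norm norm_cscale[symmetric] by (subst norm_minus_commute) (simp add: cscale_diff_left)
      also have "\<dots> \<le> cmod (c - q) * (norm x + 1)"
        by (intro mult_left_mono) auto
      also have "\<dots> < r"
        using ab by (simp add: q_def pos_less_divide_eq add_nonneg_pos)
      finally have "dist (q *\<^sub>C x) (c *\<^sub>C x) < r" .
      then show "\<exists>y\<in>D. dist y (c *\<^sub>C x) < r"
      proof -
        assume d: "dist (q *\<^sub>C x) (c *\<^sub>C x) < r"
        have "q \<in> Q"
          unfolding q_def Q_def by (rule range_eqI[of _ _ "(a, b)"]) simp
        then show ?thesis
          using Dscale x d by blast
      qed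
    qed
    have "c *\<^sub>C x \<in> closure D" if "x \<in> closure D" for c x
    proof -
      have "(\<lambda>x. c *\<^sub>C x) ` closure D \<subseteq> closure ((\<lambda>x. c *\<^sub>C x) ` D)"
        by (rule closure_bounded_linear_image_subset[OF bounded_linear_cscale])
      also have "\<dots> \<subseteq> closure D"
        using sc by (intro closure_minimal) auto
      finally show ?thesis
        using that by blast
    qed
    moreover have "0 \<in> D"
      using Q0 by (auto simp: D_def C_def)
    ultimately show "csubspace (closure D)"
      using add closure_subset[of D] by (auto simp: csubspace_def)
    have "delta k \<in> C (Suc k)" for k
      using Q0 by (simp add: C_def)
    then have "delta k \<in> D" for k
      unfolding D_def by blast
    then show "delta k \<in> closure D" for k
      using closure_subset[of D] by blast
  qed simp
  then have "htop l2_space closure_of (coef ` D) = topspace (htop l2_space)"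
    unfolding closure_of_l2_space l2.metric.topspace_mtopology by (simp add: carrier_l2_space)
  moreover have "coef ` D \<subseteq> topspace (htop l2_space)"
    unfolding l2.metric.topspace_mtopology by auto
  ultimately show ?thesis
    unfolding separable_space_def using cD by blast
qed

lemma submodule_l2_space:
  "submodule V complex_ring l2_space \<longleftrightarrow> (\<exists>W. csubspace W \<and> V = coef ` W)"
proof
  assume V: "submodule V complex_ring l2_space"
  then interpret submodule V complex_ring l2_space .
  have V_sub: "V \<subseteq> range coef"
    using subset by (simp add: carrier_l2_space)
  have "csubspace (coef -` V)"
    unfolding csubspace_def
  proof (intro conjI ballI allI)
    show "0 \<in> coef -` V"
      using one_closed by simp
    show "x + y \<in> coef -` V" if "x \<in> coef -` V" "y \<in> coef -` V" for x y
      using m_closed[of "coef x" "coef y"] that by simp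
    show "c *\<^sub>C x \<in> coef -` V" if "x \<in> coef -` V" for c x
      using smult_closed[of c "coef x"] that by (simp add: complex_ring_def)
  qed
  moreover have "V = coef ` (coef -` V)"
    using V_sub by blast
  ultimately show "\<exists>W. csubspace W \<and> V = coef ` W"
    by blast
next
  assume "\<exists>W. csubspace W \<and> V = coef ` W"
  then obtain W where W: "csubspace W" "V = coef ` W"
    by blast
  have "\<ominus>\<^bsub>l2_space\<^esub> coef y = coef (- y)" for y
    by (rule l2.M.minus_equality) auto
  then show "submodule V complex_ring l2_space"
    using csubspace_0[OF W(1)] csubspace_add[OF W(1)] csubspace_cscale[OF W(1)]
    by (intro l2.submoduleI) (auto simp: W(2) cscale_minus1)
qed

lemma closed_lin_span_l2_space: "closed_lin_span l2_space (coef ` X) = coef ` closure (cspan X)"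
proof -
  have "\<Inter>{V. submodule V complex_ring l2_space \<and> coef ` X \<subseteq> V} = coef ` cspan X"
  proof
    show "\<Inter>{V. submodule V complex_ring l2_space \<and> coef ` X \<subseteq> V} \<subseteq> coef ` cspan X"
      using csubspace_cspan[of X] cspan_superset[of X] unfolding submodule_l2_space by blast
    show "coef ` cspan X \<subseteq> \<Inter>{V. submodule V complex_ring l2_space \<and> coef ` X \<subseteq> V}"
    proof (intro Inter_greatest)
      fix V assume "V \<in> {V. submodule V complex_ring l2_space \<and> coef ` X \<subseteq> V}"
      then obtain W where W: "csubspace W" "V = coef ` W" "coef ` X \<subseteq> coef ` W"
        by (auto simp: submodule_l2_space)
      then have "X \<subseteq> W"
        by auto
      then have "cspan X \<subseteq> W"
        using W(1) by (rule cspan_minimal)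
      then show "coef ` cspan X \<subseteq> V"
        using W(2) by blast
    qed
  qed
  then show ?thesis
    unfolding closed_lin_span_def by (simp add: closure_of_l2_space)
qed

text \<open>The inverse of the passage from operators with a carrier to operators on the type
  \<open>ell2\<close>.\<close>

definition lift_op :: "(ell2 \<Rightarrow> ell2) \<Rightarrow> (nat \<Rightarrow> complex) \<Rightarrow> (nat \<Rightarrow> complex)" where
  "lift_op T = (\<lambda>x\<in>carrier l2_space. coef (T (Abs_ell2 x)))"

lemma lift_op_coef [simp]: "lift_op T (coef x) = coef (T x)"
  by (simp add: lift_op_def)

lemma lift_op_eq_iff [simp]: "lift_op S = lift_op T \<longleftrightarrow> S = T"
proof
  assume e: "lift_op S = lift_op T"
  show "S = T"
  proof
    fix x
    have "coef (S x) = coef (T x)"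
      using fun_cong[OF e, of "coef x"] by simp
    then show "S x = T x"
      by simp
  qed
qed simp

lemma inj_lift_op: "inj lift_op"
  by (rule injI) simp

lemma lift_op_mem_iff: "lift_op T \<in> lift_op ` S \<longleftrightarrow> T \<in> S"
  by (auto simp: image_iff)

lemma bounded_op_l2_space: "bounded_op l2_space l2_space = lift_op ` {T. bclinear T}"
proof (intro Set.set_eqI iffI)
  fix T assume T: "T \<in> bounded_op l2_space l2_space"
  define S where "S x = Abs_ell2 (T (coef x))" for x
  have TS: "T (coef x) = coef (S x)" for x
  proof -
    have "T (coef x) \<in> range coef"
      using T PiE_mem[of T "carrier l2_space" "\<lambda>_. carrier l2_space" "coef x"]
      by (auto simp: bounded_op_def carrier_l2_space)
    then show ?thesis
      by (auto simp: S_def)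
  qed
  have "T (coef x \<oplus>\<^bsub>l2_space\<^esub> coef y) = T (coef x) \<oplus>\<^bsub>l2_space\<^esub> T (coef y)"
    "T (c \<odot>\<^bsub>l2_space\<^esub> coef x) = c \<odot>\<^bsub>l2_space\<^esub> T (coef x)" for x y c
    using T coef_carrier unfolding bounded_op_def by blast+
  then have lin: "S (x + y) = S x + S y" "S (c *\<^sub>C x) = c *\<^sub>C S x" for x y c
    by (simp_all add: TS)
  obtain C where "\<forall>x\<in>carrier l2_space. hnorm l2_space (T x) \<le> C * hnorm l2_space x"
    using T unfolding bounded_op_def by blast
  then have "norm (S x) \<le> C * norm x" for x
    using coef_carrier[of x] by (metis TS hnorm_l2_space)
  then have "bclinear S"
    using lin by (intro bclinearI)
  moreover have "T = lift_op S"
  proof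
    fix x
    show "T x = lift_op S x"
    proof (cases "x \<in> carrier l2_space")
      case True
      then show ?thesis
        by (auto simp: carrier_l2_space TS)
    next
      case False
      then show ?thesis
        using T by (auto simp: lift_op_def bounded_op_def PiE_def extensional_def)
    qed
  qed
  ultimately show "T \<in> lift_op ` {T. bclinear T}"
    by blast
next
  fix T assume "T \<in> lift_op ` {T. bclinear T}"
  then obtain S where S: "T = lift_op S" "bclinear S"
    by blast
  obtain C where "\<And>x. norm (S x) \<le> C * norm x"
    using bclinear_bound[OF S(2)] by blast
  then show "T \<in> bounded_op l2_space l2_space"
    unfolding bounded_op_def S(1)
    by (auto simp: carrier_l2_space bclinear_simps[OF S(2)] lift_op_def)
qed

lemma compose_lift_op [simp]: "compose (carrier l2_space) (lift_op S) (lift_op T) = lift_op (\<lambda>x. S (T x))"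
  by (auto simp: compose_def lift_op_def fun_eq_iff carrier_l2_space)

lemma is_adjoint_lift_op:
  "is_adjoint l2_space l2_space (lift_op S) (lift_op T) \<longleftrightarrow>
     bclinear S \<and> bclinear T \<and> (\<forall>x y. cin (S x) y = cin x (T y))"
  unfolding is_adjoint_def bounded_op_l2_space lift_op_mem_iff by (auto simp: carrier_l2_space)

lemma projs_l2_space: "projs l2_space = lift_op ` {P. is_proj P}"
proof -
  have "lift_op P \<in> projs l2_space \<longleftrightarrow> is_proj P" for P
    unfolding projs_def mem_Collect_eq bounded_op_l2_space lift_op_mem_iff is_adjoint_lift_op
      compose_lift_op lift_op_eq_iff is_proj_def
    by (auto simp: fun_eq_iff)
  moreover have "projs l2_space \<subseteq> range lift_op"
    by (auto simp: projs_def bounded_op_l2_space)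
  ultimately show ?thesis
    by blast
qed

lemma lift_op_range: "lift_op P ` carrier l2_space = coef ` range P"
  by (auto simp: carrier_l2_space image_iff)

lemma proj_perp_lift_op: "proj_perp l2_space (lift_op P) = lift_op (\<lambda>x. x - P x)"
  by (auto simp: proj_perp_def lift_op_def fun_eq_iff carrier_l2_space)

lemma image_coef_eq_iff [simp]: "coef ` X = coef ` Y \<longleftrightarrow> X = Y"
  by (rule inj_image_eq_iff) (simp add: inj_def)

lemma proj_onto_l2_space:
  assumes "closed V" "csubspace V"
  shows "proj_onto l2_space (coef ` V) = lift_op (orth_proj V)"
  unfolding proj_onto_def projs_l2_space
proof (rule the_equality)
  show "lift_op (orth_proj V) \<in> lift_op ` {P. is_proj P} \<and> lift_op (orth_proj V) ` carrier l2_space = coef ` V"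
    using is_proj_orth_proj[OF assms] by (simp add: lift_op_range range_orth_proj[OF assms])
  fix P assume P: "P \<in> lift_op ` {P. is_proj P} \<and> P ` carrier l2_space = coef ` V"
  then obtain P' where P': "P = lift_op P'" "is_proj P'" "range P' = V"
    by (auto simp: lift_op_range)
  then show "P = lift_op (orth_proj V)"
    using is_proj_unique[OF P'(2) is_proj_orth_proj[OF assms]] by (simp add: range_orth_proj[OF assms])
qed

text \<open>The range of the projection to which the map of \<open>U\<close> sends
  \<open>P\<close>.\<close>

definition image_span :: "(ell2 \<Rightarrow> ell2) set \<Rightarrow> (ell2 \<Rightarrow> ell2) \<Rightarrow> ell2 set" where
  "image_span U P = closure (cspan {S x | S x. S \<in> U \<and> x \<in> range P})"

lemma image_span_closed: "closed (image_span U P)" "csubspace (image_span U P)"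
  by (simp_all add: image_span_def csubspace_closure_cspan)

lemma Map_l2_space:
  assumes "is_proj P"
  shows "Map l2_space l2_space (lift_op ` U) (lift_op P) = lift_op (orth_proj (image_span U P))"
proof -
  have "{S x | S x. S \<in> lift_op ` U \<and> x \<in> lift_op P ` carrier l2_space}
      = coef ` {S x | S x. S \<in> U \<and> x \<in> range P}"
    unfolding lift_op_range
  proof (intro Set.set_eqI iffI)
    fix z assume "z \<in> {S x | S x. S \<in> lift_op ` U \<and> x \<in> coef ` range P}"
    then obtain S x where "S \<in> lift_op ` U" "x \<in> coef ` range P" "z = S x"
      by blast
    then obtain S' y where "S' \<in> U" "z = coef (S' (P y))"
      by auto
    then show "z \<in> coef ` {S x | S x. S \<in> U \<and> x \<in> range P}"
      by blast
  next
    fix z assume "z \<in> coef ` {S x | S x. S \<in> U \<and> x \<in> range P}"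
    then obtain S x where "S \<in> U" "x \<in> range P" "z = lift_op S (coef x)"
      by auto
    then show "z \<in> {S x | S x. S \<in> lift_op ` U \<and> x \<in> coef ` range P}"
      by blast
  qed
  then show ?thesis
    using assms image_span_closed[of U P] unfolding Map_def image_span_def
    by (simp add: projs_l2_space closed_lin_span_l2_space proj_onto_l2_space)
qed

lemma zero_op_space: "\<zero>\<^bsub>op_space l2_space l2_space\<^esub> = lift_op (\<lambda>x. 0)"
  by (auto simp: op_space_def lift_op_def)

lemma add_op_space [simp]: "lift_op S \<oplus>\<^bsub>op_space l2_space l2_space\<^esub> lift_op T = lift_op (\<lambda>x. S x + T x)"
  by (auto simp: op_space_def lift_op_def fun_eq_iff carrier_l2_space)

lemma smult_op_space [simp]: "c \<odot>\<^bsub>op_space l2_space l2_space\<^esub> lift_op T = lift_op (\<lambda>x. c *\<^sub>C T x)"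
  by (auto simp: op_space_def lift_op_def fun_eq_iff carrier_l2_space)

lemma carrier_op_space: "carrier (op_space l2_space l2_space) = lift_op ` {T. bclinear T}"
  by (simp add: op_space_def bounded_op_l2_space)

lemma module_op_space: "Module.module complex_ring (op_space l2_space l2_space)"
proof (rule moduleI[OF cring_complex_ring])
  show "abelian_group (op_space l2_space l2_space)"
  proof (rule abelian_groupI)
    fix T assume "T \<in> carrier (op_space l2_space l2_space)"
    then obtain S where S: "T = lift_op S" "bclinear S"
      by (auto simp: carrier_op_space)
    then show "\<exists>y\<in>carrier (op_space l2_space l2_space). y \<oplus>\<^bsub>op_space l2_space l2_space\<^esub> T = \<zero>\<^bsub>op_space l2_space l2_space\<^esub>"
      using bclinear_cscale[OF S(2), of "- 1"]
      by (intro bexI[of _ "lift_op (\<lambda>x. (- 1) *\<^sub>C S x)"])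
        (auto simp: zero_op_space carrier_op_space cscale_minus1[symmetric])
  qed (auto simp: carrier_op_space zero_op_space bclinear_add bclinear_0 add_ac)
qed (auto simp: carrier_op_space complex_ring_def bclinear_cscale cscale_add_left)

lemma submodule_op_space:
  assumes "\<And>T. T \<in> D \<Longrightarrow> bclinear T" "(\<lambda>x. 0) \<in> D" "\<And>S T. S \<in> D \<Longrightarrow> T \<in> D \<Longrightarrow> (\<lambda>x. S x + T x) \<in> D"
    "\<And>c T. T \<in> D \<Longrightarrow> (\<lambda>x. c *\<^sub>C T x) \<in> D"
  shows "submodule (lift_op ` D) complex_ring (op_space l2_space l2_space)"
proof -
  interpret m: Module.module complex_ring "op_space l2_space l2_space"
    by (rule module_op_space)
  have inv: "\<ominus>\<^bsub>op_space l2_space l2_space\<^esub> lift_op T = lift_op (\<lambda>x. (- 1) *\<^sub>C T x)" if "T \<in> D" for T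
  proof (rule m.M.minus_equality)
    show "lift_op (\<lambda>x. (- 1) *\<^sub>C T x) \<oplus>\<^bsub>op_space l2_space l2_space\<^esub> lift_op T = \<zero>\<^bsub>op_space l2_space l2_space\<^esub>"
      by (simp add: zero_op_space flip: cscale_minus1)
  qed (use assms that in \<open>auto simp: carrier_op_space\<close>)
  show ?thesis
  proof (rule m.submoduleI)
    show "lift_op ` D \<subseteq> carrier (op_space l2_space l2_space)"
      using assms(1) by (auto simp: carrier_op_space)
    show "\<zero>\<^bsub>op_space l2_space l2_space\<^esub> \<in> lift_op ` D"
      using assms(2) by (auto simp: zero_op_space)
    show "\<ominus>\<^bsub>op_space l2_space l2_space\<^esub> a \<in> lift_op ` D" if "a \<in> lift_op ` D" for a
      using that inv assms(4) by auto
    show "a \<oplus>\<^bsub>op_space l2_space l2_space\<^esub> c \<in> lift_op ` D" if "a \<in> lift_op ` D" "c \<in> lift_op ` D" for a c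
      using that assms(3) by auto
    show "a \<odot>\<^bsub>op_space l2_space l2_space\<^esub> c \<in> lift_op ` D" if "c \<in> lift_op ` D" for a c
      using that assms(4) by auto
  qed
qed

section \<open>Masa, projection lattice, reflexivity and weak* closed sets\<close>

text \<open>An abelian algebra that contains the shifts lies in their commutant.\<close>

lemma masa_conv_ops: "masa l2_space (lift_op ` conv_ops)"
  unfolding masa_def
proof (intro conjI allI impI)
  have sub: "submodule (lift_op ` conv_ops) complex_ring (op_space l2_space l2_space)"
    by (intro submodule_op_space conv_ops_bclinear conv_ops_0 conv_ops_add conv_ops_cscale)
  have "\<exists>B\<in>lift_op ` conv_ops. is_adjoint l2_space l2_space (lift_op A) B" if "A \<in> conv_ops" for A
    using that adj_conv_ops[OF that] conv_ops_bclinear cin_adj[OF that] by (auto simp: is_adjoint_lift_op)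
  then show "abelian_selfadjoint_algebra l2_space (lift_op ` conv_ops)"
    unfolding abelian_selfadjoint_algebra_def using sub
    by (auto simp: lift_op_mem_iff conv_ops_comp fun_eq_iff conv_ops_commute)
  fix D' assume D': "abelian_selfadjoint_algebra l2_space D' \<and> lift_op ` conv_ops \<subseteq> D'"
  have "D' \<subseteq> lift_op ` conv_ops"
  proof
    fix A assume A: "A \<in> D'"
    have "submodule D' complex_ring (op_space l2_space l2_space)"
      using D' by (simp add: abelian_selfadjoint_algebra_def)
    then have "D' \<subseteq> carrier (op_space l2_space l2_space)"
      using subgroup.subset[OF submodule.axioms(1)] by fastforce
    then obtain T where T: "A = lift_op T" "bclinear T"
      using A by (auto simp: carrier_op_space)
    have "T (shift k x) = shift k (T x)" for k x
    proof -
      have "lift_op (shift k) \<in> D'"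
        using D' shift_conv_ops by blast
      then have "compose (carrier l2_space) A (lift_op (shift k)) = compose (carrier l2_space) (lift_op (shift k)) A"
        using D' A unfolding abelian_selfadjoint_algebra_def by blast
      then show ?thesis
        unfolding T compose_lift_op lift_op_eq_iff by (rule fun_cong)
    qed
    then show "A \<in> lift_op ` conv_ops"
      using T by (simp add: conv_ops_def)
  qed
  then show "D' = lift_op ` conv_ops"
    using D' by blast
qed

lemma carrier_proj_lattice: "carrier (proj_lattice l2_space) = lift_op ` {P. is_proj P}"
  by (simp add: proj_lattice_def projs_l2_space)

lemma le_proj_lattice:
  "lift_op P \<sqsubseteq>\<^bsub>proj_lattice l2_space\<^esub> lift_op Q \<longleftrightarrow> range P \<subseteq> range Q"
  by (simp add: proj_lattice_def lift_op_range inj_image_subset_iff inj_def)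

lemma partial_order_proj_lattice: "partial_order (proj_lattice l2_space)"
proof
  show "x \<sqsubseteq>\<^bsub>proj_lattice l2_space\<^esub> y \<Longrightarrow> y \<sqsubseteq>\<^bsub>proj_lattice l2_space\<^esub> x \<Longrightarrow> x .=\<^bsub>proj_lattice l2_space\<^esub> y"
    if "x \<in> carrier (proj_lattice l2_space)" "y \<in> carrier (proj_lattice l2_space)" for x y
    using that is_proj_unique by (auto simp: carrier_proj_lattice le_proj_lattice) (auto simp: proj_lattice_def)
qed (auto simp: proj_lattice_def)

definition sup_proj :: "(ell2 \<Rightarrow> ell2) set \<Rightarrow> ell2 \<Rightarrow> ell2" where
  "sup_proj \<P> = orth_proj (closure (cspan (\<Union>P\<in>\<P>. range P)))"

lemma is_proj_sup_proj: "is_proj (sup_proj \<P>)"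
  and range_sup_proj: "range (sup_proj \<P>) = closure (cspan (\<Union>P\<in>\<P>. range P))"
  by (simp_all add: sup_proj_def is_proj_orth_proj range_orth_proj csubspace_closure_cspan)

lemma least_sup_proj:
  assumes "\<And>P. P \<in> \<P> \<Longrightarrow> is_proj P"
  shows "least (proj_lattice l2_space) (lift_op (sup_proj \<P>)) (Upper (proj_lattice l2_space) (lift_op ` \<P>))"
proof (rule least_UpperI)
  fix x assume "x \<in> lift_op ` \<P>"
  then obtain P where P: "P \<in> \<P>" "x = lift_op P"
    by blast
  then have "range P \<subseteq> closure (cspan (\<Union>P\<in>\<P>. range P))"
    using closure_cspan_superset[of "\<Union>P\<in>\<P>. range P"] by blast
  then show "x \<sqsubseteq>\<^bsub>proj_lattice l2_space\<^esub> lift_op (sup_proj \<P>)"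
    by (simp add: P le_proj_lattice range_sup_proj)
next
  fix y assume y: "y \<in> Upper (proj_lattice l2_space) (lift_op ` \<P>)"
  then have "y \<in> carrier (proj_lattice l2_space)"
    by (simp add: Upper_def)
  then obtain Q where Q: "y = lift_op Q" "is_proj Q"
    by (auto simp: carrier_proj_lattice)
  have "range P \<subseteq> range Q" if "P \<in> \<P>" for P
  proof -
    have "lift_op P \<sqsubseteq>\<^bsub>proj_lattice l2_space\<^esub> y"
      using y that assms[OF that] by (auto simp: Upper_def carrier_proj_lattice)
    then show ?thesis
      by (simp add: Q le_proj_lattice)
  qed
  then have "closure (cspan (\<Union>P\<in>\<P>. range P)) \<subseteq> range Q"
    by (intro closure_cspan_minimal is_proj_range_closed[OF Q(2)]) blast
  then show "lift_op (sup_proj \<P>) \<sqsubseteq>\<^bsub>proj_lattice l2_space\<^esub> y"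
    by (simp add: Q le_proj_lattice range_sup_proj)
qed (use assms is_proj_sup_proj in \<open>auto simp: carrier_proj_lattice\<close>)

lemma subset_carrier_proj_lattice:
  assumes "A \<subseteq> carrier (proj_lattice l2_space)"
  obtains \<P> where "A = lift_op ` \<P>" "\<And>P. P \<in> \<P> \<Longrightarrow> is_proj P"
proof
  show "A = lift_op ` {P. is_proj P \<and> lift_op P \<in> A}"
    using assms by (auto simp: carrier_proj_lattice)
qed simp

lemma complete_lattice_proj_lattice: "complete_lattice (proj_lattice l2_space)"
proof (rule partial_order.complete_latticeI[OF partial_order_proj_lattice])
  fix A assume A: "A \<subseteq> carrier (proj_lattice l2_space)"
  obtain \<P> where P: "A = lift_op ` \<P>" "\<And>P. P \<in> \<P> \<Longrightarrow> is_proj P"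
    using subset_carrier_proj_lattice[OF A] by blast
  show "\<exists>s. least (proj_lattice l2_space) s (Upper (proj_lattice l2_space) A)"
    using least_sup_proj[OF P(2)] P(1) by blast
  define V where "V = (\<Inter>P\<in>\<P>. range P)"
  have sub: "csubspace (range P)" if "P \<in> \<P>" for P
    by (rule is_proj_range_closed[OF P(2)[OF that]])
  have V: "closed V" "csubspace V"
  proof -
    show "closed V"
      unfolding V_def by (rule closed_INT) (simp add: is_proj_range_closed(1)[OF P(2)])
    show "csubspace V"
      unfolding csubspace_def
    proof (intro conjI ballI allI)
      show "0 \<in> V"
        unfolding V_def by (rule INT_I) (rule csubspace_0[OF sub])
      show "x + y \<in> V" if "x \<in> V" "y \<in> V" for x y
        using that unfolding V_def INT_iff by (blast intro: csubspace_add[OF sub])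
      show "c *\<^sub>C x \<in> V" if "x \<in> V" for c x
        using that unfolding V_def INT_iff by (blast intro: csubspace_cscale[OF sub])
    qed
  qed
  have "greatest (proj_lattice l2_space) (lift_op (orth_proj V)) (Lower (proj_lattice l2_space) A)"
  proof (rule greatest_LowerI)
    show "lift_op (orth_proj V) \<sqsubseteq>\<^bsub>proj_lattice l2_space\<^esub> x" if "x \<in> A" for x
      using that by (auto simp: P(1) le_proj_lattice range_orth_proj[OF V]) (auto simp: V_def)
    show "lift_op (orth_proj V) \<in> carrier (proj_lattice l2_space)"
      using is_proj_orth_proj[OF V] by (simp add: carrier_proj_lattice)
    fix y assume y: "y \<in> Lower (proj_lattice l2_space) A"
    then have "y \<in> carrier (proj_lattice l2_space)"
      by (simp add: Lower_def)
    then obtain Q where Q: "y = lift_op Q" "is_proj Q"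
      by (auto simp: carrier_proj_lattice)
    have "range Q \<subseteq> range P" if "P \<in> \<P>" for P
    proof -
      have "y \<sqsubseteq>\<^bsub>proj_lattice l2_space\<^esub> lift_op P"
        using y that P(2)[OF that] by (auto simp: Lower_def carrier_proj_lattice P(1))
      then show ?thesis
        by (simp add: Q le_proj_lattice)
    qed
    then show "y \<sqsubseteq>\<^bsub>proj_lattice l2_space\<^esub> lift_op (orth_proj V)"
      unfolding Q le_proj_lattice range_orth_proj[OF V] by (auto simp: V_def)
  qed (rule A)
  then show "\<exists>i. greatest (proj_lattice l2_space) i (Lower (proj_lattice l2_space) A)"
    by blast
qed

lemma sup_proj_lattice:
  assumes "\<And>P. P \<in> \<P> \<Longrightarrow> is_proj P"
  shows "\<Squnion>\<^bsub>proj_lattice l2_space\<^esub> (lift_op ` \<P>) = lift_op (sup_proj \<P>)"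
  unfolding sup_def
proof (rule some_equality)
  show l: "least (proj_lattice l2_space) (lift_op (sup_proj \<P>)) (Upper (proj_lattice l2_space) (lift_op ` \<P>))"
    by (rule least_sup_proj[OF assms])
  show "s = lift_op (sup_proj \<P>)"
    if "least (proj_lattice l2_space) s (Upper (proj_lattice l2_space) (lift_op ` \<P>))" for s
    by (rule partial_order.least_unique[OF partial_order_proj_lattice that l])
qed

lemma image_span_mem: "S \<in> U \<Longrightarrow> S (P x) \<in> image_span U P"
  unfolding image_span_def using closure_cspan_superset[of "{S x | S x. S \<in> U \<and> x \<in> range P}"] by blast

text \<open>For a member \<open>S\<close> of \<open>U\<close>, the vectors that \<open>S\<close>
  sends into a closed subspace \<open>Z\<close> form a closed subspace, so it is enough to test them
  on the union of the ranges.\<close>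

lemma sup_pres_Map:
  assumes U: "\<And>T. T \<in> U \<Longrightarrow> bclinear T"
  shows "sup_pres (proj_lattice l2_space) (proj_lattice l2_space) (Map l2_space l2_space (lift_op ` U))"
  unfolding sup_pres_def
proof (intro conjI allI impI complete_lattice_proj_lattice)
  fix A assume A: "A \<subseteq> carrier (proj_lattice l2_space)"
  obtain \<P> where P: "A = lift_op ` \<P>" "\<And>P. P \<in> \<P> \<Longrightarrow> is_proj P"
    using subset_carrier_proj_lattice[OF A] by blast
  define \<Q> where "\<Q> = (\<lambda>P. orth_proj (image_span U P)) ` \<P>"
  have Q: "is_proj Q" if "Q \<in> \<Q>" for Q
    using that is_proj_orth_proj[OF image_span_closed] by (auto simp: \<Q>_def)
  have img: "Map l2_space l2_space (lift_op ` U) ` A = lift_op ` \<Q>"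
    unfolding P(1) \<Q>_def image_image by (intro image_cong refl Map_l2_space P(2))
  define Z where "Z = closure (cspan (\<Union>Q\<in>\<Q>. range Q))"
  have Z: "closed Z" "csubspace Z"
    by (simp_all add: Z_def csubspace_closure_cspan)
  have "image_span U (sup_proj \<P>) = Z"
  proof
    show "Z \<subseteq> image_span U (sup_proj \<P>)"
      unfolding Z_def
    proof (rule closure_cspan_minimal[OF _ image_span_closed(2,1)], rule UN_least)
      fix Q assume "Q \<in> \<Q>"
      then obtain P where P': "P \<in> \<P>" "range Q = image_span U P"
        by (auto simp: \<Q>_def range_orth_proj[OF image_span_closed])
      have "range P \<subseteq> range (sup_proj \<P>)"
        unfolding range_sup_proj using P'(1) closure_cspan_superset[of "\<Union>P\<in>\<P>. range P"] by blast
      then have "{S x | S x. S \<in> U \<and> x \<in> range P} \<subseteq> {S x | S x. S \<in> U \<and> x \<in> range (sup_proj \<P>)}"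
        by blast
      also have "\<dots> \<subseteq> image_span U (sup_proj \<P>)"
        unfolding image_span_def by (rule closure_cspan_superset)
      finally show "range Q \<subseteq> image_span U (sup_proj \<P>)"
        unfolding P'(2) image_span_def[of U P] by (rule closure_cspan_minimal[OF _ image_span_closed(2,1)])
    qed
    have "S x \<in> Z" if S: "S \<in> U" and x: "x \<in> range (sup_proj \<P>)" for S x
    proof -
      have cl: "closed {x. S x \<in> Z}" "csubspace {x. S x \<in> Z}"
        using continuous_closed_vimage[OF Z(1), of S] bclinear_continuous[OF U[OF S], of UNIV] Z(2)
        by (auto simp: vimage_def continuous_on_eq_continuous_at csubspace_def bclinear_simps[OF U[OF S]])
      have "(\<Union>P\<in>\<P>. range P) \<subseteq> {x. S x \<in> Z}"
      proof
        fix y assume "y \<in> (\<Union>P\<in>\<P>. range P)"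
        then obtain P where P': "P \<in> \<P>" "y \<in> range P"
          by blast
        then have "S y \<in> image_span U P"
          using image_span_mem[OF S] by blast
        also have "image_span U P \<subseteq> Z"
        proof -
          have "orth_proj (image_span U P) \<in> \<Q>"
            by (simp add: \<Q>_def P'(1))
          then have "range (orth_proj (image_span U P)) \<subseteq> Z"
            unfolding Z_def using closure_cspan_superset[of "\<Union>Q\<in>\<Q>. range Q"] by blast
          then show ?thesis
            by (simp only: range_orth_proj[OF image_span_closed])
        qed
        finally show "y \<in> {x. S x \<in> Z}"
          by simp
      qed
      from closure_cspan_minimal[OF this cl(2,1)] show ?thesis
        using x unfolding range_sup_proj by blast
    qed
    then show "image_span U (sup_proj \<P>) \<subseteq> Z"
      unfolding image_span_def by (intro closure_cspan_minimal Z) blast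
  qed
  then have m: "orth_proj (image_span U (sup_proj \<P>)) = sup_proj \<Q>"
    by (simp add: Z_def sup_proj_def)
  have supA: "\<Squnion>\<^bsub>proj_lattice l2_space\<^esub> A = lift_op (sup_proj \<P>)"
    unfolding P(1) by (rule sup_proj_lattice[OF P(2)])
  have supQ: "\<Squnion>\<^bsub>proj_lattice l2_space\<^esub> (lift_op ` \<Q>) = lift_op (sup_proj \<Q>)"
    by (rule sup_proj_lattice[OF Q])
  show "Map l2_space l2_space (lift_op ` U) (\<Squnion>\<^bsub>proj_lattice l2_space\<^esub> A)
      = \<Squnion>\<^bsub>proj_lattice l2_space\<^esub> (Map l2_space l2_space (lift_op ` U) ` A)"
    unfolding img supA supQ Map_l2_space[OF is_proj_sup_proj] m ..
qed

text \<open>If \<open>Q S P = 0\<close> for the generator \<open>S\<close>, then \<open>Q\<close>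
  annihilates the range of the value of the map at \<open>P\<close>. So an operator that respects
  the map satisfies the defining conditions of the hull.\<close>

lemma reflexive_reflexive_hull: "reflexive l2_space l2_space (lift_op ` reflexive_hull S0)"
  unfolding reflexive_def
proof (intro bexI conjI)
  let ?M = "reflexive_hull S0"
  let ?f = "Map l2_space l2_space (lift_op ` ?M)"
  have f: "?f (lift_op P) = lift_op (orth_proj (image_span ?M P))" if "is_proj P" for P
    by (rule Map_l2_space[OF that])
  show "?f \<in> projs l2_space \<rightarrow> projs l2_space"
    using f is_proj_orth_proj[OF image_span_closed] by (auto simp: projs_l2_space)
  show "sup_pres (proj_lattice l2_space) (proj_lattice l2_space) ?f"
    by (rule sup_pres_Map) (rule reflexive_hull_bclinear)
  have "image_span ?M (\<lambda>x. 0) \<subseteq> {0}"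
    unfolding image_span_def
    by (rule closure_cspan_minimal) (auto simp: bclinear_simps[OF reflexive_hull_bclinear] csubspace_def)
  then have "orth_proj (image_span ?M (\<lambda>x. 0)) = (\<lambda>x. 0)"
    using orth_proj_in[OF image_span_closed, of ?M "\<lambda>x. 0"] by (auto simp: fun_eq_iff)
  then show "?f \<zero>\<^bsub>op_space l2_space l2_space\<^esub> = \<zero>\<^bsub>op_space l2_space l2_space\<^esub>"
    by (simp add: zero_op_space f[OF is_proj_0])
  have comp: "compose (carrier l2_space) (proj_perp l2_space (?f (lift_op P))) (compose (carrier l2_space) (lift_op T) (lift_op P))
      = \<zero>\<^bsub>op_space l2_space l2_space\<^esub> \<longleftrightarrow> (\<forall>x. T (P x) \<in> image_span ?M P)" if "is_proj P" for T P
  proof -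
    have "(T (P x) - orth_proj (image_span ?M P) (T (P x)) = 0) \<longleftrightarrow> T (P x) \<in> image_span ?M P" for x
      using orth_proj_in[OF image_span_closed, of ?M P "T (P x)"] orth_proj_fix[OF image_span_closed, of "T (P x)" ?M P] by auto
    then show ?thesis
      unfolding f[OF that] proj_perp_lift_op zero_op_space compose_lift_op lift_op_eq_iff
      by (simp only: fun_eq_iff)
  qed
  have "T \<in> ?M \<longleftrightarrow> bclinear T \<and> (\<forall>P. is_proj P \<longrightarrow> (\<forall>x. T (P x) \<in> image_span ?M P))" for T
  proof
    assume "T \<in> ?M"
    then show "bclinear T \<and> (\<forall>P. is_proj P \<longrightarrow> (\<forall>x. T (P x) \<in> image_span ?M P))"
      using reflexive_hull_bclinear image_span_mem by blast
  next
    assume T: "bclinear T \<and> (\<forall>P. is_proj P \<longrightarrow> (\<forall>x. T (P x) \<in> image_span ?M P))"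
    show "T \<in> ?M"
    proof (rule reflexive_hullI)
      fix P Q x assume PQ: "conv_proj P" "conv_proj Q" "\<And>x. Q (S0 (P x)) = 0"
      have "image_span ?M P \<subseteq> {y. Q y = 0}"
        unfolding image_span_def
      proof (rule closure_cspan_minimal)
        show "{S x | S x. S \<in> ?M \<and> x \<in> range P} \<subseteq> {y. Q y = 0}"
        proof
          fix z assume "z \<in> {S x | S x. S \<in> ?M \<and> x \<in> range P}"
          then obtain S y where S: "S \<in> ?M" "z = S (P y)"
            by blast
          show "z \<in> {y. Q y = 0}"
            using reflexive_hullD[OF S(1) PQ] S(2) by simp
        qed
      qed (rule closed_bclinear_eq[OF conv_proj_bclinear[OF PQ(2)] bclinear_0])+
      then show "Q (T (P x)) = 0"
        using T PQ(1) by (auto simp: conv_proj_def)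
    qed (use T in blast)
  qed
  then show "lift_op ` ?M = {T \<in> bounded_op l2_space l2_space. \<forall>P\<in>projs l2_space.
      compose (carrier l2_space) (proj_perp l2_space (?f P)) (compose (carrier l2_space) T P)
        = \<zero>\<^bsub>op_space l2_space l2_space\<^esub>}"
    unfolding bounded_op_l2_space projs_l2_space using comp by auto
qed

text \<open>The complement is a union of the basic open sets for the open set \<open>- {0}\<close>
  of scalars.\<close>

lemma closedin_weak_star:
  fixes F :: "((nat \<Rightarrow> ell2) \<times> (nat \<Rightarrow> ell2)) set"
  assumes F: "\<And>x y. (x, y) \<in> F \<Longrightarrow> summable (\<lambda>n. (norm (x n))\<^sup>2) \<and> summable (\<lambda>n. (norm (y n))\<^sup>2)"
  shows "closedin (weak_star l2_space l2_space)
    (lift_op ` {T. bclinear T \<and> (\<forall>(x, y)\<in>F. (\<Sum>n. cin (T (x n)) (y n)) = 0)})"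
proof -
  define N where "N x y W = {T \<in> bounded_op l2_space l2_space. (\<Sum>n. cinner l2_space (T (x n)) (y n)) \<in> W}"
    for x y :: "nat \<Rightarrow> nat \<Rightarrow> complex" and W :: "complex set"
  have N_open: "openin (weak_star l2_space l2_space) (N (\<lambda>n. coef (x n)) (\<lambda>n. coef (y n)) W)"
    if "summable (\<lambda>n. (norm (x n))\<^sup>2)" "summable (\<lambda>n. (norm (y n))\<^sup>2)" "open W" for x y W
    unfolding weak_star_def
  proof (rule topology_generated_by_Basis, rule CollectI, intro exI conjI)
    show "N (\<lambda>n. coef (x n)) (\<lambda>n. coef (y n)) W = {T \<in> bounded_op l2_space l2_space.
        (\<Sum>n. cinner l2_space (T (coef (x n))) (coef (y n))) \<in> W}"
      by (simp add: N_def)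
  qed (use that in auto)
  have "topspace (weak_star l2_space l2_space) \<subseteq> bounded_op l2_space l2_space"
    unfolding weak_star_def by auto
  moreover have "bounded_op l2_space l2_space = N (\<lambda>n. coef 0) (\<lambda>n. coef 0) UNIV"
    by (simp add: N_def)
  then have "bounded_op l2_space l2_space \<subseteq> topspace (weak_star l2_space l2_space)"
    using openin_subset[OF N_open[of "\<lambda>_. 0" "\<lambda>_. 0" UNIV]] by simp
  ultimately have top: "topspace (weak_star l2_space l2_space) = bounded_op l2_space l2_space"
    by blast
  let ?S = "lift_op ` {T. bclinear T \<and> (\<forall>(x, y)\<in>F. (\<Sum>n. cin (T (x n)) (y n)) = 0)}"
  have "bounded_op l2_space l2_space - ?S = (\<Union>(x, y)\<in>F. N (\<lambda>n. coef (x n)) (\<lambda>n. coef (y n)) (- {0}))"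
  proof (intro Set.set_eqI iffI)
    fix A assume A: "A \<in> bounded_op l2_space l2_space - ?S"
    then obtain T where T: "A = lift_op T" "bclinear T"
      by (auto simp: bounded_op_l2_space)
    have "T \<notin> {T. bclinear T \<and> (\<forall>(x, y)\<in>F. (\<Sum>n. cin (T (x n)) (y n)) = 0)}"
      using A unfolding T(1) Diff_iff lift_op_mem_iff by simp
    with T(2) obtain x y where "(x, y) \<in> F" "(\<Sum>n. cin (T (x n)) (y n)) \<noteq> 0"
      by auto
    moreover from this have "A \<in> N (\<lambda>n. coef (x n)) (\<lambda>n. coef (y n)) (- {0})"
      using A T by (simp add: N_def)
    ultimately show "A \<in> (\<Union>(x, y)\<in>F. N (\<lambda>n. coef (x n)) (\<lambda>n. coef (y n)) (- {0}))"
      by blast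
  next
    fix A assume "A \<in> (\<Union>(x, y)\<in>F. N (\<lambda>n. coef (x n)) (\<lambda>n. coef (y n)) (- {0}))"
    then obtain x y where xy: "(x, y) \<in> F" "A \<in> N (\<lambda>n. coef (x n)) (\<lambda>n. coef (y n)) (- {0})"
      by blast
    then obtain T where T: "A = lift_op T" "bclinear T"
      by (auto simp: N_def bounded_op_l2_space)
    then have "(\<Sum>n. cin (T (x n)) (y n)) \<noteq> 0"
      using xy(2) by (simp add: N_def)
    then show "A \<in> bounded_op l2_space l2_space - ?S"
      using xy T by (auto simp: bounded_op_l2_space)
  qed
  moreover have "openin (weak_star l2_space l2_space) (\<Union>(x, y)\<in>F. N (\<lambda>n. coef (x n)) (\<lambda>n. coef (y n)) (- {0}))"
    using F by (intro openin_Union) (auto intro!: N_open)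
  ultimately show ?thesis
    unfolding closedin_def top by (auto simp: bounded_op_l2_space)
qed

context phase
begin

text \<open>Both kinds of conditions, \<open>\<langle>T P x, Q y\<rangle> = 0\<close> and the
  weighted sum, are traces of \<open>T\<close> against trace class operators. For the weighted sum,
  the weight is split as a product of two factors of modulus
  \<open>sqrt (cmod (test_weight n))\<close>.\<close>

lemma weak_star_closed_sub_bimod: "closedin (weak_star l2_space l2_space) (lift_op ` sub_bimod)"
proof -
  define pt :: "ell2 \<Rightarrow> nat \<Rightarrow> ell2" where "pt z n = (if n = 0 then z else 0)" for z n
  define F1 :: "((nat \<Rightarrow> ell2) \<times> (nat \<Rightarrow> ell2)) set"
    where "F1 = {(pt (P x), pt (Q y)) | P Q x y.
      conv_proj P \<and> conv_proj Q \<and> (\<forall>x. Q (diag kernel_symbol (P x)) = 0)}"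
  define r where "r n = sqrt (cmod (test_weight n))" for n
  define lf :: "ell2 \<Rightarrow> nat \<Rightarrow> ell2" where "lf x n = (test_weight n / r n) *\<^sub>C shift n x" for x n
  define rt :: "ell2 \<Rightarrow> nat \<Rightarrow> ell2" where "rt y n = complex_of_real (r n) *\<^sub>C shift n y" for y n
  define F2 :: "((nat \<Rightarrow> ell2) \<times> (nat \<Rightarrow> ell2)) set"
    where "F2 = {(lf x, rt y) | x y. True}"
  have r2: "(r n)\<^sup>2 = cmod (test_weight n)" "r n * r n = cmod (test_weight n)" for n
    by (simp_all add: r_def)
  have wr: "test_weight n / r n * r n = test_weight n" for n
    by (cases "test_weight n = 0") (auto simp: r_def)
  have wn: "(cmod (test_weight n / r n))\<^sup>2 = cmod (test_weight n)" for n
  proof (cases "test_weight n = 0")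
    case False
    then show ?thesis
      by (simp add: norm_divide power_divide r_def) (simp add: power2_eq_square)
  qed simp
  have "summable (\<lambda>n. cmod (test_weight n))"
    using summable_on_imp_summable[OF test_weight_abs] .
  then have ws: "summable (\<lambda>n. cmod (test_weight n) * c)" for c
    by (rule summable_mult2)
  have "summable (\<lambda>n. (norm (x n))\<^sup>2) \<and> summable (\<lambda>n. (norm (y n))\<^sup>2)" if "(x, y) \<in> F1 \<union> F2" for x y
    using that
  proof
    assume "(x, y) \<in> F1"
    then have "\<And>n. n \<notin> {0} \<Longrightarrow> x n = 0" "\<And>n. n \<notin> {0} \<Longrightarrow> y n = 0"
      by (auto simp: F1_def pt_def)
    then show ?thesis
      by (intro conjI summable_finite[of "{0}"]) auto
  next
    assume "(x, y) \<in> F2"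
    then show ?thesis
      using ws by (auto simp: F2_def lf_def rt_def power_mult_distrib wn r2)
  qed
  note closed = closedin_weak_star[of "F1 \<union> F2", OF this]
  have 1: "(\<forall>(x, y)\<in>F1. (\<Sum>n. cin (T (x n)) (y n)) = 0) \<longleftrightarrow> T \<in> refl_bimod" if T: "bclinear T" for T
  proof -
    have sum: "(\<Sum>n. cin (T (pt a n)) (pt c n)) = cin (T a) c" for a c
    proof -
      have "(\<Sum>n. cin (T (pt a n)) (pt c n)) = (\<Sum>n\<in>{0::nat}. cin (T (pt a n)) (pt c n))"
        by (rule suminf_finite) (auto simp: pt_def)
      then show ?thesis
        by (simp add: pt_def)
    qed
    have z: "(\<forall>y. cin (T (P x)) (Q y) = 0) \<longleftrightarrow> Q (T (P x)) = 0" if "conv_proj Q" for P Q x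
    proof
      have adj: "cin (T (P x)) (Q y) = cin (Q (T (P x))) y" for y
        using that is_projD(3)[of Q] by (simp add: conv_proj_def)
      show "Q (T (P x)) = 0" if "\<forall>y. cin (T (P x)) (Q y) = 0"
        using that[unfolded adj, rule_format, of "Q (T (P x))"] by (simp add: cin_self)
      show "\<forall>y. cin (T (P x)) (Q y) = 0" if "Q (T (P x)) = 0"
        unfolding adj that by simp
    qed
    have "(\<forall>(x, y)\<in>F1. (\<Sum>n. cin (T (x n)) (y n)) = 0) \<longleftrightarrow>
        (\<forall>P Q x y. conv_proj P \<and> conv_proj Q \<and> (\<forall>x. Q (diag kernel_symbol (P x)) = 0) \<longrightarrow>
          (\<Sum>n. cin (T (pt (P x) n)) (pt (Q y) n)) = 0)"
      unfolding F1_def by blast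
    also have "\<dots> \<longleftrightarrow> (\<forall>P Q. conv_proj P \<and> conv_proj Q \<and> (\<forall>x. Q (diag kernel_symbol (P x)) = 0) \<longrightarrow> (\<forall>x. Q (T (P x)) = 0))"
      unfolding sum
    proof (intro iff_allI)
      fix P Q
      show "(\<forall>x y. conv_proj P \<and> conv_proj Q \<and> (\<forall>x. Q (diag kernel_symbol (P x)) = 0) \<longrightarrow> cin (T (P x)) (Q y) = 0)
          \<longleftrightarrow> (conv_proj P \<and> conv_proj Q \<and> (\<forall>x. Q (diag kernel_symbol (P x)) = 0) \<longrightarrow> (\<forall>x. Q (T (P x)) = 0))"
        by (cases "conv_proj Q") (simp_all add: z)
    qed
    finally show ?thesis
      using T unfolding refl_bimod_def reflexive_hull_def by simp
  qed
  have 2: "(\<forall>(x, y)\<in>F2. (\<Sum>n. cin (T (x n)) (y n)) = 0) \<longleftrightarrow>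
      (\<forall>x y. (\<Sum>\<^sub>\<infinity>n. test_weight n * cin (T (shift n x)) (shift n y)) = 0)" if T: "bclinear T" for T
  proof -
    have eq: "(\<Sum>n. cin (T (lf x n)) (rt y n))
        = (\<Sum>\<^sub>\<infinity>n. test_weight n * cin (T (shift n x)) (shift n y))" for x y
    proof -
      have "cin (T (lf x n)) (rt y n)
          = (test_weight n / r n * r n) * cin (T (shift n x)) (shift n y)" for n
        by (simp add: lf_def rt_def bclinear_simps[OF T])
      then show ?thesis
        unfolding wr
        by (simp only: sums_unique[OF has_sum_imp_sums[OF has_sum_infsum[OF sub_bimod_summable[OF T]]]])
    qed
    have "(\<forall>(x, y)\<in>F2. (\<Sum>n. cin (T (x n)) (y n)) = 0) \<longleftrightarrow>
        (\<forall>x y. (\<Sum>n. cin (T (lf x n)) (rt y n)) = 0)"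
      unfolding F2_def by blast
    then show ?thesis
      by (simp only: eq)
  qed
  have "{T. bclinear T \<and> (\<forall>(x, y)\<in>F1 \<union> F2. (\<Sum>n. cin (T (x n)) (y n)) = 0)} = sub_bimod"
    unfolding sub_bimod_def ball_Un using 1 2 refl_bimod_bclinear by blast
  then show ?thesis
    using closed by simp
qed

lemma Map_sub_bimod: "Map l2_space l2_space (lift_op ` sub_bimod) = Map l2_space l2_space (lift_op ` refl_bimod)"
proof
  fix A
  show "Map l2_space l2_space (lift_op ` sub_bimod) A = Map l2_space l2_space (lift_op ` refl_bimod) A"
  proof (cases "A \<in> projs l2_space")
    case True
    then obtain P where P: "A = lift_op P" "is_proj P"
      by (auto simp: projs_l2_space)
    have "image_span sub_bimod P = image_span refl_bimod P"
    proof
      show "image_span sub_bimod P \<subseteq> image_span refl_bimod P"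
      proof -
        have "{S x | S x. S \<in> sub_bimod \<and> x \<in> range P} \<subseteq> {S x | S x. S \<in> refl_bimod \<and> x \<in> range P}"
          using sub_bimod_refl_bimod by blast
        also have "\<dots> \<subseteq> image_span refl_bimod P"
          unfolding image_span_def by (rule closure_cspan_superset)
        finally show ?thesis
          unfolding image_span_def[of sub_bimod] by (rule closure_cspan_minimal[OF _ image_span_closed(2,1)])
      qed
      have "S x \<in> image_span sub_bimod P" if "S \<in> refl_bimod" "x \<in> range P" for S x
      proof -
        have "{S x | S. S \<in> sub_bimod} \<subseteq> image_span sub_bimod P"
          using image_span_mem[of _ sub_bimod P] that(2) by auto
        then have "closure (cspan {S x | S. S \<in> sub_bimod}) \<subseteq> image_span sub_bimod P"
          by (rule closure_cspan_minimal[OF _ image_span_closed(2,1)])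
        then show ?thesis
          using refl_bimod_in_closure_sub_bimod[OF that(1)] by blast
      qed
      then show "image_span refl_bimod P \<subseteq> image_span sub_bimod P"
        unfolding image_span_def[of refl_bimod] by (intro closure_cspan_minimal[OF _ image_span_closed(2,1)]) blast
    qed
    then show ?thesis
      unfolding P(1) Map_l2_space[OF P(2)] by simp
  qed (simp add: Map_def)
qed

lemma bimodule_lift:
  assumes "\<And>T. T \<in> U \<Longrightarrow> bclinear T" "(\<lambda>x. 0) \<in> U" "\<And>S T. S \<in> U \<Longrightarrow> T \<in> U \<Longrightarrow> (\<lambda>x. S x + T x) \<in> U"
    "\<And>c T. T \<in> U \<Longrightarrow> (\<lambda>x. c *\<^sub>C T x) \<in> U"
    "\<And>A B T. T \<in> U \<Longrightarrow> A \<in> conv_ops \<Longrightarrow> B \<in> conv_ops \<Longrightarrow> (\<lambda>x. B (T (A x))) \<in> U"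
  shows "bimodule l2_space l2_space (lift_op ` conv_ops) (lift_op ` conv_ops) (lift_op ` U)"
  unfolding bimodule_def
proof (intro conjI ballI)
  show "submodule (lift_op ` U) complex_ring (op_space l2_space l2_space)"
    by (rule submodule_op_space) (use assms in blast)+
  fix B T A assume "B \<in> lift_op ` conv_ops" "T \<in> lift_op ` U" "A \<in> lift_op ` conv_ops"
  then obtain B' T' A' where "B = lift_op B'" "T = lift_op T'" "A = lift_op A'"
    "B' \<in> conv_ops" "T' \<in> U" "A' \<in> conv_ops"
    by blast
  then show "compose (carrier l2_space) B (compose (carrier l2_space) T A) \<in> lift_op ` U"
    using assms(5) by (simp add: lift_op_mem_iff)
qed

lemma bimodule_refl_bimod: "bimodule l2_space l2_space (lift_op ` conv_ops) (lift_op ` conv_ops) (lift_op ` refl_bimod)"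
  unfolding refl_bimod_def
proof (rule bimodule_lift)
  show "bclinear T" if "T \<in> reflexive_hull (diag kernel_symbol)" for T
    by (rule reflexive_hull_bclinear[OF that])
qed (rule reflexive_hull_0 reflexive_hull_add reflexive_hull_cscale reflexive_hull_bimodule; assumption)+

lemma bimodule_sub_bimod: "bimodule l2_space l2_space (lift_op ` conv_ops) (lift_op ` conv_ops) (lift_op ` sub_bimod)"
proof (rule bimodule_lift)
  show "bclinear T" if "T \<in> sub_bimod" for T
    using that sub_bimod_refl_bimod refl_bimod_bclinear by blast
qed (rule sub_bimod_0 sub_bimod_add sub_bimod_cscale sub_bimod_bimodule; assumption)+

lemma thin_refl_bimod: "thin l2_space l2_space (lift_op ` conv_ops) (lift_op ` conv_ops) (lift_op ` refl_bimod)"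
proof -
  have bim: "(\<lambda>x. B (T (A x))) \<in> refl_bimod" if "T \<in> refl_bimod" "A \<in> conv_ops" "B \<in> conv_ops" for A B T
    using reflexive_hull_bimodule that unfolding refl_bimod_def by blast
  have "{A \<in> bounded_op l2_space l2_space. \<forall>T\<in>lift_op ` refl_bimod. compose (carrier l2_space) T A \<in> lift_op ` refl_bimod} = lift_op ` conv_ops"
    unfolding bounded_op_l2_space
    using right_multipliers_in_conv_ops conv_ops_bclinear bim[OF _ _ conv_ops_id] by (auto simp: lift_op_mem_iff)
  moreover have "{B \<in> bounded_op l2_space l2_space. \<forall>T\<in>lift_op ` refl_bimod. compose (carrier l2_space) B T \<in> lift_op ` refl_bimod} = lift_op ` conv_ops"
    unfolding bounded_op_l2_space
    using left_multipliers_in_conv_ops conv_ops_bclinear bim[OF _ conv_ops_id] by (auto simp: lift_op_mem_iff)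
  ultimately show ?thesis
    unfolding thin_def by blast
qed

lemma not_synthetic_refl_bimod: "\<not> synthetic l2_space l2_space (lift_op ` conv_ops) (lift_op ` conv_ops) (lift_op ` refl_bimod)"
proof
  assume "synthetic l2_space l2_space (lift_op ` conv_ops) (lift_op ` conv_ops) (lift_op ` refl_bimod)"
  moreover have "lift_op ` sub_bimod \<in> {U. bimodule l2_space l2_space (lift_op ` conv_ops) (lift_op ` conv_ops) U \<and>
      closedin (weak_star l2_space l2_space) U \<and>
      Map l2_space l2_space U = Map l2_space l2_space (lift_op ` refl_bimod)}"
    by (intro CollectI conjI bimodule_sub_bimod weak_star_closed_sub_bimod Map_sub_bimod)
  ultimately have "lift_op ` sub_bimod = lift_op ` refl_bimod"
    by (simp only: synthetic_def singleton_iff)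
  then have "sub_bimod = refl_bimod"
    using inj_image_eq_iff[OF inj_lift_op] by blast
  then show False
    using level_deriv_refl_bimod level_deriv_not_sub_bimod by blast
qed

end

section \<open>The example\<close>

theorem theorem3p5:
  shows "\<exists>(H1 :: (nat \<Rightarrow> complex) cinner_space) (H2 :: (nat \<Rightarrow> complex) cinner_space) D1 D2 M.
    complex_hilbert_space H1 \<and> separable_space (htop H1) \<and>
    complex_hilbert_space H2 \<and> separable_space (htop H2) \<and>
    masa H1 D1 \<and> masa H2 D2 \<and>
    bimodule H1 H2 D2 D1 M \<and> reflexive H1 H2 M \<and>
    thin H1 H2 D2 D1 M \<and> \<not> synthetic H1 H2 D2 D1 M"
proof -
  obtain e b where "phase e b"
    using phase_exists by blast
  then interpret phase e b .
  have "reflexive l2_space l2_space (lift_op ` refl_bimod)"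
    unfolding refl_bimod_def by (rule reflexive_reflexive_hull)
  then show ?thesis
    using complex_hilbert_space_l2_space separable_l2_space masa_conv_ops bimodule_refl_bimod thin_refl_bimod not_synthetic_refl_bimod
    by blast
qed

end
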